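(* Let $d\geqslant 1$, let $\mathbb{E}^d$ be the set of nearest-neighbour edges of $\mathbb{Z}^d$, let $J>0$, $h^*>0$ and $\alpha\in[0,1)$, and let $\pmb{h}=(h_i:i\in\mathbb{Z}^d)$ be the magnetic field $h_i=h^*/\|i\|^{\alpha}$ for $i\neq 0$ and $h_0=h^*$. Then for every inverse temperature $\beta>0$ the set $\mathscr{G}^{\mathrm{Ising}}_{\beta}(J,\pmb{h})$ of infinite-volume Gibbs measures of the ferromagnetic nearest-neighbour Ising model on $\mathbb{Z}^d$ with coupling constant $J$ and magnetic field $\pmb{h}$ is a singleton.
   Context: $\|\cdot\|$ is a fixed norm on $\mathbb{R}^d$. Configurations are $\sigma\in\Sigma=\{-1,+1\}^{\mathbb{Z}^d}$. For a finite $V\subset\mathbb{Z}^d$, $\partial V$ denotes the set of vertices outside $V$ at graph distance $1$ from $V$. For a boundary condition $\mu\in\Sigma$ the Hamiltonian is $$\mathscr{H}^{\mu}_{V}(\sigma)=-\sum_{\{i,j\}\in\mathbb{E}^d,\ i,j\in V}J\sigma_i\sigma_j-\sum_{i\in V}h_i\sigma_i-\sum_{i\in V,\ j\in\partial V,\ \{i,j\}\in\mathbb{E}^d}J\sigma_i\mu_j .$$ The finite-volume Gibbs measure $\lambda^{\mu}_{\beta,\pmb{h},V}$ gives each $\sigma$ with $\sigma=\mu$ outside $V$ a probability proportional to $\exp(-\beta\mathscr{H}^{\mu}_{V}(\sigma))$, and gives probability $0$ to all other configurations. $\mathscr{G}^{\mathrm{Ising}}_{\beta}(J,\pmb{h})$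 is the closure of the convex hull of the set of all weak limits of $\lambda^{\mu_n}_{\beta,\pmb{h},V_n}$ along increasing sequences of finite volumes $V_n\uparrow\mathbb{Z}^d$, with arbitrary sequences of boundary conditions $\mu_n$. *)

theory Defs
  imports "HOL-Probability.Probability"
begin

definition is_norm :: "('v::real_vector \<Rightarrow> real) \<Rightarrow> bool" where
  "is_norm N \<longleftrightarrow>
     (\<forall>x. N x \<ge> 0) \<and>
     (\<forall>x. N x = 0 \<longleftrightarrow> x = 0) \<and>
     (\<forall>a x. N (a *\<^sub>R x) = \<bar>a\<bar> * N x) \<and>
     (\<forall>x y. N (x + y) \<le> N x + N y)"

text \<open>The lattice of dimension \<open>d\<close> is the type \<^typ>\<open>int ^ 'd\<close> with \<open>d = CARD('d)\<close>, so that
  \<open>d \<ge> 1\<close> is automatic.\<close>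

definition real_vec :: "int ^ 'd \<Rightarrow> real ^ 'd" where
  "real_vec i = (\<chi> k. real_of_int (i $ k))"

definition nn_edges :: "(int ^ 'd) set set" where
  "nn_edges = {{i, j} | i j. (\<Sum>k\<in>UNIV. \<bar>i $ k - j $ k\<bar>) = 1}"

definition outer_boundary :: "(int ^ 'd) set \<Rightarrow> (int ^ 'd) set" where
  "outer_boundary V = {j. j \<notin> V \<and> (\<exists>i\<in>V. {i, j} \<in> nn_edges)}"

type_synonym 'd config = "int ^ 'd \<Rightarrow> real"

definition configs :: "'d config set" where
  "configs = {\<sigma>. \<forall>i. \<sigma> i \<in> {-1, 1}}"

definition config_top :: "'d config topology" where
  "config_top = product_topology (\<lambda>_. discrete_topology {-1, 1}) UNIV"

text \<open>As the lattice is countable, the product \<open>\<sigma>\<close>-algebra is the Borel \<open>\<sigma>\<close>-algebra of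
  \<open>config_top\<close>.\<close>

definition config_space :: "'d config measure" where
  "config_space = (\<Pi>\<^sub>M i\<in>UNIV. count_space {-1, 1})"

text \<open>In the first sum an edge is an unordered pair \<open>e = {i, j}\<close> with \<open>i \<noteq> j\<close>, so
  \<open>\<Prod>k\<in>e. \<sigma> k\<close> is \<open>\<sigma> i * \<sigma> j\<close>.\<close>

definition hamiltonian ::
  "real \<Rightarrow> (int ^ 'd \<Rightarrow> real) \<Rightarrow> (int ^ 'd) set \<Rightarrow> 'd config \<Rightarrow> 'd config \<Rightarrow> real" where
  "hamiltonian J h V \<mu> \<sigma> =
     - (\<Sum>e\<in>{e \<in> nn_edges. e \<subseteq> V}. J * (\<Prod>k\<in>e. \<sigma> k))
     - (\<Sum>i\<in>V. h i * \<sigma> i)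
     - (\<Sum>(i, j)\<in>{(i, j). i \<in> V \<and> j \<in> outer_boundary V \<and> {i, j} \<in> nn_edges}. J * \<sigma> i * \<mu> j)"

definition bc_configs :: "(int ^ 'd) set \<Rightarrow> 'd config \<Rightarrow> 'd config set" where
  "bc_configs V \<mu> = {\<sigma> \<in> configs. \<forall>i. i \<notin> V \<longrightarrow> \<sigma> i = \<mu> i}"

definition partition_fun ::
  "real \<Rightarrow> real \<Rightarrow> (int ^ 'd \<Rightarrow> real) \<Rightarrow> (int ^ 'd) set \<Rightarrow> 'd config \<Rightarrow> real" where
  "partition_fun \<beta> J h V \<mu> = (\<Sum>\<sigma>\<in>bc_configs V \<mu>. exp (- \<beta> * hamiltonian J h V \<mu> \<sigma>))"

definition gibbs_measure ::
  "real \<Rightarrow> real \<Rightarrow> (int ^ 'd \<Rightarrow> real) \<Rightarrow> (int ^ 'd) set \<Rightarrow> 'd config \<Rightarrow> 'd config measure" where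
  "gibbs_measure \<beta> J h V \<mu> =
     distr (point_measure (bc_configs V \<mu>)
              (\<lambda>\<sigma>. ennreal (exp (- \<beta> * hamiltonian J h V \<mu> \<sigma>) / partition_fun \<beta> J h V \<mu>)))
           config_space (\<lambda>\<sigma>. \<sigma>)"

text \<open>The topology of weak convergence on the probability measures on \<open>config_space\<close>: the coarsest
  one for which \<open>M \<mapsto> \<integral>f dM\<close> is continuous for every bounded continuous \<open>f\<close>.\<close>

definition weak_topology :: "'d config measure topology" where
  "weak_topology = topology_generated_by
     {{M \<in> space (prob_algebra config_space). (\<integral>\<sigma>. f \<sigma> \<partial>M) \<in> U} | f U.
        continuous_map config_top euclideanreal f \<and> bounded (f ` topspace config_top) \<and> open U}"

definition weak_gibbs_limits ::
  "real \<Rightarrow> real \<Rightarrow> (int ^ 'd \<Rightarrow> real) \<Rightarrow> 'd config measure set" where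
  "weak_gibbs_limits \<beta> J h =
     {M. \<exists>V \<mu>. (\<forall>n. finite (V n)) \<and> incseq V \<and> (\<Union>n. V n) = UNIV \<and> (\<forall>n. \<mu> n \<in> configs) \<and>
        limitin weak_topology (\<lambda>n. gibbs_measure \<beta> J h (V n) (\<mu> n)) M sequentially}"

definition measure_convex_hull :: "'d config measure set \<Rightarrow> 'd config measure set" where
  "measure_convex_hull S =
     {M \<in> space (prob_algebra config_space). \<exists>(n::nat) w N.
        (\<forall>k<n. 0 \<le> w k \<and> N k \<in> S) \<and> (\<Sum>k<n. w k) = 1 \<and>
        (\<forall>A\<in>sets config_space. measure M A = (\<Sum>k<n. w k * measure (N k) A))}"

definition ising_gibbs_measures ::
  "real \<Rightarrow> real \<Rightarrow> (int ^ 'd \<Rightarrow> real) \<Rightarrow> 'd config measure set" where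
  "ising_gibbs_measures \<beta> J h =
     weak_topology closure_of (measure_convex_hull (weak_gibbs_limits \<beta> J h))"

definition decaying_field :: "(real ^ 'd \<Rightarrow> real) \<Rightarrow> real \<Rightarrow> real \<Rightarrow> int ^ 'd \<Rightarrow> real" where
  "decaying_field N hs \<alpha> i = (if i = 0 then hs else hs / N (real_vec i) powr \<alpha>)"

end

theory Submission
  imports Defs
begin

text \<open>Why the Gibbs measure is unique. Write \<open>\<langle>\<sigma>\<^sub>i\<rangle>\<^sup>+\<close> and \<open>\<langle>\<sigma>\<^sub>i\<rangle>\<^sup>-\<close> for the mean of a spin in a finite
  volume \<open>V\<close> with constant boundary condition \<open>+1\<close> and \<open>-1\<close>, and call
  \<open>\<langle>\<sigma>\<^sub>i\<rangle>\<^sup>+ - \<langle>\<sigma>\<^sub>i\<rangle>\<^sup>-\<close> the gap at \<open>i\<close>. Every finite-volume state lies, in the sense of expectations of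
  increasing functions, between the minus and the plus state of any smaller volume
  (\<open>gexp_le_plus\<close>, \<open>gexp_ge_minus\<close>), and the difference of these two states on the event that all
  spins of a finite set are \<open>+1\<close> is at most half the sum of the gaps over that set
  (\<open>cylinder_gap_le\<close>). So if the gap at each site tends to \<open>0\<close> along some volumes, all finite-volume
  expectations of local functions converge, uniformly in the boundary condition
  (\<open>tendsto_local_limit\<close>), and there is exactly one limit measure.

That the gap vanishes rests on three facts.

\<^item> The gap decreases when a nonnegative field is increased (\<open>spin_mean_gap_antimono\<close>). Take
  independent copies \<open>\<sigma>\<close>, \<open>\<tau>\<close> with plus and minus boundary condition and let \<open>T\<close> be the random set on
  which they differ. Given \<open>T\<close>, the copy \<open>\<sigma>\<close> is an Ising model of doubled coupling which is decoupled
  between \<open>T\<close>, where it feels only the boundary, and the complement of \<open>T\<close>, where it feels only the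
  field. All these couplings are nonnegative, so Griffiths' inequality makes the law of \<open>T\<close>
  log-supermodular, makes the mean of \<open>\<sigma>\<^sub>i\<close> increase with \<open>T\<close>, and makes the effect of a larger
  field on the weight of \<open>T\<close> decrease with \<open>T\<close>; the four functions theorem of Ahlswede and Daykin
  concludes.

\<^item> The total \<open>\<Sum>i\<in>V. h i * gap i\<close> is at most a constant times the number of boundary edges
  (\<open>sum_field_gap_le_boundary\<close>): it bounds from below the \<open>t\<close>-derivative, for \<open>t\<close> in \<open>[0, 1]\<close>, of the
  logarithm of the quotient of the plus and minus partition functions in the field \<open>t * h\<close>, and this
  logarithm is of boundary order.

\<^item> For a constant field \<open>\<epsilon>\<close>, translation invariance and monotonicity in the volume turn this bound on
  a sum into a bound at a single site: in the box of radius \<open>2 * n\<close> the gap at the centre is at most of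
  order \<open>1 / (n * \<epsilon>)\<close> (\<open>gap_constant_field\<close>).

On the box of radius \<open>2 * n\<close> the decaying field is at least of order \<open>n powr - \<alpha>\<close>, so by the first fact
the gap at the centre is at most of order \<open>n powr (\<alpha> - 1)\<close>, which tends to \<open>0\<close> since \<open>\<alpha> < 1\<close>.\<close>

section \<open>The four functions theorem and Griffiths' inequalities\<close>

text \<open>The theorem on a one-point ground set. If \<open>p = c1 * d0\<close> is positive, the conditions on \<open>a0 * b0\<close> and
\<open>a1 * b1\<close> bound \<open>c0\<close> and \<open>d1\<close> from below, and the claim becomes
\<open>0 \<le> (p - a0 * b1) * (p - a1 * b0)\<close>.\<close>

lemma four_functions_base:
  fixes a0 a1 b0 b1 c0 c1 d0 d1 :: real
  assumes nn: "0 \<le> a0" "0 \<le> a1" "0 \<le> b0" "0 \<le> b1" "0 \<le> c0" "0 \<le> c1" "0 \<le> d0" "0 \<le> d1"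
    and "a0 * b0 \<le> c0 * d0" and "a0 * b1 \<le> c1 * d0"
    and "a1 * b0 \<le> c1 * d0" and "a1 * b1 \<le> c1 * d1"
  shows "(a0 + a1) * (b0 + b1) \<le> (c0 + c1) * (d0 + d1)"
proof (cases "c1 * d0 = 0")
  case True
  then have "a0 * b1 = 0" "a1 * b0 = 0"
    using assms(10,11) mult_nonneg_nonneg[OF nn(1) nn(4)] mult_nonneg_nonneg[OF nn(2) nn(3)]
    by linarith+
  moreover have "0 \<le> c0 * d1" using nn by simp
  moreover have "(a0 + a1) * (b0 + b1) = a0 * b0 + a0 * b1 + a1 * b0 + a1 * b1"
    "(c0 + c1) * (d0 + d1) = c0 * d0 + c0 * d1 + c1 * d0 + c1 * d1"
    by algebra+
  ultimately show ?thesis using assms True by linarith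
next
  case False
  define p where "p = c1 * d0"
  have p: "p > 0" using False nn by (simp add: p_def less_le)
  have "0 \<le> (p - a0 * b1) * (p - a1 * b0)"
    using assms by (intro mult_nonneg_nonneg) (auto simp: p_def)
  then have 1: "p * (a0 * b1 + a1 * b0) \<le> p * p + (a0 * b0) * (a1 * b1)"
    by (simp add: algebra_simps)
  have 2: "(a0 * b0) * (a1 * b1) \<le> (c0 * d0) * (c1 * d1)"
    by (rule mult_mono[OF assms(9,12)]) (use nn in auto)
  have 3: "(c0 * d0) * (c1 * d1) = p * (c0 * d1)" by (simp add: p_def)
  have "p * (a0 * b1 + a1 * b0) \<le> p * (p + c0 * d1)"
    using 1 2 3 unfolding distrib_left by linarith
  then have "a0 * b1 + a1 * b0 \<le> p + c0 * d1"
    using p by (simp only: mult_le_cancel_left_pos)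
  then show ?thesis using assms by (simp add: algebra_simps p_def)
qed

lemma sum_Pow_insert:
  fixes f :: "'a set \<Rightarrow> real"
  assumes "finite V" "x \<notin> V"
  shows "sum f (Pow (insert x V)) = (\<Sum>A\<in>Pow V. f A + f (insert x A))"
proof -
  have "sum f (Pow (insert x V)) = sum f (Pow V) + sum f (insert x ` Pow V)"
    unfolding Pow_insert using assms by (intro sum.union_disjoint) auto
  also have "sum f (insert x ` Pow V) = (\<Sum>A\<in>Pow V. f (insert x A))"
    using assms(2) by (subst sum.reindex) (auto simp: inj_on_def intro: insert_ident[THEN iffD1])
  finally show ?thesis by (simp add: sum.distrib)
qed

text \<open>Ahlswede and Daykin: each ground-set point is summed out in turn, and summing one out preserves the
hypothesis by the one-point case.\<close>

theorem four_functions: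
  fixes \<alpha> \<beta> \<gamma> \<delta> :: "'a set \<Rightarrow> real"
  assumes "finite V"
    and "\<And>A. A \<subseteq> V \<Longrightarrow> 0 \<le> \<alpha> A" and "\<And>A. A \<subseteq> V \<Longrightarrow> 0 \<le> \<beta> A"
    and "\<And>A. A \<subseteq> V \<Longrightarrow> 0 \<le> \<gamma> A" and "\<And>A. A \<subseteq> V \<Longrightarrow> 0 \<le> \<delta> A"
    and "\<And>A B. A \<subseteq> V \<Longrightarrow> B \<subseteq> V \<Longrightarrow> \<alpha> A * \<beta> B \<le> \<gamma> (A \<union> B) * \<delta> (A \<inter> B)"
  shows "sum \<alpha> (Pow V) * sum \<beta> (Pow V) \<le> sum \<gamma> (Pow V) * sum \<delta> (Pow V)"
  using assms
proof (induction V arbitrary: \<alpha> \<beta> \<gamma> \<delta> rule: finite_induct)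
  case empty
  show ?case using empty(5)[of "{}" "{}"] by simp
next
  case (insert x V)
  define s :: "('a set \<Rightarrow> real) \<Rightarrow> 'a set \<Rightarrow> real" where "s f A = f A + f (insert x A)" for f A
  have nn: "0 \<le> \<alpha> A" "0 \<le> \<beta> A" "0 \<le> \<gamma> A" "0 \<le> \<delta> A" if "A \<subseteq> insert x V" for A
    using insert.prems that by auto
  have le: "\<alpha> A * \<beta> B \<le> \<gamma> C * \<delta> D"
    if "A \<subseteq> insert x V" "B \<subseteq> insert x V" "C = A \<union> B" "D = A \<inter> B" for A B C D
    using insert.prems(5) that by auto
  have "sum (s \<alpha>) (Pow V) * sum (s \<beta>) (Pow V) \<le> sum (s \<gamma>) (Pow V) * sum (s \<delta>) (Pow V)"
  proof (rule insert.IH)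
    fix A B assume AB: "A \<subseteq> V" "B \<subseteq> V"
    show "s \<alpha> A * s \<beta> B \<le> s \<gamma> (A \<union> B) * s \<delta> (A \<inter> B)"
      unfolding s_def
      by (rule four_functions_base; (rule nn le)?) (use AB insert.hyps in auto)
  qed (auto simp: s_def intro!: add_nonneg_nonneg nn)
  then show ?case
    using insert.hyps by (simp add: sum_Pow_insert s_def)
qed

text \<open>Spins outside \<open>V\<close> are pinned to \<open>1\<close>, so that the set is a finite group under pointwise multiplication.\<close>

definition spins :: "'a set \<Rightarrow> ('a \<Rightarrow> real) set" where
  "spins V = {\<sigma>. (\<forall>i\<in>V. \<sigma> i \<in> {-1, 1}) \<and> (\<forall>i. i \<notin> V \<longrightarrow> \<sigma> i = 1)}"

lemma spins_cases: "\<sigma> \<in> spins V \<Longrightarrow> \<sigma> i = 1 \<or> \<sigma> i = -1"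
  by (cases "i \<in> V") (auto simp: spins_def)

lemma spins_sq: "\<sigma> \<in> spins V \<Longrightarrow> \<sigma> i * \<sigma> i = 1"
  using spins_cases[of \<sigma> V i] by auto

lemma spins_mult: "\<sigma> \<in> spins V \<Longrightarrow> \<omega> \<in> spins V \<Longrightarrow> (\<lambda>i. \<sigma> i * \<omega> i) \<in> spins V"
  unfolding spins_def by fastforce

lemma bij_betw_spins: "bij_betw (\<lambda>T i. if i \<in> T then -1 else 1) (Pow V) (spins V)"
  by (rule bij_betw_byWitness[where f' = "\<lambda>\<sigma>. {i. \<sigma> i = -1}"])
     (auto simp: spins_def fun_eq_iff split: if_splits)

lemma finite_spins: "finite V \<Longrightarrow> finite (spins V)"
  using bij_betw_finite[OF bij_betw_spins, of V] by simp

lemma spins_nonempty: "spins V \<noteq> {}"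
proof -
  have "(\<lambda>_. 1) \<in> spins V" by (simp add: spins_def)
  then show ?thesis by blast
qed

lemma sum_spins_shift:
  assumes "\<omega> \<in> spins V"
  shows "(\<Sum>\<sigma>\<in>spins V. F (\<lambda>i. \<sigma> i * \<omega> i)) = (\<Sum>\<sigma>\<in>spins V. F \<sigma>)"
  by (rule sum.reindex_bij_witness[where i = "\<lambda>\<sigma> i. \<sigma> i * \<omega> i" and j = "\<lambda>\<sigma> i. \<sigma> i * \<omega> i"])
     (auto simp: mult.assoc spins_sq[OF assms] spins_mult[OF _ assms])

text \<open>Multiplication by the configuration that is \<open>-1\<close> at a single point of \<open>A\<close> changes the sign of the
monomial, so the sum vanishes unless \<open>A\<close> is empty.\<close>

lemma sum_spin_product_nonneg:
  assumes "finite V" "A \<subseteq> V"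
  shows "0 \<le> (\<Sum>\<sigma>\<in>spins V. prod \<sigma> A)"
proof (cases "A = {}")
  case False
  then obtain i where i: "i \<in> A" by blast
  define \<omega> :: "'a \<Rightarrow> real" where "\<omega> = (\<lambda>_. 1)(i := -1)"
  have \<omega>: "\<omega> \<in> spins V" using i assms by (auto simp: spins_def \<omega>_def)
  have "prod \<omega> A = -1"
    using i assms finite_subset[of A V]
    by (subst prod.remove[of A i]) (auto simp: \<omega>_def intro!: prod.neutral)
  then have "(\<Sum>\<sigma>\<in>spins V. prod \<sigma> A) = - (\<Sum>\<sigma>\<in>spins V. prod \<sigma> A)"
    using sum_spins_shift[OF \<omega>, of "\<lambda>\<sigma>. prod \<sigma> A"]
    by (simp add: prod.distrib sum_negf)
  then show ?thesis by simp
qed simp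

text \<open>Functions of positive type on the group of spin configurations: those with nonnegative Fourier
coefficients. Ferromagnetic energies belong to this class.\<close>

definition pos_fun :: "'a set \<Rightarrow> (('a \<Rightarrow> real) \<Rightarrow> real) \<Rightarrow> bool" where
  "pos_fun V F \<longleftrightarrow>
     (\<exists>c. (\<forall>A. 0 \<le> c A) \<and> (\<forall>\<sigma>\<in>spins V. F \<sigma> = (\<Sum>A\<in>Pow V. c A * prod \<sigma> A)))"

lemma pos_fun_cong:
  "pos_fun V F \<Longrightarrow> (\<And>\<sigma>. \<sigma> \<in> spins V \<Longrightarrow> F \<sigma> = G \<sigma>) \<Longrightarrow> pos_fun V G"
  unfolding pos_fun_def by metis

lemma pos_fun_monomial:
  assumes "finite V" "A \<subseteq> V" "0 \<le> c"
  shows "pos_fun V (\<lambda>\<sigma>. c * prod \<sigma> A)"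
  unfolding pos_fun_def
proof (intro exI[of _ "\<lambda>B. if B = A then c else 0"] conjI ballI)
  fix \<sigma> :: "'a \<Rightarrow> real"
  have "(\<Sum>B\<in>Pow V. (if B = A then c else 0) * prod \<sigma> B) =
      (\<Sum>B\<in>Pow V. if B = A then c * prod \<sigma> B else 0)"
    by (rule sum.cong) auto
  then show "c * prod \<sigma> A = (\<Sum>B\<in>Pow V. (if B = A then c else 0) * prod \<sigma> B)"
    using assms by (simp add: sum.delta)
qed (use assms in auto)

lemma pos_fun_const: "finite V \<Longrightarrow> 0 \<le> c \<Longrightarrow> pos_fun V (\<lambda>_. c)"
  using pos_fun_monomial[of V "{}" c] by simp

lemma pos_fun_spin: "finite V \<Longrightarrow> i \<in> V \<Longrightarrow> 0 \<le> c \<Longrightarrow> pos_fun V (\<lambda>\<sigma>. c * \<sigma> i)"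
  using pos_fun_monomial[of V "{i}" c] by simp

lemma pos_fun_add:
  assumes "pos_fun V F" "pos_fun V G"
  shows "pos_fun V (\<lambda>\<sigma>. F \<sigma> + G \<sigma>)"
proof -
  from assms obtain c d where "\<forall>A. 0 \<le> c A" "\<forall>A. 0 \<le> d A"
    "\<forall>\<sigma>\<in>spins V. F \<sigma> = (\<Sum>A\<in>Pow V. c A * prod \<sigma> A)"
    "\<forall>\<sigma>\<in>spins V. G \<sigma> = (\<Sum>A\<in>Pow V. d A * prod \<sigma> A)"
    unfolding pos_fun_def by metis
  then show ?thesis
    unfolding pos_fun_def
    by (intro exI[of _ "\<lambda>A. c A + d A"]) (auto simp: sum.distrib distrib_right)
qed

lemma pos_fun_sum:
  assumes "finite V" "\<And>x. x \<in> I \<Longrightarrow> pos_fun V (F x)"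
  shows "pos_fun V (\<lambda>\<sigma>. \<Sum>x\<in>I. F x \<sigma>)"
  using assms(2)
  by (induction I rule: infinite_finite_induct)
     (auto intro!: pos_fun_add pos_fun_const assms(1))

text \<open>Since spins square to \<open>1\<close>, the product of two monomials is the monomial of the symmetric difference.\<close>

lemma pos_fun_mult:
  assumes V: "finite V" and "pos_fun V F" "pos_fun V G"
  shows "pos_fun V (\<lambda>\<sigma>. F \<sigma> * G \<sigma>)"
proof -
  from assms obtain c d where c: "\<forall>A. 0 \<le> c A" "\<forall>A. 0 \<le> d A"
    "\<forall>\<sigma>\<in>spins V. F \<sigma> = (\<Sum>A\<in>Pow V. c A * prod \<sigma> A)"
    "\<forall>\<sigma>\<in>spins V. G \<sigma> = (\<Sum>A\<in>Pow V. d A * prod \<sigma> A)"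
    unfolding pos_fun_def by metis
  have "prod \<sigma> A * prod \<sigma> B = prod \<sigma> ((A - B) \<union> (B - A))"
    if \<sigma>: "\<sigma> \<in> spins V" and AB: "A \<subseteq> V" "B \<subseteq> V" for \<sigma> A B
  proof -
    have fin: "finite A" "finite B" using AB V finite_subset by auto
    have A: "prod \<sigma> A = prod \<sigma> (A - B) * prod \<sigma> (A \<inter> B)"
      using fin prod.Int_Diff[of A \<sigma> B] by (simp add: mult.commute)
    have B: "prod \<sigma> B = prod \<sigma> (B - A) * prod \<sigma> (A \<inter> B)"
      using fin prod.Int_Diff[of B \<sigma> A] by (simp add: mult.commute Int_commute)
    have "prod \<sigma> (A \<inter> B) * prod \<sigma> (A \<inter> B) = 1"
      by (simp add: prod.distrib[symmetric] spins_sq[OF \<sigma>])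
    moreover have "prod \<sigma> ((A - B) \<union> (B - A)) = prod \<sigma> (A - B) * prod \<sigma> (B - A)"
      using fin by (intro prod.union_disjoint) auto
    ultimately show ?thesis unfolding A B by algebra
  qed
  note sym = this
  have "pos_fun V (\<lambda>\<sigma>. c A * prod \<sigma> A * (d B * prod \<sigma> B))" if "A \<subseteq> V" "B \<subseteq> V" for A B
    by (rule pos_fun_cong[OF pos_fun_monomial[OF V, of "(A - B) \<union> (B - A)" "c A * d B"]])
       (use that c in \<open>auto simp: mult_ac simp flip: sym\<close>)
  then have "pos_fun V (\<lambda>\<sigma>. \<Sum>A\<in>Pow V. \<Sum>B\<in>Pow V. c A * prod \<sigma> A * (d B * prod \<sigma> B))"
    using V by (intro pos_fun_sum) auto
  then show ?thesis
    by (rule pos_fun_cong) (use c in \<open>auto simp: sum_product\<close>)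
qed

lemma pos_fun_prods:
  assumes "finite V" "\<And>x. x \<in> I \<Longrightarrow> pos_fun V (F x)"
  shows "pos_fun V (\<lambda>\<sigma>. \<Prod>x\<in>I. F x \<sigma>)"
  using assms(2)
  by (induction I rule: infinite_finite_induct)
     (auto intro!: pos_fun_mult pos_fun_const assms(1))

text \<open>On a monomial \<open>x = \<plusminus>1\<close> the exponential is linear: \<open>exp (c * x) = cosh c + sinh c * x\<close>.\<close>

lemma pos_fun_exp:
  assumes V: "finite V" and "pos_fun V F"
  shows "pos_fun V (\<lambda>\<sigma>. exp (F \<sigma>))"
proof -
  from assms obtain c where c: "\<forall>A. 0 \<le> c A"
    "\<forall>\<sigma>\<in>spins V. F \<sigma> = (\<Sum>A\<in>Pow V. c A * prod \<sigma> A)"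
    unfolding pos_fun_def by metis
  have factor: "pos_fun V (\<lambda>\<sigma>. exp (c A * prod \<sigma> A))" if A: "A \<subseteq> V" for A
  proof -
    have eq: "cosh (c A) + sinh (c A) * prod \<sigma> A = exp (c A * prod \<sigma> A)" if "\<sigma> \<in> spins V" for \<sigma>
    proof -
      have "prod \<sigma> A * prod \<sigma> A = 1"
        by (simp add: prod.distrib[symmetric] spins_sq[OF that])
      then have "prod \<sigma> A = 1 \<or> prod \<sigma> A = -1"
        by (simp add: square_eq_1_iff)
      then show ?thesis by (auto simp: cosh_plus_sinh cosh_minus_sinh)
    qed
    have "pos_fun V (\<lambda>\<sigma>. cosh (c A) + sinh (c A) * prod \<sigma> A)"
      using c(1) by (intro pos_fun_add pos_fun_const pos_fun_monomial V A) auto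
    then show ?thesis by (rule pos_fun_cong) (rule eq)
  qed
  have "pos_fun V (\<lambda>\<sigma>. \<Prod>A\<in>Pow V. exp (c A * prod \<sigma> A))"
    by (rule pos_fun_prods[OF V]) (rule factor, simp)
  then show ?thesis
    by (rule pos_fun_cong) (subst bspec[OF c(2)], assumption, simp add: exp_sum V)
qed

lemma pos_fun_shift:
  assumes "pos_fun V F" "\<omega> \<in> spins V"
  shows "pos_fun V (\<lambda>\<sigma>. F \<sigma> + F (\<lambda>i. \<sigma> i * \<omega> i))" (is ?plus)
    and "pos_fun V (\<lambda>\<sigma>. F \<sigma> - F (\<lambda>i. \<sigma> i * \<omega> i))" (is ?minus)
proof -
  from assms obtain c where c: "\<forall>A. 0 \<le> c A"
    "\<forall>\<sigma>\<in>spins V. F \<sigma> = (\<Sum>A\<in>Pow V. c A * prod \<sigma> A)"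
    unfolding pos_fun_def by metis
  have F': "F (\<lambda>i. \<sigma> i * \<omega> i) = (\<Sum>A\<in>Pow V. c A * prod \<omega> A * prod \<sigma> A)" if "\<sigma> \<in> spins V" for \<sigma>
    using c(2) spins_mult[OF that assms(2)] by (auto simp: prod.distrib mult_ac)
  have abs1: "\<bar>prod \<omega> A\<bar> = 1" for A
    unfolding abs_prod using spins_cases[OF assms(2)]
    by (intro prod.neutral) (metis abs_1 abs_minus_cancel)
  then have le: "prod \<omega> A \<le> 1" "-1 \<le> prod \<omega> A" for A
    by (metis abs_le_D1 order_refl, metis abs_le_D2 minus_le_iff order_refl)
  have nn: "0 \<le> c A + c A * prod \<omega> A" "c A * prod \<omega> A \<le> c A" for A
  proof -
    have "0 \<le> c A * (1 + prod \<omega> A)" "c A * prod \<omega> A \<le> c A * 1"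
      using c(1) le(1)[of A] le(2)[of A] by (intro mult_nonneg_nonneg mult_left_mono; simp)+
    then show "0 \<le> c A + c A * prod \<omega> A" "c A * prod \<omega> A \<le> c A" by (simp_all add: distrib_left)
  qed
  show ?plus unfolding pos_fun_def
    by (intro exI[of _ "\<lambda>A. c A * (1 + prod \<omega> A)"])
       (use c F' nn in \<open>auto simp: sum.distrib[symmetric] distrib_right distrib_left\<close>)
  show ?minus unfolding pos_fun_def
    by (intro exI[of _ "\<lambda>A. c A * (1 - prod \<omega> A)"])
       (use c F' nn in \<open>auto simp: sum_subtractf[symmetric] left_diff_distrib right_diff_distrib\<close>)
qed

lemma pos_fun_sum_nonneg:
  assumes "finite V" "pos_fun V F"
  shows "0 \<le> (\<Sum>\<sigma>\<in>spins V. F \<sigma>)"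
proof -
  from assms obtain c where c: "\<forall>A. 0 \<le> c A"
    "\<forall>\<sigma>\<in>spins V. F \<sigma> = (\<Sum>A\<in>Pow V. c A * prod \<sigma> A)"
    unfolding pos_fun_def by metis
  have "(\<Sum>\<sigma>\<in>spins V. F \<sigma>) = (\<Sum>A\<in>Pow V. c A * (\<Sum>\<sigma>\<in>spins V. prod \<sigma> A))"
    using c by (simp add: sum_distrib_left sum.swap[of _ "Pow V"])
  also have "\<dots> \<ge> 0"
    using c assms(1) by (intro sum_nonneg mult_nonneg_nonneg sum_spin_product_nonneg) auto
  finally show ?thesis .
qed

text \<open>Griffiths' second inequality by Ginibre's argument: the difference of the two sides is a double sum
over \<open>\<sigma>\<close> and \<open>\<tau>\<close>; after the substitution \<open>\<tau> = \<sigma> * \<omega>\<close> the summand is, for each fixed \<open>\<omega>\<close>, a product of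
functions of positive type in \<open>\<sigma>\<close>.\<close>

lemma griffiths_inequality:
  assumes V: "finite V" and S: "pos_fun V S" and F: "pos_fun V F" and G: "pos_fun V G"
  shows "(\<Sum>\<sigma>\<in>spins V. F \<sigma> * exp (S \<sigma>)) * (\<Sum>\<sigma>\<in>spins V. G \<sigma> * exp (S \<sigma>))
    \<le> (\<Sum>\<sigma>\<in>spins V. F \<sigma> * G \<sigma> * exp (S \<sigma>)) * (\<Sum>\<sigma>\<in>spins V. exp (S \<sigma>))"
proof -
  let ?X = "spins V"
  have "(\<Sum>\<sigma>\<in>?X. F \<sigma> * G \<sigma> * exp (S \<sigma>)) * (\<Sum>\<sigma>\<in>?X. exp (S \<sigma>))
      - (\<Sum>\<sigma>\<in>?X. G \<sigma> * exp (S \<sigma>)) * (\<Sum>\<sigma>\<in>?X. F \<sigma> * exp (S \<sigma>))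
    = (\<Sum>\<sigma>\<in>?X. \<Sum>\<tau>\<in>?X. (F \<sigma> - F \<tau>) * G \<sigma> * exp (S \<sigma> + S \<tau>))"
    unfolding sum_product sum_subtractf[symmetric]
    by (intro sum.cong refl) (simp add: exp_add algebra_simps)
  also have "\<dots> = (\<Sum>\<sigma>\<in>?X. \<Sum>\<omega>\<in>?X. (F \<sigma> - F (\<lambda>i. \<sigma> i * \<omega> i)) * G \<sigma> * exp (S \<sigma> + S (\<lambda>i. \<sigma> i * \<omega> i)))"
  proof (rule sum.cong[OF refl])
    fix \<sigma> :: "'a \<Rightarrow> real" assume \<sigma>: "\<sigma> \<in> ?X"
    show "(\<Sum>\<tau>\<in>?X. (F \<sigma> - F \<tau>) * G \<sigma> * exp (S \<sigma> + S \<tau>)) =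
      (\<Sum>\<omega>\<in>?X. (F \<sigma> - F (\<lambda>i. \<sigma> i * \<omega> i)) * G \<sigma> * exp (S \<sigma> + S (\<lambda>i. \<sigma> i * \<omega> i)))"
      using sum_spins_shift[OF \<sigma>, of "\<lambda>\<tau>. (F \<sigma> - F \<tau>) * G \<sigma> * exp (S \<sigma> + S \<tau>)"]
      by (simp add: mult.commute[of "\<sigma> _"])
  qed
  also have "\<dots> = (\<Sum>\<omega>\<in>?X. \<Sum>\<sigma>\<in>?X. (F \<sigma> - F (\<lambda>i. \<sigma> i * \<omega> i)) * G \<sigma> * exp (S \<sigma> + S (\<lambda>i. \<sigma> i * \<omega> i)))"
    by (rule sum.swap)
  also have "\<dots> \<ge> 0"
    by (intro sum_nonneg pos_fun_sum_nonneg[OF V] pos_fun_mult[OF V] pos_fun_exp[OF V]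
        pos_fun_shift F G S)
  finally show ?thesis by (simp add: mult.commute)
qed

text \<open>Log-supermodularity of the partition function in the couplings: \<open>S\<close> plays the part of a meet, \<open>S + X\<close>
and \<open>S + Y\<close> of two elements, and \<open>S + X + Y + D\<close> of their join.\<close>

lemma griffiths_supermodular:
  assumes V: "finite V" and F: "pos_fun V F" and S: "pos_fun V S" and X: "pos_fun V X"
    and Y: "pos_fun V Y" and D: "pos_fun V D"
  shows "(\<Sum>\<sigma>\<in>spins V. F \<sigma> * exp (S \<sigma> + X \<sigma>)) * (\<Sum>\<sigma>\<in>spins V. exp (S \<sigma> + Y \<sigma>))
    \<le> (\<Sum>\<sigma>\<in>spins V. F \<sigma> * exp (S \<sigma> + X \<sigma> + Y \<sigma> + D \<sigma>)) * (\<Sum>\<sigma>\<in>spins V. exp (S \<sigma>))"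
proof -
  let ?X = "spins V"
  have "0 \<le> (\<Sum>\<sigma>\<in>?X. exp (S \<sigma> + Y \<sigma>) * D \<sigma>)"
    by (intro pos_fun_sum_nonneg[OF V] pos_fun_mult[OF V] pos_fun_exp[OF V] pos_fun_add S Y D)
  then have "(\<Sum>\<sigma>\<in>?X. exp (S \<sigma> + Y \<sigma>)) \<le> (\<Sum>\<sigma>\<in>?X. exp (S \<sigma> + Y \<sigma>) * (1 + D \<sigma>))"
    by (simp add: algebra_simps sum.distrib)
  also have "\<dots> \<le> (\<Sum>\<sigma>\<in>?X. exp (S \<sigma> + Y \<sigma>) * exp (D \<sigma>))"
    by (intro sum_mono mult_left_mono) auto
  finally have 1: "(\<Sum>\<sigma>\<in>?X. exp (S \<sigma> + Y \<sigma>)) \<le> (\<Sum>\<sigma>\<in>?X. exp (Y \<sigma> + D \<sigma>) * exp (S \<sigma>))"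
    by (simp add: exp_add mult_ac)
  have "0 \<le> (\<Sum>\<sigma>\<in>?X. F \<sigma> * exp (S \<sigma> + X \<sigma>))"
    by (intro pos_fun_sum_nonneg[OF V] pos_fun_mult[OF V] pos_fun_exp[OF V] pos_fun_add S X F)
  then have "(\<Sum>\<sigma>\<in>?X. F \<sigma> * exp (S \<sigma> + X \<sigma>)) * (\<Sum>\<sigma>\<in>?X. exp (S \<sigma> + Y \<sigma>))
    \<le> (\<Sum>\<sigma>\<in>?X. F \<sigma> * exp (S \<sigma> + X \<sigma>)) * (\<Sum>\<sigma>\<in>?X. exp (Y \<sigma> + D \<sigma>) * exp (S \<sigma>))"
    using 1 by (rule mult_left_mono[rotated])
  also have "\<dots> = (\<Sum>\<sigma>\<in>?X. F \<sigma> * exp (X \<sigma>) * exp (S \<sigma>)) * (\<Sum>\<sigma>\<in>?X. exp (Y \<sigma> + D \<sigma>) * exp (S \<sigma>))"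
    by (simp add: exp_add mult_ac)
  also have "\<dots> \<le> (\<Sum>\<sigma>\<in>?X. F \<sigma> * exp (X \<sigma>) * exp (Y \<sigma> + D \<sigma>) * exp (S \<sigma>)) * (\<Sum>\<sigma>\<in>?X. exp (S \<sigma>))"
    by (intro griffiths_inequality[OF V] pos_fun_mult[OF V] pos_fun_exp[OF V] pos_fun_add S X F Y D)
  finally show ?thesis by (simp add: exp_add mult_ac)
qed

section \<open>Two copies of an Ising model with opposite boundary fields\<close>

text \<open>Only spins in \<open>T\<close> matter, but the function is evaluated on configurations of an ambient volume, so that
sums over configurations can be compared for sets \<open>T\<close> of different size.\<close>

definition pair_energy ::
  "real \<Rightarrow> 'a set set \<Rightarrow> ('a \<Rightarrow> real) \<Rightarrow> 'a set \<Rightarrow> ('a \<Rightarrow> real) \<Rightarrow> real" where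
  "pair_energy J E g T \<sigma> = (\<Sum>e\<in>{e\<in>E. e \<subseteq> T}. J * prod \<sigma> e) + (\<Sum>i\<in>T. g i * \<sigma> i)"

lemma pair_energy_local:
  assumes "\<And>i. i \<in> T \<Longrightarrow> \<sigma> i = \<tau> i"
  shows "pair_energy J E g T \<sigma> = pair_energy J E g T \<tau>"
proof -
  have "prod \<sigma> e = prod \<tau> e" if "e \<subseteq> T" for e
    using that assms by (intro prod.cong) auto
  then show ?thesis
    unfolding pair_energy_def using assms by (intro arg_cong2[where f = "(+)"] sum.cong) auto
qed

lemma pos_fun_pair_energy_diff:
  assumes V: "finite V" and E: "finite E" and J: "0 \<le> J" and SU: "S \<subseteq> U" "U \<subseteq> V"
    and g: "\<And>i. i \<in> U \<Longrightarrow> 0 \<le> g' i" "\<And>i. i \<in> S \<Longrightarrow> g i \<le> g' i"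
  shows "pos_fun V (\<lambda>\<sigma>. pair_energy J E g' U \<sigma> - pair_energy J E g S \<sigma>)"
proof -
  have fin: "finite U" by (rule finite_subset[OF SU(2) V])
  have "pair_energy J E g' U \<sigma> - pair_energy J E g S \<sigma> =
      (\<Sum>e\<in>{e\<in>E. e \<subseteq> U} - {e\<in>E. e \<subseteq> S}. J * prod \<sigma> e)
      + (\<Sum>i\<in>U. (g' i - (if i \<in> S then g i else 0)) * \<sigma> i)" for \<sigma>
  proof -
    have 1: "(\<Sum>e\<in>{e\<in>E. e \<subseteq> U} - {e\<in>E. e \<subseteq> S}. J * prod \<sigma> e) =
      (\<Sum>e\<in>{e\<in>E. e \<subseteq> U}. J * prod \<sigma> e) - (\<Sum>e\<in>{e\<in>E. e \<subseteq> S}. J * prod \<sigma> e)"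
      by (rule sum_diff) (use E in simp, use SU(1) in blast)
    have 2: "(\<Sum>i\<in>S. g i * \<sigma> i) = (\<Sum>i\<in>U. (if i \<in> S then g i else 0) * \<sigma> i)"
      by (rule sum.mono_neutral_cong_left) (use fin SU(1) in auto)
    show ?thesis
      unfolding pair_energy_def 1 2 by (simp add: sum_subtractf left_diff_distrib)
  qed
  moreover have "pos_fun V (\<lambda>\<sigma>. (\<Sum>e\<in>{e\<in>E. e \<subseteq> U} - {e\<in>E. e \<subseteq> S}. J * prod \<sigma> e)
      + (\<Sum>i\<in>U. (g' i - (if i \<in> S then g i else 0)) * \<sigma> i))"
    by (intro pos_fun_add pos_fun_sum pos_fun_monomial pos_fun_spin V) (use SU g J in auto)
  ultimately show ?thesis by simp
qed

lemma pos_fun_pair_energy: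
  assumes "finite V" "finite E" "0 \<le> J" "U \<subseteq> V" "\<And>i. i \<in> U \<Longrightarrow> 0 \<le> g i"
  shows "pos_fun V (pair_energy J E g U)"
proof -
  have "pos_fun V (\<lambda>\<sigma>. (\<Sum>e\<in>{e\<in>E. e \<subseteq> U}. J * prod \<sigma> e) + (\<Sum>i\<in>U. g i * \<sigma> i))"
    by (intro pos_fun_add pos_fun_sum pos_fun_monomial pos_fun_spin assms(1)) (use assms in auto)
  then show ?thesis unfolding pair_energy_def[abs_def] .
qed

text \<open>What is left are the members of \<open>E\<close> that lie in \<open>T \<union> U\<close> but in neither of the two sets, and the excess
of \<open>g'\<close> over \<open>g\<close> on \<open>U - T\<close>.\<close>

lemma pos_fun_pair_energy_mixed:
  assumes V: "finite V" and E: "finite E" and J: "0 \<le> J" and TU: "T \<subseteq> V" "U \<subseteq> V"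
    and g: "\<And>i. i \<in> V \<Longrightarrow> 0 \<le> g i" "\<And>i. i \<in> V \<Longrightarrow> g i \<le> g' i"
  shows "pos_fun V (\<lambda>\<sigma>. pair_energy J E g' (T \<union> U) \<sigma> + pair_energy J E g (T \<inter> U) \<sigma>
           - pair_energy J E g' T \<sigma> - pair_energy J E g U \<sigma>)"
proof -
  have fin: "finite U" "finite T" using V TU finite_subset by blast+
  let ?R = "{e\<in>E. e \<subseteq> T \<union> U} - ({e\<in>E. e \<subseteq> T} \<union> {e\<in>E. e \<subseteq> U})"
  have "pair_energy J E g' (T \<union> U) \<sigma> + pair_energy J E g (T \<inter> U) \<sigma>
           - pair_energy J E g' T \<sigma> - pair_energy J E g U \<sigma> =
      (\<Sum>e\<in>?R. J * prod \<sigma> e) + (\<Sum>i\<in>U - T. (g' i - g i) * \<sigma> i)" for \<sigma>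
  proof -
    have 1: "(\<Sum>e\<in>?R. J * prod \<sigma> e) = (\<Sum>e\<in>{e\<in>E. e \<subseteq> T \<union> U}. J * prod \<sigma> e)
        - (\<Sum>e\<in>{e\<in>E. e \<subseteq> T} \<union> {e\<in>E. e \<subseteq> U}. J * prod \<sigma> e)"
      using E TU by (intro sum_diff) auto
    have "{e\<in>E. e \<subseteq> T} \<inter> {e\<in>E. e \<subseteq> U} = {e\<in>E. e \<subseteq> T \<inter> U}" by auto
    then have 2: "(\<Sum>e\<in>{e\<in>E. e \<subseteq> T} \<union> {e\<in>E. e \<subseteq> U}. J * prod \<sigma> e) =
      (\<Sum>e\<in>{e\<in>E. e \<subseteq> T}. J * prod \<sigma> e) + (\<Sum>e\<in>{e\<in>E. e \<subseteq> U}. J * prod \<sigma> e)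
      - (\<Sum>e\<in>{e\<in>E. e \<subseteq> T \<inter> U}. J * prod \<sigma> e)"
      using E by (subst sum_Un) auto
    have 3: "(\<Sum>i\<in>T \<union> U. g' i * \<sigma> i) = (\<Sum>i\<in>T. g' i * \<sigma> i) + (\<Sum>i\<in>U - T. g' i * \<sigma> i)"
      using fin by (subst sum.union_disjoint[symmetric]) auto
    have 4: "(\<Sum>i\<in>U. g i * \<sigma> i) = (\<Sum>i\<in>T \<inter> U. g i * \<sigma> i) + (\<Sum>i\<in>U - T. g i * \<sigma> i)"
      using fin by (subst sum.union_disjoint[symmetric]) (auto intro: sum.cong)
    show ?thesis
      unfolding pair_energy_def 1 2 3 4 by (simp add: sum_subtractf left_diff_distrib)
  qed
  moreover have "pos_fun V (\<lambda>\<sigma>. (\<Sum>e\<in>?R. J * prod \<sigma> e) + (\<Sum>i\<in>U - T. (g' i - g i) * \<sigma> i))"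
    by (intro pos_fun_add pos_fun_sum pos_fun_monomial pos_fun_spin V) (use TU g J in auto)
  ultimately show ?thesis by simp
qed

text \<open>The lattice condition in the two forms that the four functions theorem needs: with \<open>F\<close> a spin and equal
fields, and with \<open>F = 1\<close> and two ordered fields.\<close>

lemma pair_energy_lattice:
  assumes V: "finite V" and E: "finite E" and J: "0 \<le> J" and TU: "T \<subseteq> V" "U \<subseteq> V"
    and g: "\<And>i. i \<in> V \<Longrightarrow> 0 \<le> g i" "\<And>i. i \<in> V \<Longrightarrow> g i \<le> g' i" and F: "pos_fun V F"
  shows "(\<Sum>\<sigma>\<in>spins V. F \<sigma> * exp (pair_energy J E g' T \<sigma>)) * (\<Sum>\<sigma>\<in>spins V. exp (pair_energy J E g U \<sigma>))
    \<le> (\<Sum>\<sigma>\<in>spins V. F \<sigma> * exp (pair_energy J E g' (T \<union> U) \<sigma>))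
      * (\<Sum>\<sigma>\<in>spins V. exp (pair_energy J E g (T \<inter> U) \<sigma>))"
proof -
  let ?e = "pair_energy J E"
  have g': "0 \<le> g' i" if "i \<in> V" for i using g that by force
  have "pos_fun V (\<lambda>\<sigma>. ?e g' T \<sigma> - ?e g (T \<inter> U) \<sigma>)" "pos_fun V (\<lambda>\<sigma>. ?e g U \<sigma> - ?e g (T \<inter> U) \<sigma>)"
    "pos_fun V (?e g (T \<inter> U))"
    using g g' TU by (auto intro!: pos_fun_pair_energy_diff pos_fun_pair_energy V E J)
  from griffiths_supermodular[OF V F this(3,1,2)
      pos_fun_pair_energy_mixed[OF V E J TU, of g g', OF g(1) g(2)]]
  show ?thesis by simp
qed

text \<open>Swapping the parts of two configurations on \<open>T\<close> is an involution on pairs of configurations.\<close>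

lemma sum_spins_independent:
  fixes F G :: "('a \<Rightarrow> real) \<Rightarrow> real"
  assumes V: "finite V" and "T \<subseteq> V"
    and F: "\<And>\<sigma> \<tau>. (\<And>i. i \<in> T \<Longrightarrow> \<sigma> i = \<tau> i) \<Longrightarrow> F \<sigma> = F \<tau>"
    and G: "\<And>\<sigma> \<tau>. (\<And>i. i \<in> V - T \<Longrightarrow> \<sigma> i = \<tau> i) \<Longrightarrow> G \<sigma> = G \<tau>"
  shows "real (card (spins V)) * (\<Sum>\<sigma>\<in>spins V. F \<sigma> * G \<sigma>) = (\<Sum>\<sigma>\<in>spins V. F \<sigma>) * (\<Sum>\<sigma>\<in>spins V. G \<sigma>)"
proof -
  \<comment> \<open>exchanges the values of the two configurations off \<open>T\<close>, so \<open>F\<close> sees the first and \<open>G\<close> the second\<close>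
  define m :: "('a \<Rightarrow> real) \<times> ('a \<Rightarrow> real) \<Rightarrow> _"
    where "m = (\<lambda>(\<sigma>, \<tau>). (\<lambda>i. if i \<in> T then \<sigma> i else \<tau> i, \<lambda>i. if i \<in> T then \<tau> i else \<sigma> i))"
  have m: "m (m p) = p" "p \<in> spins V \<times> spins V \<Longrightarrow> m p \<in> spins V \<times> spins V" for p
    using assms(2) by (auto simp: m_def spins_def fun_eq_iff split: prod.splits)
  have "(\<Sum>p\<in>spins V \<times> spins V. F (fst p) * G (fst p)) =
      (\<Sum>\<sigma>\<in>spins V. \<Sum>\<tau>\<in>spins V. F \<sigma> * G \<sigma>)"
    by (simp only: sum.cartesian_product' fst_conv)
  then have "real (card (spins V)) * (\<Sum>\<sigma>\<in>spins V. F \<sigma> * G \<sigma>) =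
      (\<Sum>p\<in>spins V \<times> spins V. F (fst p) * G (fst p))"
    by (simp add: sum_distrib_left)
  also have "\<dots> = (\<Sum>p\<in>spins V \<times> spins V. F (fst (m p)) * G (fst (m p)))"
    by (rule sum.reindex_bij_witness[where i = m and j = m]) (auto simp: m)
  also have "\<dots> = (\<Sum>p\<in>spins V \<times> spins V. F (fst p) * G (snd p))"
    by (intro sum.cong arg_cong2[where f = "(*)"] F G) (auto simp: m_def)
  also have "\<dots> = (\<Sum>\<sigma>\<in>spins V. F \<sigma>) * (\<Sum>\<sigma>\<in>spins V. G \<sigma>)"
    by (simp only: sum_product sum.cartesian_product' fst_conv snd_conv)
  finally show ?thesis .
qed

text \<open>The algebra behind the decoupling. Where the second copy agrees with the first the contributions of \<open>b\<close>
cancel, where it is opposite those of \<open>g\<close> cancel, and so do the contributions of an edge between a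
place of agreement and a place of disagreement.\<close>

lemma pair_energy_duplicate:
  assumes V: "finite V" and E: "finite E" and E2: "\<And>e. e \<in> E \<Longrightarrow> card e = 2"
    and T: "T \<subseteq> V"
  defines "\<omega> \<equiv> \<lambda>i. if i \<in> T then -1 else 1"
  shows "pair_energy J E (\<lambda>i. g i + b i) V \<sigma> + pair_energy J E (\<lambda>i. g i - b i) V (\<lambda>i. \<sigma> i * \<omega> i)
    = pair_energy (2 * J) E (\<lambda>i. 2 * b i) T \<sigma> + pair_energy (2 * J) E (\<lambda>i. 2 * g i) (V - T) \<sigma>"
proof -
  let ?E = "\<lambda>S. {e\<in>E. e \<subseteq> S}"
  have finT: "finite T" using T V finite_subset by blast
  have e: "J * prod \<sigma> e + J * (prod \<sigma> e * prod \<omega> e) =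
     (if e \<subseteq> T then 2 * J * prod \<sigma> e else 0) + (if e \<subseteq> V - T then 2 * J * prod \<sigma> e else 0)"
    if "e \<in> ?E V" for e
  proof -
    from that E2[of e] obtain x y where "e = {x, y}" "x \<noteq> y" by (metis (no_types) card_2_iff mem_Collect_eq)
    with that show ?thesis by (auto simp: \<omega>_def)
  qed
  have 1: "(\<Sum>e\<in>?E V. J * prod \<sigma> e) + (\<Sum>e\<in>?E V. J * prod (\<lambda>i. \<sigma> i * \<omega> i) e) =
    (\<Sum>e\<in>?E T. 2 * J * prod \<sigma> e) + (\<Sum>e\<in>?E (V - T). 2 * J * prod \<sigma> e)"
  proof -
    have "(\<Sum>e\<in>?E V. if e \<subseteq> S then 2 * J * prod \<sigma> e else 0) = (\<Sum>e\<in>?E S. 2 * J * prod \<sigma> e)"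
      if "S \<subseteq> V" for S
      using E that by (intro sum.mono_neutral_cong_right) auto
    note restrict = this[OF T] this[OF Diff_subset[of V T]]
    have "(\<Sum>e\<in>?E V. J * prod \<sigma> e) + (\<Sum>e\<in>?E V. J * prod (\<lambda>i. \<sigma> i * \<omega> i) e) =
      (\<Sum>e\<in>?E V. (if e \<subseteq> T then 2 * J * prod \<sigma> e else 0)
        + (if e \<subseteq> V - T then 2 * J * prod \<sigma> e else 0))"
      unfolding sum.distrib[symmetric] prod.distrib by (intro sum.cong refl e)
    then show ?thesis unfolding sum.distrib restrict .
  qed
  have 2: "(\<Sum>i\<in>V. (g i + b i) * \<sigma> i) + (\<Sum>i\<in>V. (g i - b i) * (\<sigma> i * \<omega> i)) =
      (\<Sum>i\<in>T. 2 * b i * \<sigma> i) + (\<Sum>i\<in>V - T. 2 * g i * \<sigma> i)"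
  proof -
    have "(\<Sum>i\<in>V. (g i + b i) * \<sigma> i) + (\<Sum>i\<in>V. (g i - b i) * (\<sigma> i * \<omega> i)) =
      (\<Sum>i\<in>V. if i \<in> T then 2 * b i * \<sigma> i else 2 * g i * \<sigma> i)"
      unfolding sum.distrib[symmetric] by (intro sum.cong) (auto simp: \<omega>_def algebra_simps)
    also have "\<dots> = (\<Sum>i\<in>T. 2 * b i * \<sigma> i) + (\<Sum>i\<in>V - T. 2 * g i * \<sigma> i)"
      using V T by (subst sum.If_cases) (auto simp: Int_absorb1 Diff_eq)
    finally show ?thesis .
  qed
  show ?thesis unfolding pair_energy_def using 1 2 by linarith
qed

definition spin_mean ::
  "real \<Rightarrow> 'a set set \<Rightarrow> 'a set \<Rightarrow> ('a \<Rightarrow> real) \<Rightarrow> 'a \<Rightarrow> real" where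
  "spin_mean J E V a i = (\<Sum>\<sigma>\<in>spins V. \<sigma> i * exp (pair_energy J E a V \<sigma>))
     / (\<Sum>\<sigma>\<in>spins V. exp (pair_energy J E a V \<sigma>))"

text \<open>The sum over both copies is rewritten as a sum over the set \<open>T\<close> where they differ and over the first
copy. Given \<open>T\<close> the weights on \<open>T\<close> and on \<open>V - T\<close> are independent, and \<open>\<sigma> i - \<tau> i\<close> is \<open>2 * \<sigma> i\<close> on \<open>T\<close> and
\<open>0\<close> off \<open>T\<close>.\<close>

lemma sum_spins_duplicate:
  assumes V: "finite V" and E: "finite E" and E2: "\<And>e. e \<in> E \<Longrightarrow> card e = 2"
  shows "real (card (spins V)) * (\<Sum>\<sigma>\<in>spins V. \<Sum>\<tau>\<in>spins V.
      exp (pair_energy J E (\<lambda>i. g i + b i) V \<sigma>) * exp (pair_energy J E (\<lambda>i. g i - b i) V \<tau>)) =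
    (\<Sum>T\<in>Pow V. (\<Sum>\<sigma>\<in>spins V. exp (pair_energy (2*J) E (\<lambda>i. 2 * b i) T \<sigma>)) *
        (\<Sum>\<sigma>\<in>spins V. exp (pair_energy (2*J) E (\<lambda>i. 2 * g i) (V - T) \<sigma>)))" (is ?thesis1)
  and "i \<in> V \<Longrightarrow> real (card (spins V)) * (\<Sum>\<sigma>\<in>spins V. \<Sum>\<tau>\<in>spins V. (\<sigma> i - \<tau> i) *
      (exp (pair_energy J E (\<lambda>i. g i + b i) V \<sigma>) * exp (pair_energy J E (\<lambda>i. g i - b i) V \<tau>))) =
    2 * (\<Sum>T\<in>Pow V. (if i \<in> T then \<Sum>\<sigma>\<in>spins V. \<sigma> i * exp (pair_energy (2*J) E (\<lambda>i. 2 * b i) T \<sigma>) else 0) *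
        (\<Sum>\<sigma>\<in>spins V. exp (pair_energy (2*J) E (\<lambda>i. 2 * g i) (V - T) \<sigma>)))" (is "_ \<Longrightarrow> ?thesis2")
proof -
  let ?p = "pair_energy J E (\<lambda>i. g i + b i) V" and ?m = "pair_energy J E (\<lambda>i. g i - b i) V"
  let ?B = "pair_energy (2*J) E (\<lambda>i. 2 * b i)" and ?G = "pair_energy (2*J) E (\<lambda>i. 2 * g i)"
  let ?w = "\<lambda>T i. if i \<in> T then -1 else 1 :: real"
  have gen: "(\<Sum>\<sigma>\<in>spins V. \<Sum>\<tau>\<in>spins V. f \<sigma> \<tau> * (exp (?p \<sigma>) * exp (?m \<tau>))) =
     (\<Sum>T\<in>Pow V. \<Sum>\<sigma>\<in>spins V. f \<sigma> (\<lambda>i. \<sigma> i * ?w T i) * exp (?B T \<sigma>) * exp (?G (V - T) \<sigma>))"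
    for f :: "('a \<Rightarrow> real) \<Rightarrow> ('a \<Rightarrow> real) \<Rightarrow> real"
  proof -
    have "(\<Sum>\<sigma>\<in>spins V. \<Sum>\<tau>\<in>spins V. f \<sigma> \<tau> * (exp (?p \<sigma>) * exp (?m \<tau>))) =
      (\<Sum>\<sigma>\<in>spins V. \<Sum>\<omega>\<in>spins V. f \<sigma> (\<lambda>i. \<sigma> i * \<omega> i) * (exp (?p \<sigma>) * exp (?m (\<lambda>i. \<sigma> i * \<omega> i))))"
    proof (rule sum.cong[OF refl])
      fix \<sigma> :: "'a \<Rightarrow> real" assume \<sigma>: "\<sigma> \<in> spins V"
      show "(\<Sum>\<tau>\<in>spins V. f \<sigma> \<tau> * (exp (?p \<sigma>) * exp (?m \<tau>))) =
        (\<Sum>\<omega>\<in>spins V. f \<sigma> (\<lambda>i. \<sigma> i * \<omega> i) * (exp (?p \<sigma>) * exp (?m (\<lambda>i. \<sigma> i * \<omega> i))))"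
        using sum_spins_shift[OF \<sigma>, of "\<lambda>\<tau>. f \<sigma> \<tau> * (exp (?p \<sigma>) * exp (?m \<tau>))"]
        by (simp add: mult.commute[of "\<sigma> _"])
    qed
    also have "\<dots> = (\<Sum>\<sigma>\<in>spins V. \<Sum>T\<in>Pow V. f \<sigma> (\<lambda>i. \<sigma> i * ?w T i) * (exp (?p \<sigma>) * exp (?m (\<lambda>i. \<sigma> i * ?w T i))))"
      by (intro sum.cong refl) (rule sum.reindex_bij_betw[OF bij_betw_spins, symmetric])
    also have "\<dots> = (\<Sum>\<sigma>\<in>spins V. \<Sum>T\<in>Pow V. f \<sigma> (\<lambda>i. \<sigma> i * ?w T i) * exp (?B T \<sigma>) * exp (?G (V - T) \<sigma>))"
      by (intro sum.cong refl)
         (simp add: exp_add[symmetric] pair_energy_duplicate[OF V E E2] mult.assoc)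
    also have "\<dots> = (\<Sum>T\<in>Pow V. \<Sum>\<sigma>\<in>spins V. f \<sigma> (\<lambda>i. \<sigma> i * ?w T i) * exp (?B T \<sigma>) * exp (?G (V - T) \<sigma>))"
      by (rule sum.swap)
    finally show ?thesis .
  qed
  have ind: "real (card (spins V)) * (\<Sum>\<sigma>\<in>spins V. f \<sigma> * exp (?B T \<sigma>) * exp (?G (V - T) \<sigma>)) =
      (\<Sum>\<sigma>\<in>spins V. f \<sigma> * exp (?B T \<sigma>)) * (\<Sum>\<sigma>\<in>spins V. exp (?G (V - T) \<sigma>))"
    if "T \<subseteq> V" "\<And>\<sigma> \<tau>. (\<And>i. i \<in> T \<Longrightarrow> \<sigma> i = \<tau> i) \<Longrightarrow> f \<sigma> = f \<tau>" for T f
    by (rule sum_spins_independent[OF V that(1)])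
       (auto intro!: arg_cong2[where f = "(*)"] arg_cong[where f = exp] pair_energy_local that(2))
  show ?thesis1
    using gen[of "\<lambda>_ _. 1"] ind[of _ "\<lambda>_. 1"] by (simp add: sum_distrib_left)
  show ?thesis2 if "i \<in> V"
  proof -
    have "real (card (spins V)) * (\<Sum>\<sigma>\<in>spins V. \<Sum>\<tau>\<in>spins V. (\<sigma> i - \<tau> i) * (exp (?p \<sigma>) * exp (?m \<tau>))) =
      (\<Sum>T\<in>Pow V. real (card (spins V)) * (\<Sum>\<sigma>\<in>spins V. (\<sigma> i - \<sigma> i * ?w T i) * exp (?B T \<sigma>) * exp (?G (V - T) \<sigma>)))"
      unfolding gen[of "\<lambda>\<sigma> \<tau>. \<sigma> i - \<tau> i"] by (simp add: sum_distrib_left)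
    also have "\<dots> = (\<Sum>T\<in>Pow V. 2 * ((if i \<in> T then \<Sum>\<sigma>\<in>spins V. \<sigma> i * exp (?B T \<sigma>) else 0) *
        (\<Sum>\<sigma>\<in>spins V. exp (?G (V - T) \<sigma>))))"
    proof (intro sum.cong refl)
      fix T assume T: "T \<in> Pow V"
      show "real (card (spins V)) * (\<Sum>\<sigma>\<in>spins V. (\<sigma> i - \<sigma> i * ?w T i) * exp (?B T \<sigma>) * exp (?G (V - T) \<sigma>)) =
        2 * ((if i \<in> T then \<Sum>\<sigma>\<in>spins V. \<sigma> i * exp (?B T \<sigma>) else 0) * (\<Sum>\<sigma>\<in>spins V. exp (?G (V - T) \<sigma>)))"
      proof (cases "i \<in> T")
        case True
        have "(\<Sum>\<sigma>\<in>spins V. (\<sigma> i - \<sigma> i * ?w T i) * exp (?B T \<sigma>) * exp (?G (V - T) \<sigma>)) =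
          2 * (\<Sum>\<sigma>\<in>spins V. \<sigma> i * exp (?B T \<sigma>) * exp (?G (V - T) \<sigma>))"
          using True by (simp add: sum_distrib_left mult.assoc)
        then show ?thesis
          using ind[of T "\<lambda>\<sigma>. \<sigma> i"] T True by (simp add: mult.left_commute[of _ 2])
      qed simp
    qed
    finally show ?thesis by (simp add: sum_distrib_left)
  qed
qed

text \<open>The gap is the mean of an increasing function of \<open>T\<close>. Raising \<open>g\<close> to \<open>g'\<close> multiplies the weight of \<open>T\<close>
by a quotient of partition functions on \<open>V - T\<close>, which decreases in \<open>T\<close>, hence lowers that mean. The
four functions theorem is applied to the cross-multiplied inequality.\<close>

theorem spin_mean_gap_antimono:
  assumes V: "finite V" and E: "finite E" and E2: "\<And>e. e \<in> E \<Longrightarrow> card e = 2"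
    and J: "0 \<le> J" and i: "i \<in> V"
    and b: "\<And>j. j \<in> V \<Longrightarrow> 0 \<le> b j"
    and g: "\<And>j. j \<in> V \<Longrightarrow> 0 \<le> g j" "\<And>j. j \<in> V \<Longrightarrow> g j \<le> g' j"
  shows "spin_mean J E V (\<lambda>j. g' j + b j) i - spin_mean J E V (\<lambda>j. g' j - b j) i
    \<le> spin_mean J E V (\<lambda>j. g j + b j) i - spin_mean J E V (\<lambda>j. g j - b j) i"
proof -
  let ?B = "pair_energy (2*J) E (\<lambda>j. 2 * b j)" and ?G = "\<lambda>g. pair_energy (2*J) E (\<lambda>j. 2 * g j)"
  define ZB where "ZB T = (\<Sum>\<sigma>\<in>spins V. exp (?B T \<sigma>))" for T
  define M where "M T = (if i \<in> T then \<Sum>\<sigma>\<in>spins V. \<sigma> i * exp (?B T \<sigma>) else 0)" for T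
  define Z where "Z g T = (\<Sum>\<sigma>\<in>spins V. exp (?G g T \<sigma>))" for g T
  define num where "num g = (\<Sum>T\<in>Pow V. M T * Z g (V - T))" for g
  define den where "den g = (\<Sum>T\<in>Pow V. ZB T * Z g (V - T))" for g
  have fin: "finite (spins V)" by (rule finite_spins[OF V])
  have pos: "0 < (\<Sum>\<sigma>\<in>spins V. exp (h \<sigma>))" for h :: "('a \<Rightarrow> real) \<Rightarrow> real"
    using spins_nonempty fin by (intro sum_pos) auto
  have gap: "spin_mean J E V (\<lambda>j. g j + b j) i - spin_mean J E V (\<lambda>j. g j - b j) i = 2 * num g / den g" for g
  proof -
    let ?p = "pair_energy J E (\<lambda>j. g j + b j) V" and ?m = "pair_energy J E (\<lambda>j. g j - b j) V"
    have divI: "A = B / real (card (spins V))" if "real (card (spins V)) * A = B" for A B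
      using that fin spins_nonempty[of V] by (simp add: eq_divide_eq mult.commute)
    have "spin_mean J E V (\<lambda>j. g j + b j) i - spin_mean J E V (\<lambda>j. g j - b j) i =
      ((\<Sum>\<sigma>\<in>spins V. \<sigma> i * exp (?p \<sigma>)) * (\<Sum>\<sigma>\<in>spins V. exp (?m \<sigma>)) -
        (\<Sum>\<sigma>\<in>spins V. exp (?p \<sigma>)) * (\<Sum>\<sigma>\<in>spins V. \<sigma> i * exp (?m \<sigma>))) /
      ((\<Sum>\<sigma>\<in>spins V. exp (?p \<sigma>)) * (\<Sum>\<sigma>\<in>spins V. exp (?m \<sigma>)))"
      unfolding spin_mean_def using pos[of ?p] pos[of ?m] by (simp add: field_simps)
    also have "(\<Sum>\<sigma>\<in>spins V. \<sigma> i * exp (?p \<sigma>)) * (\<Sum>\<sigma>\<in>spins V. exp (?m \<sigma>)) -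
        (\<Sum>\<sigma>\<in>spins V. exp (?p \<sigma>)) * (\<Sum>\<sigma>\<in>spins V. \<sigma> i * exp (?m \<sigma>)) =
      (\<Sum>\<sigma>\<in>spins V. \<Sum>\<tau>\<in>spins V. (\<sigma> i - \<tau> i) * (exp (?p \<sigma>) * exp (?m \<tau>)))"
      unfolding sum_product sum_subtractf[symmetric]
      by (intro sum.cong refl) (simp add: algebra_simps)
    also have "\<dots> = 2 * num g / card (spins V)"
      unfolding num_def M_def Z_def by (rule divI) (rule sum_spins_duplicate(2)[OF V E E2 i])
    also have "(\<Sum>\<sigma>\<in>spins V. exp (?p \<sigma>)) * (\<Sum>\<sigma>\<in>spins V. exp (?m \<sigma>)) = den g / card (spins V)"
      unfolding den_def ZB_def Z_def sum_product[of "\<lambda>\<sigma>. exp (?p \<sigma>)"]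
      by (rule divI) (rule sum_spins_duplicate(1)[OF V E E2])
    finally show ?thesis using fin spins_nonempty[of V] by simp
  qed
  have g': "0 \<le> g' j" if "j \<in> V" for j using g that by force
  have M0: "0 \<le> M T" if "T \<subseteq> V" for T
    using pos_fun_spin[OF V i, of 1] b that J unfolding M_def
    by (auto intro!: pos_fun_sum_nonneg[OF V] pos_fun_mult[OF V] pos_fun_exp[OF V] pos_fun_pair_energy V E)
  have "num g' * den g \<le> num g * den g'"
    unfolding num_def den_def
  proof (rule four_functions[OF V])
    fix A C assume AC: "A \<subseteq> V" "C \<subseteq> V"
    have 1: "M A * ZB C \<le> M (A \<union> C) * ZB (A \<inter> C)"
    proof (cases "i \<in> A")
      case True
      then show ?thesis
        using pair_energy_lattice[OF V E _ AC, of "2*J" "\<lambda>j. 2 * b j" "\<lambda>j. 2 * b j" "\<lambda>\<sigma>. \<sigma> i"]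
          b J pos_fun_spin[OF V i, of 1]
        by (simp add: M_def ZB_def)
    next
      case False
      have "0 \<le> M (A \<union> C) * ZB (A \<inter> C)" using M0[of "A \<union> C"] AC
        by (intro mult_nonneg_nonneg) (auto simp: ZB_def intro!: sum_nonneg)
      then show ?thesis using False by (simp add: M_def)
    qed
    have 2: "Z g' (V - A) * Z g (V - C) \<le> Z g' (V - (A \<inter> C)) * Z g (V - (A \<union> C))"
      using pair_energy_lattice[OF V E, of "2*J" "V - A" "V - C" "\<lambda>j. 2 * g j" "\<lambda>j. 2 * g' j" "\<lambda>_. 1"]
        g J pos_fun_const[OF V, of 1]
      by (simp add: Z_def Diff_Int Diff_Un)
    have "(M A * ZB C) * (Z g' (V - A) * Z g (V - C))
      \<le> (M (A \<union> C) * ZB (A \<inter> C)) * (Z g' (V - (A \<inter> C)) * Z g (V - (A \<union> C)))"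
      using AC M0[of "A \<union> C"] by (intro mult_mono[OF 1 2]) (auto simp: ZB_def Z_def intro!: mult_nonneg_nonneg less_imp_le[OF pos])
    then show "M A * Z g' (V - A) * (ZB C * Z g (V - C))
      \<le> M (A \<union> C) * Z g (V - (A \<union> C)) * (ZB (A \<inter> C) * Z g' (V - A \<inter> C))"
      by (simp add: mult_ac)
  qed (auto simp: ZB_def Z_def intro!: mult_nonneg_nonneg M0 less_imp_le[OF pos])
  moreover have "0 < den g" for g
    unfolding den_def ZB_def Z_def using V by (intro sum_pos mult_pos_pos pos) auto
  ultimately show ?thesis
    unfolding gap by (simp add: divide_simps mult.commute)
qed

section \<open>Finite-volume Ising expectations on the lattice and their monotonicity\<close>

lemma nn_edges_iff: "{i, j} \<in> nn_edges \<longleftrightarrow> (\<Sum>k\<in>UNIV. \<bar>i $ k - j $ k\<bar>) = 1"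
  unfolding nn_edges_def by (auto simp: doubleton_eq_iff abs_minus_commute)

lemma nn_edgesE:
  assumes "e \<in> nn_edges"
  obtains i j where "e = {i, j}" "i \<noteq> j" "(\<Sum>k\<in>UNIV. \<bar>i $ k - j $ k\<bar>) = 1"
  using assms unfolding nn_edges_def by force

lemma nn_edge_memberE:
  assumes "e \<in> nn_edges" "i \<in> e"
  obtains j where "e = {i, j}" "i \<noteq> j"
  using assms by (auto elim!: nn_edgesE intro: that)

lemma card_nn_edge: "e \<in> nn_edges \<Longrightarrow> card e = 2"
  by (elim nn_edgesE) simp

definition lattice_box :: "nat \<Rightarrow> int ^ 'd \<Rightarrow> (int ^ 'd) set" where
  "lattice_box n c = {x. \<forall>k. \<bar>x $ k - c $ k\<bar> \<le> int n}"

lemma finite_lattice_box: "finite (lattice_box n c)"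
proof -
  have "(\<lambda>x. ($) (x - c)) ` lattice_box n c \<subseteq> UNIV \<rightarrow>\<^sub>E {- int n..int n}"
  proof -
    have "- int n \<le> x $ k - c $ k \<and> x $ k - c $ k \<le> int n" if "x \<in> lattice_box n c" for x k
    proof -
      have "\<bar>x $ k - c $ k\<bar> \<le> int n" using that by (simp add: lattice_box_def)
      then show ?thesis by linarith
    qed
    then show ?thesis by auto
  qed
  then have "finite ((\<lambda>x. ($) (x - c)) ` lattice_box n c)"
    by (rule finite_subset) (auto intro: finite_PiE)
  then show ?thesis
    by (rule finite_imageD) (auto simp: inj_on_def vec_eq_iff fun_eq_iff)
qed

lemma neighbour_in_box:
  assumes "{i, j} \<in> nn_edges"
  shows "j \<in> lattice_box 1 i"
  unfolding lattice_box_def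
proof (intro CollectI allI)
  fix k
  have "\<bar>i $ k - j $ k\<bar> \<le> (\<Sum>k\<in>UNIV. \<bar>i $ k - j $ k\<bar>)"
    by (rule member_le_sum) auto
  then show "\<bar>j $ k - i $ k\<bar> \<le> int 1"
    using assms by (simp add: nn_edges_iff abs_minus_commute)
qed

definition touching :: "(int ^ 'd) set \<Rightarrow> (int ^ 'd) set set" where
  "touching V = {e \<in> nn_edges. e \<inter> V \<noteq> {}}"

text \<open>The edges that carry the boundary condition, directed outwards.\<close>

definition crossing :: "(int ^ 'd) set \<Rightarrow> ((int ^ 'd) \<times> (int ^ 'd)) set" where
  "crossing V = {(i, j). i \<in> V \<and> j \<in> outer_boundary V \<and> {i, j} \<in> nn_edges}"

lemma finite_touching: "finite V \<Longrightarrow> finite (touching V)"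
proof -
  assume V: "finite V"
  have "touching V \<subseteq> (\<Union>i\<in>V. (\<lambda>j. {i, j}) ` lattice_box 1 i)"
  proof
    fix e assume e: "e \<in> touching V"
    then obtain i where i: "e \<in> nn_edges" "i \<in> e" "i \<in> V"
      unfolding touching_def by auto
    from nn_edge_memberE[OF i(1,2)] obtain j where "e = {i, j}" .
    then have ij: "e = {i, j}" "i \<in> V" "{i, j} \<in> nn_edges" using i by auto
    then show "e \<in> (\<Union>i\<in>V. (\<lambda>j. {i, j}) ` lattice_box 1 i)"
      using neighbour_in_box by auto
  qed
  then show ?thesis
    by (rule finite_subset) (auto intro: finite_lattice_box V)
qed

lemma crossing_eq: "crossing V = {(i, j). i \<in> V \<and> j \<notin> V \<and> {i, j} \<in> nn_edges}"
  unfolding crossing_def outer_boundary_def by auto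

lemma finite_crossing: "finite V \<Longrightarrow> finite (crossing V)"
  by (rule finite_subset[of _ "Sigma V (lattice_box 1)"])
     (use neighbour_in_box in \<open>force simp: crossing_eq intro: finite_lattice_box\<close>)+

text \<open>The boundary condition is read off from \<open>\<sigma>\<close> itself. The first sum runs over all edges that meet \<open>V\<close>, so
that the energies of nested volumes differ by a function of the spins outside the smaller one
(\<open>energy_superset\<close>).\<close>

definition energy :: "real \<Rightarrow> (int ^ 'd \<Rightarrow> real) \<Rightarrow> (int ^ 'd) set \<Rightarrow> 'd config \<Rightarrow> real" where
  "energy J h V \<sigma> = (\<Sum>e\<in>touching V. J * prod \<sigma> e) + (\<Sum>i\<in>V. h i * \<sigma> i)"

lemma energy_split:
  assumes V: "finite V"
  shows "energy J h V \<sigma> = (\<Sum>e\<in>{e \<in> nn_edges. e \<subseteq> V}. J * prod \<sigma> e) + (\<Sum>i\<in>V. h i * \<sigma> i)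
    + (\<Sum>(i, j)\<in>crossing V. J * \<sigma> i * \<sigma> j)"
proof -
  have ne: "e \<noteq> {}" if "e \<in> nn_edges" for e using card_nn_edge[OF that] by auto
  have "touching V = {e \<in> nn_edges. e \<subseteq> V} \<union> (touching V - {e \<in> nn_edges. e \<subseteq> V})"
    by (auto simp: touching_def dest: ne)
  then have 1: "(\<Sum>e\<in>touching V. J * prod \<sigma> e) = (\<Sum>e\<in>{e \<in> nn_edges. e \<subseteq> V}. J * prod \<sigma> e)
      + (\<Sum>e\<in>touching V - {e \<in> nn_edges. e \<subseteq> V}. J * prod \<sigma> e)"
    using finite_touching[OF V] by (metis (no_types, lifting) Diff_disjoint finite_Un sum.union_disjoint)
  have "bij_betw (\<lambda>(i, j). {i, j}) (crossing V) (touching V - {e \<in> nn_edges. e \<subseteq> V})"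
  proof (rule bij_betw_imageI)
    show "inj_on (\<lambda>(i, j). {i, j}) (crossing V)"
      by (auto simp: inj_on_def crossing_eq doubleton_eq_iff)
    show "(\<lambda>(i, j). {i, j}) ` crossing V = touching V - {e \<in> nn_edges. e \<subseteq> V}"
    proof (intro equalityI subsetI)
      fix e assume "e \<in> touching V - {e \<in> nn_edges. e \<subseteq> V}"
      then obtain i where i: "e \<in> nn_edges" "i \<in> e" "i \<in> V" "\<not> e \<subseteq> V"
        unfolding touching_def by auto
      from nn_edge_memberE[OF i(1,2)] obtain j where "e = {i, j}" .
      then have "e = {i, j}" "i \<in> V" "j \<notin> V" "{i, j} \<in> nn_edges" using i by auto
      then show "e \<in> (\<lambda>(i, j). {i, j}) ` crossing V" by (auto simp: crossing_eq)
    qed (auto simp: touching_def crossing_eq)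
  qed
  then have "(\<Sum>e\<in>touching V - {e \<in> nn_edges. e \<subseteq> V}. J * prod \<sigma> e) =
      (\<Sum>p\<in>crossing V. J * prod \<sigma> ((\<lambda>(i, j). {i, j}) p))"
    by (rule sum.reindex_bij_betw[symmetric])
  also have "\<dots> = (\<Sum>(i, j)\<in>crossing V. J * \<sigma> i * \<sigma> j)"
  proof (intro sum.cong refl)
    fix p assume "p \<in> crossing V"
    then obtain i j where p: "p = (i, j)" "i \<noteq> j" by (auto simp: crossing_eq)
    then show "J * prod \<sigma> ((\<lambda>(i, j). {i, j}) p) = (case p of (i, j) \<Rightarrow> J * \<sigma> i * \<sigma> j)"
      by simp
  qed
  finally show ?thesis unfolding energy_def 1 by simp
qed

lemma bc_configs_off: "\<sigma> \<in> bc_configs V \<mu> \<Longrightarrow> i \<notin> V \<Longrightarrow> \<sigma> i = \<mu> i"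
  by (simp add: bc_configs_def)

lemma hamiltonian_eq_energy:
  assumes "finite V" "\<sigma> \<in> bc_configs V \<mu>"
  shows "hamiltonian J h V \<mu> \<sigma> = - energy J h V \<sigma>"
proof -
  have "(\<Sum>(i, j)\<in>crossing V. J * \<sigma> i * \<mu> j) = (\<Sum>(i, j)\<in>crossing V. J * \<sigma> i * \<sigma> j)"
    using assms(2) by (intro sum.cong) (auto simp: crossing_eq bc_configs_off)
  then show ?thesis
    unfolding energy_split[OF assms(1)] hamiltonian_def crossing_def by simp
qed

text \<open>Identifies configurations with different boundary conditions in the same volume.\<close>

definition extend :: "(int ^ 'd) set \<Rightarrow> 'd config \<Rightarrow> 'd config \<Rightarrow> 'd config" where
  "extend V \<mu> \<sigma> = (\<lambda>i. if i \<in> V then \<sigma> i else \<mu> i)"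

lemma bij_betw_extend:
  assumes "\<mu> \<in> configs"
  shows "bij_betw (extend V \<mu>) (spins V) (bc_configs V \<mu>)"
  by (rule bij_betw_byWitness[where f' = "extend V (\<lambda>_. 1)"])
     (use assms in \<open>fastforce simp: spins_def bc_configs_def configs_def extend_def fun_eq_iff\<close>)+

lemma finite_bc_configs: "finite V \<Longrightarrow> \<mu> \<in> configs \<Longrightarrow> finite (bc_configs V \<mu>)"
  using bij_betw_finite[OF bij_betw_extend] finite_spins by blast

lemma self_bc_configs: "\<mu> \<in> configs \<Longrightarrow> \<mu> \<in> bc_configs V \<mu>"
  by (simp add: bc_configs_def)

lemma bc_configs_subset: "bc_configs V \<mu> \<subseteq> configs"
  by (auto simp: bc_configs_def)

definition gsum ::
  "real \<Rightarrow> (int ^ 'd \<Rightarrow> real) \<Rightarrow> (int ^ 'd) set \<Rightarrow> 'd config \<Rightarrow> ('d config \<Rightarrow> real) \<Rightarrow> real" where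
  "gsum J h V \<mu> f = (\<Sum>\<sigma>\<in>bc_configs V \<mu>. f \<sigma> * exp (energy J h V \<sigma>))"

definition gexp ::
  "real \<Rightarrow> (int ^ 'd \<Rightarrow> real) \<Rightarrow> (int ^ 'd) set \<Rightarrow> 'd config \<Rightarrow> ('d config \<Rightarrow> real) \<Rightarrow> real" where
  "gexp J h V \<mu> f = gsum J h V \<mu> f / gsum J h V \<mu> (\<lambda>_. 1)"

lemma gsum_one_pos: "finite V \<Longrightarrow> \<mu> \<in> configs \<Longrightarrow> 0 < gsum J h V \<mu> (\<lambda>_. 1)"
  unfolding gsum_def using self_bc_configs[of \<mu> V] finite_bc_configs[of V \<mu>]
  by (intro sum_pos) auto

lemma gexp_add: "gexp J h V \<mu> (\<lambda>\<sigma>. f \<sigma> + g \<sigma>) = gexp J h V \<mu> f + gexp J h V \<mu> g"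
  by (simp add: gexp_def gsum_def distrib_right sum.distrib add_divide_distrib)

lemma gexp_diff: "gexp J h V \<mu> (\<lambda>\<sigma>. f \<sigma> - g \<sigma>) = gexp J h V \<mu> f - gexp J h V \<mu> g"
  by (simp add: gexp_def gsum_def left_diff_distrib sum_subtractf diff_divide_distrib)

lemma gexp_mult: "gexp J h V \<mu> (\<lambda>\<sigma>. c * f \<sigma>) = c * gexp J h V \<mu> f"
  by (simp add: gexp_def gsum_def sum_distrib_left mult.assoc)

lemma gexp_sum: "gexp J h V \<mu> (\<lambda>\<sigma>. \<Sum>x\<in>I. f x \<sigma>) = (\<Sum>x\<in>I. gexp J h V \<mu> (f x))"
  by (induction I rule: infinite_finite_induct) (simp_all add: gexp_add, simp_all add: gexp_def gsum_def)

lemma gexp_const: "finite V \<Longrightarrow> \<mu> \<in> configs \<Longrightarrow> gexp J h V \<mu> (\<lambda>_. c) = c"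
  using gexp_mult[of J h V \<mu> c "\<lambda>_. 1"] gsum_one_pos[of V \<mu> J h] by (simp add: gexp_def)

lemma energy_superset:
  assumes U: "finite U" and VU: "V \<subseteq> U" and \<sigma>: "\<sigma> \<in> bc_configs V \<mu>"
  shows "energy J h U \<sigma> = energy J h V \<sigma>
    + ((\<Sum>e\<in>touching U - touching V. J * prod \<mu> e) + (\<Sum>i\<in>U - V. h i * \<mu> i))"
proof -
  have sub: "touching V \<subseteq> touching U" using VU by (auto simp: touching_def)
  have "prod \<sigma> e = prod \<mu> e" if "e \<in> touching U - touching V" for e
    using that by (intro prod.cong bc_configs_off[OF \<sigma>]) (auto simp: touching_def)
  then have 1: "(\<Sum>e\<in>touching U. J * prod \<sigma> e) =
      (\<Sum>e\<in>touching U - touching V. J * prod \<mu> e) + (\<Sum>e\<in>touching V. J * prod \<sigma> e)"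
    unfolding sum.subset_diff[OF sub finite_touching[OF U]] by simp
  have 2: "(\<Sum>i\<in>U. h i * \<sigma> i) = (\<Sum>i\<in>U - V. h i * \<mu> i) + (\<Sum>i\<in>V. h i * \<sigma> i)"
    unfolding sum.subset_diff[OF VU U] by (simp add: bc_configs_off[OF \<sigma>])
  show ?thesis unfolding energy_def 1 2 by simp
qed

lemma gexp_superset:
  assumes "finite U" "V \<subseteq> U"
  shows "gexp J h V \<mu> f = (\<Sum>\<sigma>\<in>bc_configs V \<mu>. f \<sigma> * exp (energy J h U \<sigma>))
      / (\<Sum>\<sigma>\<in>bc_configs V \<mu>. exp (energy J h U \<sigma>))"
  unfolding gexp_def gsum_def
  by (simp add: energy_superset[OF assms] exp_add[of "energy J h V _"] mult.assoc[symmetric]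
      sum_distrib_right[symmetric])

text \<open>For two pairs of spins \<open>\<sigma>\<^sub>i\<sigma>\<^sub>j + \<tau>\<^sub>i\<tau>\<^sub>j\<close> does not decrease when the pairs are replaced by their minimum and
maximum, and single-site terms are unchanged.\<close>

lemma energy_supermodular:
  assumes J: "0 \<le> J" and \<sigma>: "\<sigma> \<in> configs" and \<tau>: "\<tau> \<in> configs"
  shows "energy J h V \<sigma> + energy J h V \<tau> \<le>
    energy J h V (\<lambda>i. min (\<sigma> i) (\<tau> i)) + energy J h V (\<lambda>i. max (\<sigma> i) (\<tau> i))"
proof -
  have "J * prod \<sigma> e + J * prod \<tau> e \<le>
    J * prod (\<lambda>i. min (\<sigma> i) (\<tau> i)) e + J * prod (\<lambda>i. max (\<sigma> i) (\<tau> i)) e" if "e \<in> touching V" for e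
  proof -
    have "e \<in> nn_edges" using that by (simp add: touching_def)
    then obtain i j where e: "e = {i, j}" "i \<noteq> j" by (rule nn_edgesE)
    have "\<sigma> i \<in> {-1, 1}" "\<sigma> j \<in> {-1, 1}" "\<tau> i \<in> {-1, 1}" "\<tau> j \<in> {-1, 1}"
      using \<sigma> \<tau> by (auto simp: configs_def)
    then have "prod \<sigma> e + prod \<tau> e \<le>
      prod (\<lambda>i. min (\<sigma> i) (\<tau> i)) e + prod (\<lambda>i. max (\<sigma> i) (\<tau> i)) e"
      using e by auto
    then show ?thesis using J by (metis distrib_left mult_left_mono)
  qed
  then have "(\<Sum>e\<in>touching V. J * prod \<sigma> e) + (\<Sum>e\<in>touching V. J * prod \<tau> e) \<le>
    (\<Sum>e\<in>touching V. J * prod (\<lambda>i. min (\<sigma> i) (\<tau> i)) e) + (\<Sum>e\<in>touching V. J * prod (\<lambda>i. max (\<sigma> i) (\<tau> i)) e)"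
    unfolding sum.distrib[symmetric] by (rule sum_mono)
  moreover have "(\<Sum>i\<in>V. h i * \<sigma> i) + (\<Sum>i\<in>V. h i * \<tau> i) =
    (\<Sum>i\<in>V. h i * min (\<sigma> i) (\<tau> i)) + (\<Sum>i\<in>V. h i * max (\<sigma> i) (\<tau> i))"
    unfolding sum.distrib[symmetric] distrib_left[symmetric]
    by (intro sum.cong arg_cong2[where f = "(*)"] refl) (auto simp: min_def max_def)
  ultimately show ?thesis unfolding energy_def by linarith
qed

text \<open>Codes a configuration by its set of minus spins; union of codes is then the minimum of configurations.\<close>

definition minus_on :: "(int ^ 'd) set \<Rightarrow> 'd config \<Rightarrow> (int ^ 'd) set \<Rightarrow> 'd config" where
  "minus_on U \<mu> B = (\<lambda>i. if i \<in> U then (if i \<in> B then -1 else 1) else \<mu> i)"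

lemma sum_bc_configs_Pow:
  assumes U: "finite U" and VU: "V \<subseteq> U" and \<mu>: "\<mu> \<in> configs"
  shows "(\<Sum>\<sigma>\<in>bc_configs V \<mu>. f \<sigma>) =
    (\<Sum>B\<in>Pow U. if minus_on U \<mu> B \<in> bc_configs V \<mu> then f (minus_on U \<mu> B) else 0)"
proof -
  have sub: "bc_configs V \<mu> \<subseteq> bc_configs U \<mu>" using VU by (auto simp: bc_configs_def)
  have bij: "bij_betw (minus_on U \<mu>) (Pow U) (bc_configs U \<mu>)"
    by (rule bij_betw_byWitness[where f' = "\<lambda>\<sigma>. {i \<in> U. \<sigma> i = -1}"])
       (use \<mu> in \<open>auto simp: bc_configs_def configs_def minus_on_def fun_eq_iff split: if_splits\<close>)
  have "(\<Sum>\<sigma>\<in>bc_configs V \<mu>. f \<sigma>) = (\<Sum>\<sigma>\<in>bc_configs U \<mu>. if \<sigma> \<in> bc_configs V \<mu> then f \<sigma> else 0)"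
    using sub finite_bc_configs[OF U \<mu>] by (intro sum.mono_neutral_cong_left) auto
  then show ?thesis
    using sum.reindex_bij_betw[OF bij, of "\<lambda>\<sigma>. if \<sigma> \<in> bc_configs V \<mu> then f \<sigma> else 0"] by simp
qed

text \<open>Holley's inequality for two volumes and boundary conditions at once. Both measures are written with the
energy of the union \<open>U\<close> of the volumes, which changes each only by a constant factor; supermodularity of
this energy and the lattice hypothesis give the condition of the four functions theorem on \<open>Pow U\<close>.\<close>

lemma holley_nonneg:
  assumes V: "finite V" and V': "finite V'" and \<mu>: "\<mu> \<in> configs" and \<nu>: "\<nu> \<in> configs" and J: "0 \<le> J"
    and lattice: "\<And>\<sigma> \<tau>. \<sigma> \<in> bc_configs V \<mu> \<Longrightarrow> \<tau> \<in> bc_configs V' \<nu> \<Longrightarrow>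
      (\<lambda>i. min (\<sigma> i) (\<tau> i)) \<in> bc_configs V \<mu> \<and> (\<lambda>i. max (\<sigma> i) (\<tau> i)) \<in> bc_configs V' \<nu>"
    and f0: "\<And>\<sigma>. \<sigma> \<in> configs \<Longrightarrow> 0 \<le> f \<sigma>"
    and mono: "\<And>\<sigma> \<tau>. \<sigma> \<in> configs \<Longrightarrow> \<tau> \<in> configs \<Longrightarrow> (\<And>i. \<sigma> i \<le> \<tau> i) \<Longrightarrow> f \<sigma> \<le> f \<tau>"
  shows "gexp J h V \<mu> f \<le> gexp J h V' \<nu> f"
proof -
  define U where "U = V \<union> V'"
  have U: "finite U" "V \<subseteq> U" "V' \<subseteq> U" using V V' by (auto simp: U_def)
  let ?w = "\<lambda>\<sigma>. exp (energy J h U \<sigma>)"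
  let ?c = "\<lambda>V \<mu> B. minus_on U \<mu> B \<in> bc_configs V \<mu>"
  let ?\<alpha> = "\<lambda>B. if ?c V \<mu> B then f (minus_on U \<mu> B) * ?w (minus_on U \<mu> B) else 0"
  let ?\<beta> = "\<lambda>B. if ?c V' \<nu> B then ?w (minus_on U \<nu> B) else 0"
  let ?\<gamma> = "\<lambda>B. if ?c V \<mu> B then ?w (minus_on U \<mu> B) else 0"
  let ?\<delta> = "\<lambda>B. if ?c V' \<nu> B then f (minus_on U \<nu> B) * ?w (minus_on U \<nu> B) else 0"
  have f0': "0 \<le> f \<sigma>" if "\<sigma> \<in> bc_configs W \<eta>" for \<sigma> W \<eta>
    using f0 bc_configs_subset that by blast
  have "sum ?\<alpha> (Pow U) * sum ?\<beta> (Pow U) \<le> sum ?\<gamma> (Pow U) * sum ?\<delta> (Pow U)"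
  proof (rule four_functions[OF U(1)])
    fix A B assume AB: "A \<subseteq> U" "B \<subseteq> U"
    let ?\<sigma> = "minus_on U \<mu> A" and ?\<tau> = "minus_on U \<nu> B"
    let ?lo = "\<lambda>i. min (?\<sigma> i) (?\<tau> i)" and ?hi = "\<lambda>i. max (?\<sigma> i) (?\<tau> i)"
    have nn: "0 \<le> ?\<gamma> (A \<union> B) * ?\<delta> (A \<inter> B)"
      by (auto intro!: mult_nonneg_nonneg f0')
    show "?\<alpha> A * ?\<beta> B \<le> ?\<gamma> (A \<union> B) * ?\<delta> (A \<inter> B)"
    proof (cases "?c V \<mu> A \<and> ?c V' \<nu> B")
      case True
      then have m: "?lo \<in> bc_configs V \<mu>" "?hi \<in> bc_configs V' \<nu>" using lattice by blast+
      have lo: "minus_on U \<mu> (A \<union> B) = ?lo"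
      proof
        fix i show "minus_on U \<mu> (A \<union> B) i = ?lo i"
          using bc_configs_off[OF m(1), of i, symmetric] U by (cases "i \<in> U") (auto simp: minus_on_def)
      qed
      have hi: "minus_on U \<nu> (A \<inter> B) = ?hi"
      proof
        fix i show "minus_on U \<nu> (A \<inter> B) i = ?hi i"
          using bc_configs_off[OF m(2), of i, symmetric] U by (cases "i \<in> U") (auto simp: minus_on_def)
      qed
      have conf: "?\<sigma> \<in> configs" "?\<tau> \<in> configs" "?hi \<in> configs"
        using True m bc_configs_subset by blast+
      have "f ?\<sigma> * (?w ?\<sigma> * ?w ?\<tau>) \<le> f ?hi * (?w ?lo * ?w ?hi)"
      proof (rule mult_mono)
        show "f ?\<sigma> \<le> f ?hi" using conf by (intro mono) auto
        show "?w ?\<sigma> * ?w ?\<tau> \<le> ?w ?lo * ?w ?hi"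
          using energy_supermodular[OF J conf(1,2), of h U] by (simp add: exp_add[symmetric])
      qed (use conf f0 in auto)
      then show ?thesis using True m by (simp add: lo hi mult_ac)
    qed (use nn in auto)
  qed (auto intro!: mult_nonneg_nonneg f0')
  then have "(\<Sum>\<sigma>\<in>bc_configs V \<mu>. f \<sigma> * ?w \<sigma>) * (\<Sum>\<sigma>\<in>bc_configs V' \<nu>. ?w \<sigma>)
    \<le> (\<Sum>\<sigma>\<in>bc_configs V \<mu>. ?w \<sigma>) * (\<Sum>\<sigma>\<in>bc_configs V' \<nu>. f \<sigma> * ?w \<sigma>)"
    unfolding sum_bc_configs_Pow[OF U(1,2) \<mu>] sum_bc_configs_Pow[OF U(1,3) \<nu>] .
  moreover have "0 < (\<Sum>\<sigma>\<in>bc_configs V \<mu>. ?w \<sigma>)" "0 < (\<Sum>\<sigma>\<in>bc_configs V' \<nu>. ?w \<sigma>)"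
    using self_bc_configs[OF \<mu>, of V] self_bc_configs[OF \<nu>, of V'] finite_bc_configs[OF V \<mu>]
      finite_bc_configs[OF V' \<nu>] by (intro sum_pos; auto)+
  ultimately show ?thesis
    unfolding gexp_superset[OF U(1,2)] gexp_superset[OF U(1,3)]
    by (simp add: divide_simps mult.commute)
qed

lemma configs_cases: "\<sigma> \<in> configs \<Longrightarrow> \<sigma> i = 1 \<or> \<sigma> i = -1"
  by (auto simp: configs_def)

definition increasing :: "('d config \<Rightarrow> real) \<Rightarrow> bool" where
  "increasing f \<longleftrightarrow> (\<forall>\<sigma>\<in>configs. \<forall>\<tau>\<in>configs. (\<forall>i. \<sigma> i \<le> \<tau> i) \<longrightarrow> f \<sigma> \<le> f \<tau>)"

lemma plus_config: "(\<lambda>_. 1) \<in> configs" and minus_config: "(\<lambda>_. -1) \<in> configs"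
  by (auto simp: configs_def)

lemma holley_inequality:
  assumes V: "finite V" and V': "finite V'" and \<mu>: "\<mu> \<in> configs" and \<nu>: "\<nu> \<in> configs" and J: "0 \<le> J"
    and lattice: "\<And>\<sigma> \<tau>. \<sigma> \<in> bc_configs V \<mu> \<Longrightarrow> \<tau> \<in> bc_configs V' \<nu> \<Longrightarrow>
      (\<lambda>i. min (\<sigma> i) (\<tau> i)) \<in> bc_configs V \<mu> \<and> (\<lambda>i. max (\<sigma> i) (\<tau> i)) \<in> bc_configs V' \<nu>"
    and inc: "increasing f"
  shows "gexp J h V \<mu> f \<le> gexp J h V' \<nu> f"
proof -
  \<comment> \<open>the value of an increasing function at the all-minus configuration is its minimum\<close>
  let ?m = "f (\<lambda>_. -1)"
  have "gexp J h V \<mu> (\<lambda>\<sigma>. f \<sigma> - ?m) \<le> gexp J h V' \<nu> (\<lambda>\<sigma>. f \<sigma> - ?m)"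
  proof (rule holley_nonneg[OF V V' \<mu> \<nu> J lattice])
    show "0 \<le> f \<sigma> - ?m" if "\<sigma> \<in> configs" for \<sigma>
    proof -
      have "-1 \<le> \<sigma> i" for i using configs_cases[OF that, of i] by auto
      then show ?thesis using inc that minus_config by (auto simp: increasing_def)
    qed
  qed (use inc in \<open>auto simp: increasing_def\<close>)
  then show ?thesis by (simp add: gexp_diff gexp_const V V' \<mu> \<nu>)
qed

lemma configs_min_max:
  "\<sigma> \<in> configs \<Longrightarrow> \<tau> \<in> configs \<Longrightarrow> (\<lambda>i. min (\<sigma> i) (\<tau> i)) \<in> configs \<and> (\<lambda>i. max (\<sigma> i) (\<tau> i)) \<in> configs"
  by (auto simp: configs_def min_def max_def)

text \<open>The plus state of a smaller volume dominates, since there the spins in between are pinned to \<open>1\<close>.\<close>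

lemma gexp_le_plus:
  assumes "finite V" "V' \<subseteq> V" "\<mu> \<in> configs" "0 \<le> J" "increasing f"
  shows "gexp J h V \<mu> f \<le> gexp J h V' (\<lambda>_. 1) f"
proof (rule holley_inequality[OF assms(1) finite_subset[OF assms(2,1)] assms(3) plus_config assms(4) _ assms(5)])
  fix \<sigma> \<tau> assume *: "\<sigma> \<in> bc_configs V \<mu>" "\<tau> \<in> bc_configs V' (\<lambda>_. 1)"
  have le: "\<sigma> i \<le> 1" for i using * configs_cases[of \<sigma> i] by (auto simp: bc_configs_def)
  show "(\<lambda>i. min (\<sigma> i) (\<tau> i)) \<in> bc_configs V \<mu> \<and> (\<lambda>i. max (\<sigma> i) (\<tau> i)) \<in> bc_configs V' (\<lambda>_. 1)"
  proof -
    have "min (\<sigma> i) (\<tau> i) = \<mu> i" if "i \<notin> V" for i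
      using that * assms(2) le[of i] unfolding bc_configs_def by (auto simp: min_def)
    moreover have "max (\<sigma> i) (\<tau> i) = 1" if "i \<notin> V'" for i
      using that * assms(2) le[of i] unfolding bc_configs_def by (auto simp: max_def)
    ultimately show ?thesis
      using * configs_min_max[of \<sigma> \<tau>] unfolding bc_configs_def by auto
  qed
qed

lemma gexp_ge_minus:
  assumes "finite V" "V' \<subseteq> V" "\<mu> \<in> configs" "0 \<le> J" "increasing f"
  shows "gexp J h V' (\<lambda>_. -1) f \<le> gexp J h V \<mu> f"
proof (rule holley_inequality[OF finite_subset[OF assms(2,1)] assms(1) minus_config assms(3,4) _ assms(5)])
  fix \<sigma> \<tau> assume *: "\<sigma> \<in> bc_configs V' (\<lambda>_. -1)" "\<tau> \<in> bc_configs V \<mu>"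
  have le: "-1 \<le> \<tau> i" for i using * configs_cases[of \<tau> i] by (auto simp: bc_configs_def)
  show "(\<lambda>i. min (\<sigma> i) (\<tau> i)) \<in> bc_configs V' (\<lambda>_. -1) \<and> (\<lambda>i. max (\<sigma> i) (\<tau> i)) \<in> bc_configs V \<mu>"
  proof -
    have "min (\<sigma> i) (\<tau> i) = -1" if "i \<notin> V'" for i
      using that * assms(2) le[of i] unfolding bc_configs_def by (auto simp: min_def)
    moreover have "max (\<sigma> i) (\<tau> i) = \<mu> i" if "i \<notin> V" for i
      using that * assms(2) le[of i] unfolding bc_configs_def by (auto simp: max_def)
    ultimately show ?thesis
      using * configs_min_max[of \<sigma> \<tau>] unfolding bc_configs_def by auto
  qed
qed

section \<open>The gap between plus and minus boundary conditions\<close>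

definition gap :: "real \<Rightarrow> (int ^ 'd \<Rightarrow> real) \<Rightarrow> (int ^ 'd) set \<Rightarrow> int ^ 'd \<Rightarrow> real" where
  "gap J h V i = gexp J h V (\<lambda>_. 1) (\<lambda>\<sigma>. \<sigma> i) - gexp J h V (\<lambda>_. -1) (\<lambda>\<sigma>. \<sigma> i)"

lemma increasing_spin: "increasing (\<lambda>\<sigma>. \<sigma> i)"
  by (simp add: increasing_def)

lemma gap_antimono_volume:
  assumes "finite V" "V' \<subseteq> V" "0 \<le> J"
  shows "gap J h V i \<le> gap J h V' i"
  unfolding gap_def
  using gexp_le_plus[OF assms(1,2) plus_config assms(3) increasing_spin, of h i]
    gexp_ge_minus[OF assms(1,2) minus_config assms(3) increasing_spin, of h i] by simp

definition outer_degree :: "(int ^ 'd) set \<Rightarrow> int ^ 'd \<Rightarrow> real" where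
  "outer_degree V i = real (card {j. (i, j) \<in> crossing V})"

text \<open>A constant boundary condition acts as a field, proportional to the number of outside neighbours.\<close>

lemma energy_constant_bc:
  assumes V: "finite V"
  shows "energy J h V (extend V (\<lambda>_. s) \<sigma>) =
    pair_energy J {e \<in> nn_edges. e \<subseteq> V} (\<lambda>i. h i + s * (J * outer_degree V i)) V \<sigma>"
proof -
  let ?\<tau> = "extend V (\<lambda>_. s) \<sigma>"
  have fin: "finite {j. (i, j) \<in> crossing V}" for i
    by (rule finite_subset[OF _ finite_imageI[OF finite_crossing[OF V], of snd]]) force
  have 1: "(\<Sum>e\<in>{e \<in> nn_edges. e \<subseteq> V}. J * prod ?\<tau> e) = (\<Sum>e\<in>{e \<in> nn_edges. e \<subseteq> V}. J * prod \<sigma> e)"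
    by (intro sum.cong refl arg_cong2[where f = "(*)"] prod.cong) (auto simp: extend_def)
  have 2: "(\<Sum>i\<in>V. h i * ?\<tau> i) = (\<Sum>i\<in>V. h i * \<sigma> i)"
    by (intro sum.cong) (auto simp: extend_def)
  have "(\<Sum>(i, j)\<in>crossing V. J * ?\<tau> i * ?\<tau> j) = (\<Sum>(i, j)\<in>crossing V. J * \<sigma> i * s)"
    by (intro sum.cong) (auto simp: extend_def crossing_eq)
  also have "\<dots> = (\<Sum>(i, j)\<in>Sigma V (\<lambda>i. {j. (i, j) \<in> crossing V}). J * \<sigma> i * s)"
    by (rule sum.cong) (auto simp: crossing_eq)
  also have "\<dots> = (\<Sum>i\<in>V. \<Sum>j\<in>{j. (i, j) \<in> crossing V}. J * \<sigma> i * s)"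
    using V fin by (intro sum.Sigma[symmetric]) auto
  also have "\<dots> = (\<Sum>i\<in>V. s * (J * outer_degree V i) * \<sigma> i)"
    by (simp add: outer_degree_def mult_ac)
  finally have 3: "(\<Sum>(i, j)\<in>crossing V. J * ?\<tau> i * ?\<tau> j) = (\<Sum>i\<in>V. s * (J * outer_degree V i) * \<sigma> i)" .
  show ?thesis
    unfolding energy_split[OF V] pair_energy_def 1 2 3
    by (simp add: distrib_right sum.distrib cong: conj_cong)
qed

lemma gsum_extend:
  assumes "\<mu> \<in> configs"
  shows "gsum J h V \<mu> f = (\<Sum>\<sigma>\<in>spins V. f (extend V \<mu> \<sigma>) * exp (energy J h V (extend V \<mu> \<sigma>)))"
  unfolding gsum_def by (rule sum.reindex_bij_betw[OF bij_betw_extend[OF assms], symmetric])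

lemma gexp_constant_bc:
  assumes V: "finite V" and s: "s = 1 \<or> s = -1" and i: "i \<in> V"
  shows "gexp J h V (\<lambda>_. s) (\<lambda>\<sigma>. \<sigma> i) =
    spin_mean J {e \<in> nn_edges. e \<subseteq> V} V (\<lambda>i. h i + s * (J * outer_degree V i)) i"
proof -
  have s': "(\<lambda>_. s) \<in> configs" using s by (auto simp: configs_def)
  have "extend V (\<lambda>_. s) \<sigma> i = \<sigma> i" for \<sigma> using i by (simp add: extend_def)
  then show ?thesis
    unfolding gexp_def gsum_extend[OF s'] energy_constant_bc[OF V] spin_mean_def by simp
qed

lemma gap_antimono_field:
  assumes V: "finite V" and J: "0 \<le> J" and i: "i \<in> V"
    and h: "\<And>j. j \<in> V \<Longrightarrow> 0 \<le> h j" "\<And>j. j \<in> V \<Longrightarrow> h j \<le> h' j"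
  shows "gap J h' V i \<le> gap J h V i"
proof -
  have "finite {e \<in> nn_edges. e \<subseteq> V}"
    by (rule finite_subset[of _ "Pow V"]) (use V in auto)
  from spin_mean_gap_antimono[OF V this _ J i, of "\<lambda>i. J * outer_degree V i" h h'] show ?thesis
    unfolding gap_def gexp_constant_bc[OF V disjI1[OF refl] i] gexp_constant_bc[OF V disjI2[OF refl] i]
    using J h by (simp add: card_nn_edge outer_degree_def)
qed

text \<open>A change of the boundary condition changes the energy by at most \<open>2 * J\<close> for each boundary edge.\<close>

lemma gsum_flip_le:
  assumes V: "finite V" and J: "0 \<le> J" and \<mu>: "\<mu> \<in> configs" and \<nu>: "\<nu> \<in> configs"
  shows "gsum J h V \<mu> (\<lambda>_. 1) \<le> exp (2 * J * real (card (crossing V))) * gsum J h V \<nu> (\<lambda>_. 1)"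
proof -
  have "energy J h V (extend V \<mu> \<sigma>) \<le> 2 * J * real (card (crossing V)) + energy J h V (extend V \<nu> \<sigma>)"
    if \<sigma>: "\<sigma> \<in> spins V" for \<sigma>
  proof -
    have 1: "(\<Sum>e\<in>{e \<in> nn_edges. e \<subseteq> V}. J * prod (extend V \<mu> \<sigma>) e) =
        (\<Sum>e\<in>{e \<in> nn_edges. e \<subseteq> V}. J * prod (extend V \<nu> \<sigma>) e)"
      by (intro sum.cong refl arg_cong2[where f = "(*)"] prod.cong) (auto simp: extend_def)
    have 2: "(\<Sum>i\<in>V. h i * extend V \<mu> \<sigma> i) = (\<Sum>i\<in>V. h i * extend V \<nu> \<sigma> i)"
      by (intro sum.cong) (auto simp: extend_def)
    have c: "extend V \<mu> \<sigma> \<in> configs" "extend V \<nu> \<sigma> \<in> configs"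
      using bij_betw_apply[OF bij_betw_extend[OF \<mu>] \<sigma>] bij_betw_apply[OF bij_betw_extend[OF \<nu>] \<sigma>]
        bc_configs_subset by blast+
    have "(\<Sum>(i, j)\<in>crossing V. J * extend V \<mu> \<sigma> i * extend V \<mu> \<sigma> j) \<le>
        (\<Sum>(i, j)\<in>crossing V. 2 * J + J * extend V \<nu> \<sigma> i * extend V \<nu> \<sigma> j)"
    proof (rule sum_mono, clarify)
      fix i j
      have "extend V \<mu> \<sigma> i * extend V \<mu> \<sigma> j \<le> 2 + extend V \<nu> \<sigma> i * extend V \<nu> \<sigma> j"
        using configs_cases[OF c(1), of i] configs_cases[OF c(1), of j]
          configs_cases[OF c(2), of i] configs_cases[OF c(2), of j] by auto
      from mult_left_mono[OF this J]
      show "J * extend V \<mu> \<sigma> i * extend V \<mu> \<sigma> j \<le> 2 * J + J * extend V \<nu> \<sigma> i * extend V \<nu> \<sigma> j"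
        by (simp add: algebra_simps)
    qed
    also have "\<dots> = 2 * J * real (card (crossing V)) + (\<Sum>(i, j)\<in>crossing V. J * extend V \<nu> \<sigma> i * extend V \<nu> \<sigma> j)"
      by (simp add: sum.distrib case_prod_beta)
    finally show ?thesis unfolding energy_split[OF V] 1 2 by simp
  qed
  then show ?thesis
    unfolding gsum_extend[OF \<mu>] gsum_extend[OF \<nu>] sum_distrib_left
    by (intro sum_mono) (simp add: exp_add[symmetric])
qed

lemma gsum_scaled_derivative:
  assumes V: "finite V" and \<mu>: "\<mu> \<in> configs"
  shows "((\<lambda>t. ln (gsum J (\<lambda>i. t * h i) V \<mu> (\<lambda>_. 1))) has_real_derivative
    (\<Sum>i\<in>V. h i * gexp J (\<lambda>i. t * h i) V \<mu> (\<lambda>\<sigma>. \<sigma> i))) (at t)"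
proof -
  have E: "energy J (\<lambda>i. t * h i) V \<sigma> = (\<Sum>e\<in>touching V. J * prod \<sigma> e) + t * (\<Sum>i\<in>V. h i * \<sigma> i)" for t \<sigma>
    by (simp add: energy_def sum_distrib_left mult.assoc)
  have "((\<lambda>t. gsum J (\<lambda>i. t * h i) V \<mu> (\<lambda>_. 1)) has_real_derivative
    gsum J (\<lambda>i. t * h i) V \<mu> (\<lambda>\<sigma>. \<Sum>i\<in>V. h i * \<sigma> i)) (at t)"
    unfolding gsum_def E
    by (auto intro!: derivative_eq_intros sum.cong)
  then have "((\<lambda>t. ln (gsum J (\<lambda>i. t * h i) V \<mu> (\<lambda>_. 1))) has_real_derivative
    gexp J (\<lambda>i. t * h i) V \<mu> (\<lambda>\<sigma>. \<Sum>i\<in>V. h i * \<sigma> i)) (at t)"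
    unfolding gexp_def using gsum_one_pos[OF V \<mu>] by (auto intro!: derivative_eq_intros)
  then show ?thesis by (simp add: gexp_sum gexp_mult)
qed

text \<open>Mean value theorem for the logarithm of the quotient of the two partition functions in the field
\<open>t * h\<close>. Its derivative at \<open>t\<close> is the left-hand side with the gap in the field \<open>t * h\<close>, which is at
least the gap in the field \<open>h\<close>.\<close>

lemma sum_field_gap_le_boundary:
  assumes V: "finite V" and J: "0 \<le> J" and h: "\<And>i. i \<in> V \<Longrightarrow> 0 \<le> h i"
  shows "(\<Sum>i\<in>V. h i * gap J h V i) \<le> 4 * J * real (card (crossing V))"
proof -
  let ?Z = "\<lambda>s t. gsum J (\<lambda>i. t * h i) V (\<lambda>_. s) (\<lambda>_. 1)"
  let ?c = "2 * J * real (card (crossing V))"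
  define \<phi> where "\<phi> t = ln (?Z 1 t) - ln (?Z (-1) t)" for t
  have pos: "0 < ?Z 1 t" "0 < ?Z (-1) t" for t
    using gsum_one_pos[OF V] plus_config minus_config by blast+
  have "\<bar>\<phi> t\<bar> \<le> ?c" for t
  proof -
    have "ln (?Z 1 t) \<le> ln (exp ?c * ?Z (-1) t)" "ln (?Z (-1) t) \<le> ln (exp ?c * ?Z 1 t)"
      using gsum_flip_le[OF V J plus_config minus_config, of "\<lambda>i. t * h i"] pos
        gsum_flip_le[OF V J minus_config plus_config, of "\<lambda>i. t * h i"] by simp_all
    then show ?thesis using pos(1)[of t] pos(2)[of t]
      by (simp add: \<phi>_def ln_mult abs_le_iff del: of_nat_mult)
  qed
  from this[of 0] this[of 1] have bound: "\<phi> 1 - \<phi> 0 \<le> 4 * J * real (card (crossing V))" by linarith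
  have "(\<phi> has_real_derivative (\<Sum>i\<in>V. h i * gap J (\<lambda>i. t * h i) V i)) (at t)" for t
    unfolding \<phi>_def[abs_def] gap_def right_diff_distrib sum_subtractf
    by (intro DERIV_diff gsum_scaled_derivative V plus_config minus_config)
  from MVT2[of 0 1, OF _ this] obtain z where z: "0 < z" "z < 1"
    "\<phi> 1 - \<phi> 0 = (\<Sum>i\<in>V. h i * gap J (\<lambda>i. z * h i) V i)" by auto
  have "(\<Sum>i\<in>V. h i * gap J h V i) \<le> (\<Sum>i\<in>V. h i * gap J (\<lambda>i. z * h i) V i)"
    using h z by (intro sum_mono mult_left_mono gap_antimono_field V J) (auto intro: mult_left_le_one_le)
  with z bound show ?thesis by simp
qed

lemma nn_edges_translate: "{i + a, j + a} \<in> nn_edges \<longleftrightarrow> {i, j} \<in> nn_edges"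
  by (simp add: nn_edges_iff)

lemma gexp_translate:
  fixes V :: "(int ^ 'd) set"
  assumes V: "finite V"
  shows "gexp J (\<lambda>_. \<epsilon>) ((\<lambda>i. i + a) ` V) (\<lambda>_. s) (\<lambda>\<sigma>. \<sigma> (i + a)) = gexp J (\<lambda>_. \<epsilon>) V (\<lambda>_. s) (\<lambda>\<sigma>. \<sigma> i)"
proof -
  let ?t = "\<lambda>i. i + a"
  let ?W = "?t ` V"
  have inj: "inj_on ?t A" for A by simp
  have W: "x \<in> ?W \<longleftrightarrow> x - a \<in> V" for x
    by (auto intro!: image_eqI[of _ _ "x - a"])
  have bij: "bij_betw (\<lambda>\<sigma> i. \<sigma> (i - a)) (bc_configs V (\<lambda>_. s)) (bc_configs ?W (\<lambda>_. s))"
  proof (rule bij_betw_byWitness[where f' = "\<lambda>\<sigma> i. \<sigma> (i + a)"])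
    have "i - a \<notin> V" if "i \<notin> ?W" for i using that by (simp add: W)
    then show "(\<lambda>\<sigma> i. \<sigma> (i - a)) ` bc_configs V (\<lambda>_. s) \<subseteq> bc_configs ?W (\<lambda>_. s)"
      by (auto simp: bc_configs_def configs_def)
    have "i + a \<notin> ?W" if "i \<notin> V" for i using that by auto
    then show "(\<lambda>\<sigma> i. \<sigma> (i + a)) ` bc_configs ?W (\<lambda>_. s) \<subseteq> bc_configs V (\<lambda>_. s)"
      unfolding bc_configs_def configs_def by blast
  qed auto
  have E: "energy J (\<lambda>_. \<epsilon>) ?W (\<lambda>i. \<sigma> (i - a)) = energy J (\<lambda>_. \<epsilon>) V \<sigma>" for \<sigma>
  proof -
    have cr: "bij_betw (\<lambda>(i, j). (?t i, ?t j)) (crossing V) (crossing ?W)"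
      by (rule bij_betw_byWitness[where f' = "\<lambda>(i, j). (i - a, j - a)"])
         (auto simp: crossing_eq W nn_edges_iff algebra_simps)
    have ed: "bij_betw ((`) ?t) {e \<in> nn_edges. e \<subseteq> V} {e \<in> nn_edges. e \<subseteq> ?W}"
    proof (rule bij_betw_imageI)
      show "inj_on ((`) ?t) {e \<in> nn_edges. e \<subseteq> V}" by (auto simp: inj_on_def inj_image_eq_iff)
      show "(`) ?t ` {e \<in> nn_edges. e \<subseteq> V} = {e \<in> nn_edges. e \<subseteq> ?W}"
      proof (intro equalityI subsetI)
        fix e assume "e \<in> (`) ?t ` {e \<in> nn_edges. e \<subseteq> V}"
        then obtain e' where e': "e' \<in> nn_edges" "e' \<subseteq> V" "e = ?t ` e'" by auto
        then obtain i j where "e' = {i, j}" by (elim nn_edgesE) auto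
        with e' show "e \<in> {e \<in> nn_edges. e \<subseteq> ?W}" by (auto simp: nn_edges_translate)
      next
        fix e assume "e \<in> {e \<in> nn_edges. e \<subseteq> ?W}"
        then have e: "e \<in> nn_edges" "e \<subseteq> ?W" by auto
        then obtain i j where "e = {i, j}" by (elim nn_edgesE) auto
        with e obtain i' j' where "e = {i' + a, j' + a}" "i' \<in> V" "j' \<in> V" by auto
        with e have "e = ?t ` {i', j'}" "{i', j'} \<in> nn_edges" "{i', j'} \<subseteq> V"
          by (auto simp: nn_edges_translate)
        then show "e \<in> (`) ?t ` {e \<in> nn_edges. e \<subseteq> V}" by blast
      qed
    qed
    have pr: "prod (\<lambda>i. \<sigma> (i - a)) (?t ` e) = prod \<sigma> e" for e
      by (subst prod.reindex[OF inj]) (simp add: o_def)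
    have finW: "finite ?W" using V by simp
    show ?thesis
      unfolding energy_split[OF V] energy_split[OF finW]
        sum.reindex_bij_betw[OF ed, symmetric] sum.reindex_bij_betw[OF cr, symmetric] pr sum.reindex[OF inj]
      by (simp add: o_def case_prod_beta)
  qed
  show ?thesis
    unfolding gexp_def gsum_def sum.reindex_bij_betw[OF bij, symmetric] E by simp
qed

lemma lattice_box_translate: "lattice_box n (c + a) = (\<lambda>i. i + a) ` lattice_box n c"
proof -
  have "x \<in> (\<lambda>i. i + a) ` lattice_box n c" if "x \<in> lattice_box n (c + a)" for x
    using that by (intro image_eqI[of _ _ "x - a"]) (auto simp: lattice_box_def algebra_simps)
  then show ?thesis by (auto simp: lattice_box_def)
qed

lemma gap_lattice_box_center:
  fixes c i :: "int ^ 'd"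
  shows "gap J (\<lambda>_. \<epsilon>) (lattice_box n i) i = gap J (\<lambda>_. \<epsilon>) (lattice_box n c) c"
proof -
  have "i = c + (i - c)" by simp
  then show ?thesis
    using gexp_translate[OF finite_lattice_box, of J \<epsilon> "i - c" n c _ c] unfolding gap_def
    by (metis lattice_box_translate)
qed

definition unit_steps :: "(int ^ 'd) set" where
  "unit_steps = {u. (\<Sum>k\<in>UNIV. \<bar>u $ k\<bar>) = 1}"

lemma finite_unit_steps: "finite unit_steps"
proof (rule finite_subset[OF _ finite_lattice_box[of 1 0]])
  show "unit_steps \<subseteq> lattice_box 1 0"
  proof
    fix u :: "int ^ 'd" assume "u \<in> unit_steps"
    then have "{0, u} \<in> nn_edges" by (simp add: nn_edges_iff unit_steps_def)
    then show "u \<in> lattice_box 1 0" by (rule neighbour_in_box)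
  qed
qed

lemma unit_step_cases:
  assumes "u \<in> unit_steps"
  obtains k where "u $ k = 1 \<or> u $ k = -1" "\<And>l. l \<noteq> k \<Longrightarrow> u $ l = 0"
proof -
  have s: "(\<Sum>k\<in>UNIV. \<bar>u $ k\<bar>) = 1" using assms by (simp add: unit_steps_def)
  then obtain k where k: "u $ k \<noteq> 0" by (metis abs_zero sum.neutral zero_neq_one)
  have "(\<Sum>k\<in>UNIV. \<bar>u $ k\<bar>) = \<bar>u $ k\<bar> + (\<Sum>l\<in>UNIV - {k}. \<bar>u $ l\<bar>)"
    by (rule sum.remove) auto
  moreover have "0 \<le> (\<Sum>l\<in>UNIV - {k}. \<bar>u $ l\<bar>)" by (rule sum_nonneg) simp
  ultimately have "\<bar>u $ k\<bar> = 1" "(\<Sum>l\<in>UNIV - {k}. \<bar>u $ l\<bar>) = 0" using s k by linarith+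
  then show ?thesis
    by (intro that[of k]) (auto simp: sum_nonneg_eq_0_iff)
qed

text \<open>An edge that leaves the box, together with a position along its direction, is coded injectively by the
point of the box on the line of the edge at that position and by the step of the edge. Hence the
boundary is smaller than the box by a factor of the side length.\<close>

lemma card_crossing_lattice_box:
  fixes c :: "int ^ 'd"
  shows "card (crossing (lattice_box n c)) * (2 * n + 1) \<le>
    card (lattice_box n c) * card (unit_steps :: (int ^ 'd) set)"
proof -
  let ?B = "lattice_box n c"
  \<comment> \<open>moves the inner endpoint along its edge direction, the only coordinate in which \<open>i\<close> and \<open>j\<close> differ, to height \<open>m\<close> above the centre\<close>
  define F :: "((int ^ 'd) \<times> (int ^ 'd)) \<times> int \<Rightarrow> (int ^ 'd) \<times> (int ^ 'd)"
    where "F = (\<lambda>((i, j), m). (\<chi> l. if i $ l \<noteq> j $ l then c $ l + m else i $ l, j - i))"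
  have step: "\<exists>k. (j - i) $ k \<in> {1, -1} \<and> (\<forall>l. l \<noteq> k \<longrightarrow> i $ l = j $ l) \<and>
      i $ k = c $ k + int n * (j - i) $ k" if "(i, j) \<in> crossing ?B" for i j
  proof -
    from that have ij: "i \<in> ?B" "j \<notin> ?B" "j - i \<in> unit_steps"
      by (auto simp: crossing_eq nn_edges_iff unit_steps_def abs_minus_commute)
    obtain k where k: "(j - i) $ k = 1 \<or> (j - i) $ k = -1" "\<And>l. l \<noteq> k \<Longrightarrow> (j - i) $ l = 0"
      using unit_step_cases[OF ij(3)] by metis
    then have eq: "i $ l = j $ l" if "l \<noteq> k" for l using that by simp
    obtain l where l: "\<not> \<bar>j $ l - c $ l\<bar> \<le> int n" using ij(2) by (auto simp: lattice_box_def)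
    have "\<bar>i $ m - c $ m\<bar> \<le> int n" for m using ij(1) by (auto simp: lattice_box_def)
    from this[of l] this[of k] l eq have *: "l = k" "\<bar>i $ k - c $ k\<bar> \<le> int n" by metis+
    have "\<not> \<bar>j $ k - c $ k\<bar> \<le> int n" "j $ k = i $ k + (j - i) $ k" using l * by simp_all
    then have "i $ k = c $ k + int n * (j - i) $ k"
      using k(1) *(2) by (auto simp del: vector_minus_component)
    moreover have "(j - i) $ k \<in> {1, -1}" using k(1) by blast
    ultimately show ?thesis using eq by blast
  qed
  have "inj_on F (crossing ?B \<times> {- int n..int n})"
  proof (rule inj_onI)
    fix p p' assume pp: "p \<in> crossing ?B \<times> {- int n..int n}" "p' \<in> crossing ?B \<times> {- int n..int n}" "F p = F p'"
    obtain i j m where p: "p = ((i, j), m)" by (metis surj_pair)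
    obtain i' j' m' where p': "p' = ((i', j'), m')" by (metis surj_pair)
    have A: "(i, j) \<in> crossing ?B" "(i', j') \<in> crossing ?B" "F ((i, j), m) = F ((i', j'), m')"
      using pp unfolding p p' by blast+
    from A(3) have u: "j - i = j' - i'" by (simp add: F_def)
    have v: "(if i $ l \<noteq> j $ l then c $ l + m else i $ l) = (if i' $ l \<noteq> j' $ l then c $ l + m' else i' $ l)" for l
      using arg_cong[OF A(3), of "\<lambda>p. fst p $ l"] by (simp add: F_def)
    obtain k where k: "(j - i) $ k \<in> {1, -1}" "\<And>l. l \<noteq> k \<Longrightarrow> i $ l = j $ l"
      "i $ k = c $ k + int n * (j - i) $ k" using step[OF A(1)] by blast
    obtain k' where k': "(j' - i') $ k' \<in> {1, -1}" "\<And>l. l \<noteq> k' \<Longrightarrow> i' $ l = j' $ l"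
      "i' $ k' = c $ k' + int n * (j' - i') $ k'" using step[OF A(2)] by blast
    have ne: "i $ k \<noteq> j $ k" "i' $ k' \<noteq> j' $ k'" using k(1) k'(1) by auto
    have "k = k'"
    proof (rule ccontr)
      assume "k \<noteq> k'"
      then have "(j' - i') $ k = 0" using k'(2)[of k] by simp
      then show False using k(1) unfolding u by simp
    qed
    have "i $ l = i' $ l" for l
    proof (cases "l = k")
      case True
      then show ?thesis using k(3) k'(3) \<open>k = k'\<close> by (simp only: u)
    next
      case False
      then show ?thesis using v[of l] k(2)[of l] k'(2)[of l] \<open>k = k'\<close> by simp
    qed
    then have "i = i'" by (simp add: vec_eq_iff)
    moreover have "m = m'" using v[of k] ne \<open>k = k'\<close> by simp
    ultimately show "p = p'" using u unfolding p p' by (metis diff_add_cancel)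
  qed
  moreover have "F ` (crossing ?B \<times> {- int n..int n}) \<subseteq> ?B \<times> unit_steps"
  proof
    fix p assume "p \<in> F ` (crossing ?B \<times> {- int n..int n})"
    then obtain q m where "q \<in> crossing ?B" and m: "m \<in> {- int n..int n}" and p: "p = F (q, m)" by blast
    then obtain i j where A: "(i, j) \<in> crossing ?B" "p = F ((i, j), m)" by (cases q) simp
    have "\<bar>m\<bar> \<le> int n" using m by auto
    then show "p \<in> ?B \<times> unit_steps"
      using A
      by (simp add: F_def lattice_box_def crossing_eq nn_edges_iff unit_steps_def abs_minus_commute) metis
  qed
  ultimately have "card (crossing ?B \<times> {- int n..int n}) \<le> card (?B \<times> (unit_steps :: (int ^ 'd) set))"
    by (rule card_inj_on_le) (simp add: finite_lattice_box finite_unit_steps)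
  moreover have "nat (2 * int n + 1) = 2 * n + 1" by linarith
  ultimately show ?thesis by (simp add: card_cartesian_product)
qed

text \<open>In the box of radius \<open>n\<close> every gap is at least the central gap of the box of radius \<open>2 * n\<close>, since that
box, shifted to have its centre there, contains the smaller box. The boundary bound for the sum over the
small box then bounds the central gap of the large one.\<close>

lemma gap_constant_field:
  fixes c :: "int ^ 'd"
  assumes J: "0 \<le> J" and \<epsilon>: "0 < \<epsilon>"
  shows "gap J (\<lambda>_. \<epsilon>) (lattice_box (2 * n) c) c \<le>
    4 * J * real (card (unit_steps :: (int ^ 'd) set)) / (\<epsilon> * real (2 * n + 1))"
proof -
  let ?B = "lattice_box n c" and ?g = "gap J (\<lambda>_. \<epsilon>) (lattice_box (2 * n) c) c"
  have c: "c \<in> ?B" by (simp add: lattice_box_def)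
  have B: "0 < card ?B" using c finite_lattice_box card_gt_0_iff by blast
  have "?g \<le> gap J (\<lambda>_. \<epsilon>) ?B i" if i: "i \<in> ?B" for i
  proof -
    have "?B \<subseteq> lattice_box (2 * n) i"
    proof
      fix x assume x: "x \<in> ?B"
      have "\<bar>x $ k - i $ k\<bar> \<le> int (2 * n)" for k
      proof -
        have "\<bar>x $ k - c $ k\<bar> \<le> int n" "\<bar>i $ k - c $ k\<bar> \<le> int n"
          using x i by (auto simp: lattice_box_def)
        then show ?thesis by linarith
      qed
      then show "x \<in> lattice_box (2 * n) i" by (simp add: lattice_box_def)
    qed
    then have "gap J (\<lambda>_. \<epsilon>) (lattice_box (2 * n) i) i \<le> gap J (\<lambda>_. \<epsilon>) ?B i"
      by (rule gap_antimono_volume[OF finite_lattice_box _ J])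
    then show ?thesis by (simp add: gap_lattice_box_center[of J \<epsilon> _ i c])
  qed
  then have "(\<Sum>i\<in>?B. \<epsilon> * ?g) \<le> (\<Sum>i\<in>?B. \<epsilon> * gap J (\<lambda>_. \<epsilon>) ?B i)"
    using \<epsilon> by (intro sum_mono mult_left_mono) auto
  also have "\<dots> \<le> 4 * J * real (card (crossing ?B))"
    using \<epsilon> by (intro sum_field_gap_le_boundary finite_lattice_box J) auto
  finally have "real (card ?B) * (\<epsilon> * ?g) * real (2 * n + 1) \<le> 4 * J * real (card (crossing ?B)) * real (2 * n + 1)"
    by (intro mult_right_mono) auto
  also have "\<dots> = 4 * J * real (card (crossing ?B) * (2 * n + 1))" by (simp only: of_nat_mult mult.assoc)
  also have "\<dots> \<le> 4 * J * real (card ?B * card (unit_steps :: (int ^ 'd) set))"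
    using J card_crossing_lattice_box[of n c] by (intro mult_left_mono of_nat_mono) auto
  finally have "real (card ?B) * (\<epsilon> * real (2 * n + 1) * ?g) \<le> real (card ?B) * (4 * J * card (unit_steps :: (int ^ 'd) set))"
    by (simp add: mult_ac)
  then have "\<epsilon> * real (2 * n + 1) * ?g \<le> 4 * J * card (unit_steps :: (int ^ 'd) set)"
    using B by (simp only: mult_le_cancel_left_pos of_nat_0_less_iff)
  moreover have "0 < \<epsilon> * real (2 * n + 1)" using \<epsilon> by simp
  ultimately show ?thesis by (simp only: pos_le_divide_eq mult.commute)
qed

section \<open>Vanishing of the gap and convergence of local expectations\<close>

lemma gap_tendsto_zero:
  fixes c :: "int ^ 'd"
  assumes J: "0 \<le> J" and K: "0 < K" and \<alpha>: "\<alpha> < 1" and h0: "\<And>i. 0 \<le> h i"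
    and h: "\<And>n i. i \<in> lattice_box (2 * n) c \<Longrightarrow> K / real (n + 1) powr \<alpha> \<le> h i"
  shows "(\<lambda>n. gap J h (lattice_box (2 * n) c) c) \<longlonglongrightarrow> 0"
proof (rule tendsto_sandwich)
  let ?U = "4 * J * real (card (unit_steps :: (int ^ 'd) set))"
  have c: "c \<in> lattice_box m c" for m by (simp add: lattice_box_def)
  show "\<forall>\<^sub>F n in sequentially. 0 \<le> gap J h (lattice_box (2 * n) c) c"
    unfolding gap_def using gexp_le_plus[OF finite_lattice_box order_refl minus_config J increasing_spin]
    by (intro always_eventually allI) simp
  show "\<forall>\<^sub>F n in sequentially. gap J h (lattice_box (2 * n) c) c \<le> ?U / K * real (n + 1) powr (\<alpha> - 1)"
  proof (intro always_eventually allI)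
    fix n
    let ?\<epsilon> = "K / real (n + 1) powr \<alpha>"
    have \<epsilon>: "0 < ?\<epsilon>" using K by simp
    have "gap J h (lattice_box (2 * n) c) c \<le> gap J (\<lambda>_. ?\<epsilon>) (lattice_box (2 * n) c) c"
      by (rule gap_antimono_field[OF finite_lattice_box J c]) (use \<epsilon> h in auto)
    also have "\<dots> \<le> ?U / (?\<epsilon> * real (2 * n + 1))" by (rule gap_constant_field[OF J \<epsilon>])
    also have "\<dots> \<le> ?U / (?\<epsilon> * real (n + 1))"
      using J \<epsilon> by (intro divide_left_mono mult_left_mono mult_pos_pos) auto
    also have "\<dots> = ?U / K * real (n + 1) powr (\<alpha> - 1)"
      using K by (simp add: powr_diff field_simps)
    finally show "gap J h (lattice_box (2 * n) c) c \<le> ?U / K * real (n + 1) powr (\<alpha> - 1)" .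
  qed
  have "filterlim (\<lambda>n. real (n + 1)) at_top sequentially"
    by (rule filterlim_compose[OF filterlim_real_sequentially filterlim_add_const_nat_at_top])
  then have "(\<lambda>n. real (n + 1) powr (\<alpha> - 1)) \<longlonglongrightarrow> 0"
    using \<alpha> by (intro tendsto_neg_powr) auto
  from tendsto_mult_right_zero[OF this, of "?U / K"]
  show "(\<lambda>n. ?U / K * real (n + 1) powr (\<alpha> - 1)) \<longlonglongrightarrow> 0" .
qed simp

lemma norm_sum_le:
  assumes "is_norm N"
  shows "N (\<Sum>x\<in>I. f x) \<le> (\<Sum>x\<in>I. N (f x))"
  using assms
  by (induction I rule: infinite_finite_induct)
     (use assms in \<open>force simp: is_norm_def intro: order_trans[OF _ add_left_mono]\<close>)+

text \<open>The norm is at most a multiple of the maximum norm, so the field on a box is at least a multiple of the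
corresponding power of the radius.\<close>

lemma decaying_field_lower_bound:
  fixes N :: "real ^ 'd \<Rightarrow> real" and c :: "int ^ 'd"
  assumes N: "is_norm N" and hs: "0 < hs" and \<alpha>: "0 \<le> \<alpha>"
  obtains K where "0 < K"
    "\<And>n i. i \<in> lattice_box (2 * n) c \<Longrightarrow> K / real (n + 1) powr \<alpha> \<le> decaying_field N hs \<alpha> i"
proof
  let ?e = "\<lambda>k. axis k 1 :: real ^ 'd"
  define M where "M = 1 + (\<Sum>k\<in>UNIV. real_of_int (2 + \<bar>c $ k\<bar>) * N (?e k))"
  have N0: "0 \<le> N x" "N (a *\<^sub>R x) = \<bar>a\<bar> * N x" "N x = 0 \<longleftrightarrow> x = 0" for a x
    using N by (auto simp: is_norm_def)
  have "0 \<le> (\<Sum>k\<in>UNIV. real_of_int (2 + \<bar>c $ k\<bar>) * N (?e k))"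
    using N0 by (intro sum_nonneg mult_nonneg_nonneg) auto
  then have M: "1 \<le> M" by (simp add: M_def)
  show "0 < hs / M powr \<alpha>" using hs M by simp
  fix n and i :: "int ^ 'd" assume i: "i \<in> lattice_box (2 * n) c"
  have "real_vec i = (\<Sum>k\<in>UNIV. real_of_int (i $ k) *\<^sub>R ?e k)"
    by (simp add: vec_eq_iff real_vec_def axis_def if_distrib sum.delta cong: if_cong)
  then have "N (real_vec i) \<le> (\<Sum>k\<in>UNIV. N (real_of_int (i $ k) *\<^sub>R ?e k))"
    using norm_sum_le[OF N, of "\<lambda>k. real_of_int (i $ k) *\<^sub>R ?e k" UNIV] by simp
  also have "\<dots> = (\<Sum>k\<in>UNIV. \<bar>real_of_int (i $ k)\<bar> * N (?e k))" by (simp add: N0)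
  also have "\<dots> \<le> (\<Sum>k\<in>UNIV. real (n + 1) * (real_of_int (2 + \<bar>c $ k\<bar>) * N (?e k)))"
  proof (rule sum_mono)
    fix k
    have "\<bar>i $ k - c $ k\<bar> \<le> int (2 * n)" using i by (simp add: lattice_box_def)
    then have "\<bar>i $ k\<bar> \<le> 2 * int n + \<bar>c $ k\<bar>" by linarith
    also have "\<dots> \<le> (int n + 1) * (2 + \<bar>c $ k\<bar>)" by (simp add: algebra_simps)
    finally have "real_of_int \<bar>i $ k\<bar> \<le> real_of_int ((int n + 1) * (2 + \<bar>c $ k\<bar>))"
      by (simp only: of_int_le_iff)
    then have "\<bar>real_of_int (i $ k)\<bar> \<le> real (n + 1) * real_of_int (2 + \<bar>c $ k\<bar>)"
      by (simp add: add.commute)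
    from mult_right_mono[OF this N0(1)[of "?e k"]]
    show "\<bar>real_of_int (i $ k)\<bar> * N (?e k) \<le> real (n + 1) * (real_of_int (2 + \<bar>c $ k\<bar>) * N (?e k))"
      by (simp add: mult.assoc)
  qed
  also have "\<dots> \<le> real (n + 1) * M"
    unfolding sum_distrib_left[symmetric] M_def by (intro mult_left_mono) auto
  finally have le: "N (real_vec i) \<le> M * real (n + 1)" by (simp add: mult.commute)
  have split: "hs / M powr \<alpha> / real (n + 1) powr \<alpha> = hs / (M * real (n + 1)) powr \<alpha>"
    using M by (subst powr_mult) auto
  show "hs / M powr \<alpha> / real (n + 1) powr \<alpha> \<le> decaying_field N hs \<alpha> i"
  proof (cases "i = 0")
    case True
    have "1 * 1 \<le> M * real (n + 1)" using M by (intro mult_mono) auto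
    then have "1 \<le> (M * real (n + 1)) powr \<alpha>" using \<alpha> by (intro ge_one_powr_ge_zero) auto
    then show ?thesis unfolding split using True hs by (simp add: decaying_field_def divide_le_eq)
  next
    case False
    then have "real_vec i \<noteq> 0" by (auto simp: real_vec_def vec_eq_iff)
    then have pos: "0 < N (real_vec i)" using N0 by (simp add: less_le)
    then have "N (real_vec i) powr \<alpha> \<le> (M * real (n + 1)) powr \<alpha>"
      using le \<alpha> by (intro powr_mono2) auto
    then show ?thesis unfolding split using False hs pos
      by (simp add: decaying_field_def frac_le)
  qed
qed

text \<open>On configurations, the indicator of the event that the spins in \<open>A\<close> are \<open>1\<close> and those in \<open>B\<close> are \<open>-1\<close>;
the polynomial form makes it measurable and continuous at sight.\<close>

definition cylinder :: "(int ^ 'd) set \<Rightarrow> (int ^ 'd) set \<Rightarrow> 'd config \<Rightarrow> real" where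
  "cylinder A B \<sigma> = (\<Prod>i\<in>A. (1 + \<sigma> i) / 2) * (\<Prod>i\<in>B. (1 - \<sigma> i) / 2)"

definition sign_config :: "(int ^ 'd) set \<Rightarrow> 'd config" where
  "sign_config A = (\<lambda>i. if i \<in> A then 1 else -1)"

definition local_on :: "(int ^ 'd) set \<Rightarrow> ('d config \<Rightarrow> real) \<Rightarrow> bool" where
  "local_on D F \<longleftrightarrow> (\<forall>\<sigma>\<in>configs. \<forall>\<tau>\<in>configs. (\<forall>i\<in>D. \<sigma> i = \<tau> i) \<longrightarrow> F \<sigma> = F \<tau>)"

lemma sign_config_configs: "sign_config A \<in> configs"
  by (simp add: sign_config_def configs_def)

lemma cylinder_configs:
  assumes "\<sigma> \<in> configs" "finite A" "finite B"
  shows "cylinder A B \<sigma> = (if (\<forall>i\<in>A. \<sigma> i = 1) \<and> (\<forall>i\<in>B. \<sigma> i = -1) then 1 else 0)"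
proof -
  have pm: "(\<Prod>i\<in>C. (1 + s * \<sigma> i) / 2) = (if \<forall>i\<in>C. s * \<sigma> i = 1 then 1 else 0)"
    if "finite C" "s = 1 \<or> s = -1" for C s
  proof (cases "\<forall>i\<in>C. s * \<sigma> i = 1")
    case False
    then obtain i where "i \<in> C" "s * \<sigma> i \<noteq> 1" by blast
    then have "i \<in> C" "(1 + s * \<sigma> i) / 2 = 0"
      using that(2) configs_cases[OF assms(1), of i] by auto
    then show ?thesis using False that(1) by (auto simp: prod_zero_iff)
  qed (simp add: prod.neutral)
  have "(\<forall>i\<in>B. - \<sigma> i = 1) \<longleftrightarrow> (\<forall>i\<in>B. \<sigma> i = -1)" by (auto simp: minus_equation_iff)
  then show ?thesis
    unfolding cylinder_def using pm[OF assms(2), of 1] pm[OF assms(3), of "-1"] by simp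
qed

lemma local_expansion:
  assumes D: "finite D" and F: "local_on D F" and \<sigma>: "\<sigma> \<in> configs"
  shows "F \<sigma> = (\<Sum>S\<in>Pow D. F (sign_config S) * cylinder S (D - S) \<sigma>)"
proof -
  let ?S = "{i \<in> D. \<sigma> i = 1}"
  have "cylinder S (D - S) \<sigma> = (if S = ?S then 1 else 0)" if "S \<subseteq> D" for S
  proof -
    have "(\<forall>i\<in>S. \<sigma> i = 1) \<and> (\<forall>i\<in>D - S. \<sigma> i = -1) \<longleftrightarrow> S = ?S"
      using that configs_cases[OF \<sigma>] by (auto; force)
    then show ?thesis
      using finite_subset[OF that D] D by (simp only: cylinder_configs[OF \<sigma>] finite_Diff)
  qed
  then have "(\<Sum>S\<in>Pow D. F (sign_config S) * cylinder S (D - S) \<sigma>) =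
      (\<Sum>S\<in>Pow D. if S = ?S then F (sign_config S) else 0)"
    by (intro sum.cong refl) simp
  also have "\<dots> = F (sign_config ?S)" using D by (subst sum.delta) auto
  also have "\<dots> = F \<sigma>"
  proof -
    have "sign_config ?S i = \<sigma> i" if "i \<in> D" for i
      using configs_cases[OF \<sigma>, of i] that by (auto simp: sign_config_def)
    then show ?thesis using F \<sigma> sign_config_configs unfolding local_on_def by blast
  qed
  finally show ?thesis ..
qed

lemma gexp_cong:
  assumes "\<And>\<sigma>. \<sigma> \<in> configs \<Longrightarrow> f \<sigma> = g \<sigma>"
  shows "gexp J h V \<mu> f = gexp J h V \<mu> g"
proof -
  have "gsum J h V \<mu> f = gsum J h V \<mu> g"
    unfolding gsum_def using bc_configs_subset[of V \<mu>] assms by (intro sum.cong refl) auto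
  then show ?thesis by (simp add: gexp_def)
qed

lemma increasing_cylinder: "finite A \<Longrightarrow> increasing (cylinder A {})"
  unfolding increasing_def
proof (intro ballI impI)
  fix \<sigma> \<tau> :: "'a config" assume *: "finite A" "\<sigma> \<in> configs" "\<tau> \<in> configs" "\<forall>i. \<sigma> i \<le> \<tau> i"
  have "\<tau> i = 1" if "\<sigma> i = 1" for i
    using *(4)[rule_format, of i] that configs_cases[OF *(3), of i] by auto
  then show "cylinder A {} \<sigma> \<le> cylinder A {} \<tau>"
    using * by (auto simp: cylinder_configs)
qed

text \<open>If the indicator of all spins in \<open>A\<close> being \<open>1\<close> jumps from \<open>0\<close> to \<open>1\<close>, some spin of \<open>A\<close> has turned from \<open>-1\<close>
to \<open>1\<close>, which raises half the sum of the spins by at least \<open>1\<close>. This is what reduces events to single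
spins.\<close>

lemma increasing_count_minus_cylinder:
  assumes A: "finite A"
  shows "increasing (\<lambda>\<sigma>. (\<Sum>i\<in>A. \<sigma> i / 2) - cylinder A {} \<sigma>)"
  unfolding increasing_def
proof (intro ballI impI)
  fix \<sigma> \<tau> :: "'a config" assume *: "\<sigma> \<in> configs" "\<tau> \<in> configs" "\<forall>i. \<sigma> i \<le> \<tau> i"
  have nn: "0 \<le> (\<tau> i - \<sigma> i) / 2" for i using *(3) by simp
  have "cylinder A {} \<tau> - cylinder A {} \<sigma> \<le> (\<Sum>i\<in>A. (\<tau> i - \<sigma> i) / 2)"
  proof (cases "(\<forall>i\<in>A. \<tau> i = 1) \<and> \<not> (\<forall>i\<in>A. \<sigma> i = 1)")
    case True
    then obtain k where k: "k \<in> A" "\<sigma> k = -1" "\<tau> k = 1" using configs_cases[OF *(1)] by blast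
    have "(\<tau> k - \<sigma> k) / 2 \<le> (\<Sum>i\<in>A. (\<tau> i - \<sigma> i) / 2)"
      using k A nn by (intro member_le_sum) auto
    then show ?thesis using True k * A by (simp add: cylinder_configs)
  next
    case False
    then have "cylinder A {} \<tau> - cylinder A {} \<sigma> \<le> 0" using * A by (auto simp: cylinder_configs)
    also have "0 \<le> (\<Sum>i\<in>A. (\<tau> i - \<sigma> i) / 2)" using nn by (intro sum_nonneg) auto
    finally show ?thesis .
  qed
  then show "(\<Sum>i\<in>A. \<sigma> i / 2) - cylinder A {} \<sigma> \<le> (\<Sum>i\<in>A. \<tau> i / 2) - cylinder A {} \<tau>"
    by (simp add: sum_subtractf diff_divide_distrib)
qed

lemma cylinder_gap_le:
  assumes "finite V" "0 \<le> J" "finite A"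
  shows "gexp J h V (\<lambda>_. 1) (cylinder A {}) - gexp J h V (\<lambda>_. -1) (cylinder A {})
    \<le> (\<Sum>i\<in>A. gap J h V i / 2)"
proof -
  have half: "gexp J h V \<mu> (\<lambda>\<sigma>. \<sigma> i / 2) = gexp J h V \<mu> (\<lambda>\<sigma>. \<sigma> i) / 2" for \<mu> i
    using gexp_mult[of J h V \<mu> "1/2" "\<lambda>\<sigma>. \<sigma> i"] by simp
  show ?thesis
    using gexp_le_plus[OF assms(1) order_refl minus_config assms(2)
        increasing_count_minus_cylinder[OF assms(3)], of h]
    by (simp add: gexp_diff gexp_sum half gap_def sum_subtractf diff_divide_distrib)
qed

text \<open>Convergence along this filter is convergence as the volume exhausts the lattice, uniformly in the
boundary condition.\<close>

definition volumes :: "((int ^ 'd) set \<times> 'd config) filter" where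
  "volumes = finite_subsets_at_top UNIV \<times>\<^sub>F principal configs"

lemma eventually_volumes:
  assumes "finite W" "\<And>V \<mu>. finite V \<Longrightarrow> W \<subseteq> V \<Longrightarrow> \<mu> \<in> configs \<Longrightarrow> P (V, \<mu>)"
  shows "eventually P volumes"
  unfolding volumes_def eventually_prod_filter
  using assms
  by (intro exI[of _ "\<lambda>V. finite V \<and> W \<subseteq> V"] exI[of _ "\<lambda>\<mu>. \<mu> \<in> configs"])
     (auto simp: eventually_principal eventually_finite_subsets_at_top intro!: exI[of _ W])

lemma volumes_neq_bot: "volumes \<noteq> bot"
  unfolding volumes_def using plus_config by (auto simp: prod_filter_eq_bot principal_eq_bot_iff)

lemma filterlim_volumes:
  assumes "\<And>n. finite (V n)" "incseq V" "(\<Union>n. V n) = UNIV" "\<And>n. \<mu> n \<in> configs"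
  shows "filterlim (\<lambda>n. (V n, \<mu> n)) volumes sequentially"
  unfolding volumes_def
proof (rule filterlim_Pair)
  show "filterlim V (finite_subsets_at_top UNIV) sequentially"
    unfolding filterlim_finite_subsets_at_top
  proof (intro allI impI)
    fix X assume "finite X \<and> X \<subseteq> (UNIV :: (int ^ 'a) set)"
    then have X: "finite X" by simp
    have "\<exists>N. X \<subseteq> V N"
      using X
    proof (induction X)
      case (insert x X)
      then obtain N where "X \<subseteq> V N" by blast
      moreover obtain N' where "x \<in> V N'" using assms(3) by blast
      moreover have "V N \<subseteq> V (max N N')" "V N' \<subseteq> V (max N N')"
        by (simp_all add: incseqD[OF assms(2)])
      ultimately show ?case by (intro exI[of _ "max N N'"]) blast
    qed simp
    then obtain N where N: "X \<subseteq> V N" ..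
    show "\<forall>\<^sub>F n in sequentially. finite (V n) \<and> X \<subseteq> V n \<and> V n \<subseteq> UNIV"
      using N assms(1) incseqD[OF assms(2)] unfolding eventually_sequentially
      by (intro exI[of _ N]) blast
  qed
  show "filterlim \<mu> (principal configs) sequentially"
    using assms(4) by (simp add: filterlim_principal)
qed

text \<open>The plus expectations decrease in the volume, the minus expectations increase, all others lie in
between, and small gaps close the interval.\<close>

lemma cylinder_converges:
  fixes A :: "(int ^ 'd) set"
  assumes J: "0 \<le> J" and A: "finite A"
    and small: "\<And>i e. 0 < e \<Longrightarrow> \<exists>V. finite V \<and> gap J h V i < e"
  shows "\<exists>p. ((\<lambda>(V, \<mu>). gexp J h V \<mu> (cylinder A {})) \<longlongrightarrow> p) volumes"
proof -
  let ?f = "cylinder A {}"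
  define u where "u V = gexp J h V (\<lambda>_. 1) ?f" for V
  define l where "l V = gexp J h V (\<lambda>_. -1) ?f" for V
  define p where "p = Inf (u ` {V. finite V})"
  have inc: "increasing ?f" by (rule increasing_cylinder[OF A])
  have between: "l V' \<le> gexp J h V \<mu> ?f \<and> gexp J h V \<mu> ?f \<le> u V'"
    if "finite V" "V' \<subseteq> V" "\<mu> \<in> configs" for V V' \<mu>
    using gexp_le_plus[OF that J inc] gexp_ge_minus[OF that J inc] by (simp add: u_def l_def)
  have lu: "l V \<le> u V'" if "finite V" "finite V'" for V V'
  proof -
    have "finite (V \<union> V')" using that by simp
    from order_trans[OF conjunct1[OF between[OF this Un_upper1 plus_config]]
        conjunct2[OF between[OF this Un_upper2 plus_config]]]
    show ?thesis .
  qed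
  have p_le: "p \<le> u V" if "finite V" for V
    unfolding p_def by (rule cInf_lower) (use that lu in \<open>auto intro: bdd_belowI2[of _ "l {}"]\<close>)
  have p_ge: "l V \<le> p" if "finite V" for V
    unfolding p_def by (rule cInf_greatest) (use that lu in auto)
  have "((\<lambda>(V, \<mu>). gexp J h V \<mu> ?f) \<longlongrightarrow> p) volumes"
  proof (rule tendstoI)
    fix e :: real assume e: "0 < e"
    \<comment> \<open>the summand \<open>1\<close> keeps the denominator positive when \<open>A\<close> is empty\<close>
    define \<delta> where "\<delta> = e / real (card A + 1)"
    have \<delta>: "0 < \<delta>" using e by (simp add: \<delta>_def)
    from small[OF this] obtain W where W: "\<And>i. finite (W i)" "\<And>i. gap J h (W i) i < \<delta>" by metis
    define V0 where "V0 = (\<Union>i\<in>A. W i)"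
    have V0: "finite V0" using A W(1) by (simp add: V0_def)
    have "gap J h V0 i \<le> \<delta>" if "i \<in> A" for i
      using gap_antimono_volume[OF V0, of "W i" J h i] that W(2)[of i] J by (force simp: V0_def)
    then have "(\<Sum>i\<in>A. gap J h V0 i / 2) \<le> (\<Sum>i\<in>A. \<delta> / 2)" by (intro sum_mono) auto
    also have "\<dots> < e" 
    proof -
      have "0 < e * real (card A) + e * 2" using e by (intro add_nonneg_pos) auto
      then show ?thesis by (simp add: \<delta>_def field_simps)
    qed
    finally have ul: "u V0 - l V0 < e"
      using cylinder_gap_le[OF V0 J A, of h] by (simp add: u_def l_def)
    show "\<forall>\<^sub>F x in volumes. dist (case x of (V, \<mu>) \<Rightarrow> gexp J h V \<mu> ?f) p < e"
    proof (rule eventually_volumes[OF V0])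
      fix V and \<mu> :: "'d config" assume "finite V" "V0 \<subseteq> V" "\<mu> \<in> configs"
      from between[OF this] p_le[OF V0] p_ge[OF V0] ul
      show "dist (case (V, \<mu>) of (V, \<mu>) \<Rightarrow> gexp J h V \<mu> ?f) p < e"
        by (auto simp: dist_real_def)
    qed
  qed
  then show ?thesis ..
qed

text \<open>Inclusion and exclusion: a condition \<open>\<sigma> x = -1\<close> is the absence of the condition \<open>\<sigma> x = 1\<close>.\<close>

lemma cylinder_signs_converge:
  assumes "finite B" "finite A"
    and conv: "\<And>A. finite A \<Longrightarrow> \<exists>p. ((\<lambda>(V, \<mu>). gexp J h V \<mu> (cylinder A {})) \<longlongrightarrow> p) volumes"
  shows "\<exists>p. ((\<lambda>(V, \<mu>). gexp J h V \<mu> (cylinder A B)) \<longlongrightarrow> p) volumes"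
  using assms(1,2)
proof (induction B arbitrary: A)
  case empty
  then show ?case by (rule conv)
next
  case (insert x B)
  obtain p q where pq: "((\<lambda>(V, \<mu>). gexp J h V \<mu> (cylinder A B)) \<longlongrightarrow> p) volumes"
    "((\<lambda>(V, \<mu>). gexp J h V \<mu> (cylinder (insert x A) B)) \<longlongrightarrow> q) volumes"
    using insert.IH[OF insert.prems] insert.IH[of "insert x A"] insert.prems by blast
  have "gexp J h V \<mu> (cylinder A (insert x B)) =
      gexp J h V \<mu> (cylinder A B) - gexp J h V \<mu> (cylinder (insert x A) B)" for V \<mu>
    unfolding gexp_diff[symmetric]
  proof (rule gexp_cong)
    fix \<sigma> :: "'a config" assume "\<sigma> \<in> configs"
    then show "cylinder A (insert x B) \<sigma> = cylinder A B \<sigma> - cylinder (insert x A) B \<sigma>"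
      using insert.hyps insert.prems configs_cases[of \<sigma> x] by (auto simp: cylinder_configs)
  qed
  then show ?case using tendsto_diff[OF pq] by (auto simp: case_prod_beta')
qed

definition local_limit :: "real \<Rightarrow> (int ^ 'd \<Rightarrow> real) \<Rightarrow> ('d config \<Rightarrow> real) \<Rightarrow> real" where
  "local_limit J h F = Lim volumes (\<lambda>(V, \<mu>). gexp J h V \<mu> F)"

lemma tendsto_local_limit:
  assumes D: "finite D" and F: "local_on D F"
    and conv: "\<And>A. finite A \<Longrightarrow> \<exists>p. ((\<lambda>(V, \<mu>). gexp J h V \<mu> (cylinder A {})) \<longlongrightarrow> p) volumes"
  shows "((\<lambda>(V, \<mu>). gexp J h V \<mu> F) \<longlongrightarrow> local_limit J h F) volumes"
proof -
  have "\<forall>S\<in>Pow D. \<exists>p. ((\<lambda>(V, \<mu>). gexp J h V \<mu> (cylinder S (D - S))) \<longlongrightarrow> p) volumes"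
  proof
    fix S assume "S \<in> Pow D"
    then have "finite S" "finite (D - S)" using D by (auto intro: finite_subset)
    then show "\<exists>p. ((\<lambda>(V, \<mu>). gexp J h V \<mu> (cylinder S (D - S))) \<longlongrightarrow> p) volumes"
      by (intro cylinder_signs_converge[OF _ _ conv])
  qed
  from bchoice[OF this] obtain p where p: "\<And>S. S \<in> Pow D \<Longrightarrow>
      ((\<lambda>(V, \<mu>). gexp J h V \<mu> (cylinder S (D - S))) \<longlongrightarrow> p S) volumes" by blast
  have "gexp J h V \<mu> F = (\<Sum>S\<in>Pow D. F (sign_config S) * gexp J h V \<mu> (cylinder S (D - S)))" for V \<mu>
    by (subst gexp_cong[OF local_expansion[OF D F]]) (simp_all add: gexp_sum gexp_mult)
  moreover have "((\<lambda>x. \<Sum>S\<in>Pow D. F (sign_config S) * (case x of (V, \<mu>) \<Rightarrow> gexp J h V \<mu> (cylinder S (D - S))))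
      \<longlongrightarrow> (\<Sum>S\<in>Pow D. F (sign_config S) * p S)) volumes"
    by (intro tendsto_sum tendsto_mult_left p)
  ultimately have *: "((\<lambda>(V, \<mu>). gexp J h V \<mu> F) \<longlongrightarrow> (\<Sum>S\<in>Pow D. F (sign_config S) * p S)) volumes"
    by (simp add: case_prod_beta')
  show ?thesis unfolding local_limit_def tendsto_Lim[OF volumes_neq_bot *] by (rule *)
qed

section \<open>Local functions and the weak topology\<close>

lemma space_config_space: "space config_space = configs"
  by (auto simp: config_space_def space_PiM configs_def PiE_def Pi_def)

lemma topspace_config_top: "topspace config_top = configs"
  by (auto simp: config_top_def configs_def PiE_def Pi_def)

lemma spin_measurable: "(\<lambda>\<sigma>. \<sigma> i) \<in> borel_measurable config_space"
proof -
  have "(\<lambda>\<sigma>. \<sigma> i) \<in> measurable config_space (count_space {-1, 1})"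
    unfolding config_space_def by (rule measurable_component_singleton) simp
  moreover have "(\<lambda>x. x) \<in> measurable (count_space {-1, 1}) (borel :: real measure)" by simp
  ultimately show ?thesis by (rule measurable_compose)
qed

lemma spin_continuous: "continuous_map config_top euclideanreal (\<lambda>\<sigma>. \<sigma> i)"
proof -
  have "continuous_map config_top (discrete_topology {-1, 1}) (\<lambda>\<sigma>. \<sigma> i)"
    unfolding config_top_def by (rule continuous_map_product_projection) simp
  moreover have "continuous_map (discrete_topology {-1, 1 :: real}) euclideanreal (\<lambda>x. x)" by simp
  ultimately have "continuous_map config_top euclideanreal ((\<lambda>x. x) \<circ> (\<lambda>\<sigma>. \<sigma> i))"
    by (rule continuous_map_compose)
  then show ?thesis by (simp add: o_def)
qed

lemma local_measurable:
  assumes "finite D" "local_on D F"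
  shows "F \<in> borel_measurable config_space"
proof -
  have "(\<lambda>\<sigma>. \<Sum>S\<in>Pow D. F (sign_config S) * cylinder S (D - S) \<sigma>) \<in> borel_measurable config_space"
    unfolding cylinder_def
    by (intro borel_measurable_sum borel_measurable_times borel_measurable_prod borel_measurable_const
        borel_measurable_divide borel_measurable_add borel_measurable_diff spin_measurable)
  moreover have "F \<sigma> = (\<Sum>S\<in>Pow D. F (sign_config S) * cylinder S (D - S) \<sigma>)"
    if "\<sigma> \<in> space config_space" for \<sigma>
    using that by (intro local_expansion[OF assms]) (simp add: space_config_space)
  ultimately show ?thesis
    using measurable_cong[of config_space F "\<lambda>\<sigma>. \<Sum>S\<in>Pow D. F (sign_config S) * cylinder S (D - S) \<sigma>" borel]
    by simp
qed

lemma local_continuous: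
  assumes "finite D" "local_on D F"
  shows "continuous_map config_top euclideanreal F"
proof -
  have half: "continuous_map config_top euclideanreal (\<lambda>\<sigma>. (1 + s * \<sigma> i) / 2)" for s i
  proof -
    have "continuous_map config_top euclideanreal (\<lambda>\<sigma>. 1 / 2 + s / 2 * \<sigma> i)"
      by (rule continuous_map_add[OF _ continuous_map_real_mult_left[OF spin_continuous]]) simp
    then show ?thesis by (simp add: add_divide_distrib)
  qed
  have "continuous_map config_top euclideanreal (cylinder S (D - S))" if "S \<in> Pow D" for S
  proof -
    have "finite S" "finite (D - S)" using that assms(1) finite_subset[of S D] by auto
    then show ?thesis
      unfolding cylinder_def[abs_def] using half[of 1] half[of "-1"]
      by (intro continuous_map_real_mult continuous_map_prod) simp_all
  qed
  then have "continuous_map config_top euclideanreal (\<lambda>\<sigma>. \<Sum>S\<in>Pow D. F (sign_config S) * cylinder S (D - S) \<sigma>)"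
    using assms(1) by (intro continuous_map_sum continuous_map_real_mult_left) simp_all
  then show ?thesis
    by (rule continuous_map_eq)
       (rule local_expansion[OF assms, symmetric], simp add: topspace_config_top)
qed

lemma local_bounded:
  assumes "finite D" "local_on D F"
  obtains B where "\<And>\<sigma>. \<sigma> \<in> configs \<Longrightarrow> \<bar>F \<sigma>\<bar> \<le> B"
proof
  fix \<sigma> :: "'a config" assume \<sigma>: "\<sigma> \<in> configs"
  have "\<bar>F \<sigma>\<bar> \<le> (\<Sum>S\<in>Pow D. \<bar>F (sign_config S) * cylinder S (D - S) \<sigma>\<bar>)"
    unfolding local_expansion[OF assms \<sigma>] by (rule sum_abs)
  also have "\<dots> \<le> (\<Sum>S\<in>Pow D. \<bar>F (sign_config S)\<bar>)"
  proof (rule sum_mono)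
    fix S assume "S \<in> Pow D"
    then have "finite S" "finite (D - S)" using assms(1) by (auto intro: finite_subset)
    then show "\<bar>F (sign_config S) * cylinder S (D - S) \<sigma>\<bar> \<le> \<bar>F (sign_config S)\<bar>"
      using \<sigma> by (simp add: cylinder_configs abs_mult)
  qed
  finally show "\<bar>F \<sigma>\<bar> \<le> (\<Sum>S\<in>Pow D. \<bar>F (sign_config S)\<bar>)" .
qed

lemma prob_algebra_configD:
  assumes "M \<in> space (prob_algebra config_space)"
  shows "sets M = sets config_space" "prob_space M" "space M = configs"
  using assms sets_eq_imp_space_eq[of M config_space] by (auto simp: space_prob_algebra space_config_space)

lemma integrable_bounded_config:
  fixes f :: "'d config \<Rightarrow> real"
  assumes M: "M \<in> space (prob_algebra config_space)" and f: "f \<in> borel_measurable config_space"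
    and B: "\<And>\<sigma>. \<sigma> \<in> configs \<Longrightarrow> \<bar>f \<sigma>\<bar> \<le> B"
  shows "integrable M f"
proof -
  interpret prob_space M by (rule prob_algebra_configD(2)[OF M])
  show ?thesis
  proof (rule integrable_const_bound[of _ B])
    show "AE \<sigma> in M. norm (f \<sigma>) \<le> B" using B prob_algebra_configD(3)[OF M] by (intro AE_I2) simp
    show "f \<in> borel_measurable M"
      using f unfolding measurable_cong_sets[OF prob_algebra_configD(1)[OF M] refl] .
  qed
qed

lemma integral_config_close:
  fixes f g :: "'d config \<Rightarrow> real"
  assumes M: "M \<in> space (prob_algebra config_space)"
    and f: "f \<in> borel_measurable config_space" "\<And>\<sigma>. \<sigma> \<in> configs \<Longrightarrow> \<bar>f \<sigma>\<bar> \<le> B"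
    and g: "g \<in> borel_measurable config_space" "\<And>\<sigma>. \<sigma> \<in> configs \<Longrightarrow> \<bar>g \<sigma>\<bar> \<le> C"
    and e: "\<And>\<sigma>. \<sigma> \<in> configs \<Longrightarrow> \<bar>f \<sigma> - g \<sigma>\<bar> \<le> e"
  shows "\<bar>(\<integral>\<sigma>. f \<sigma> \<partial>M) - (\<integral>\<sigma>. g \<sigma> \<partial>M)\<bar> \<le> e"
proof -
  interpret prob_space M by (rule prob_algebra_configD(2)[OF M])
  have int: "integrable M f" "integrable M g"
    by (rule integrable_bounded_config[OF M f], assumption, rule integrable_bounded_config[OF M g], assumption)
  have "\<bar>\<integral>\<sigma>. f \<sigma> - g \<sigma> \<partial>M\<bar> \<le> (\<integral>\<sigma>. \<bar>f \<sigma> - g \<sigma>\<bar> \<partial>M)"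
    using integral_norm_bound[of M "\<lambda>\<sigma>. f \<sigma> - g \<sigma>"] by simp
  also have "\<dots> \<le> (\<integral>\<sigma>. e \<partial>M)"
    using int e prob_algebra_configD(3)[OF M] by (intro integral_mono) auto
  finally show ?thesis using int by (simp add: prob_space)
qed

text \<open>Indicators of cylinder sets are local functions, and cylinder sets generate the \<open>\<sigma>\<close>-algebra.\<close>

lemma prob_measure_eqI:
  assumes M: "M \<in> space (prob_algebra config_space)" and M': "M' \<in> space (prob_algebra config_space)"
    and eq: "\<And>D F. finite D \<Longrightarrow> local_on D F \<Longrightarrow> (\<integral>\<sigma>. F \<sigma> \<partial>M) = (\<integral>\<sigma>. F \<sigma> \<partial>M')"
  shows "M = M'"
proof (rule measure_eqI_PiM_infinite)
  let ?N = "\<lambda>_ :: int ^ 'a. count_space {-1, 1 :: real}"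
  note P = prob_algebra_configD[OF M] and P' = prob_algebra_configD[OF M']
  interpret M: prob_space M by (rule P(2))
  interpret M': prob_space M' by (rule P'(2))
  show "sets M = sets (PiM UNIV ?N)" "sets M' = sets (PiM UNIV ?N)"
    using P P' by (simp_all add: config_space_def)
  show "finite_measure M" by unfold_locales
  fix A and D :: "(int ^ 'a) set"
  assume D: "finite D" "D \<subseteq> UNIV" and A: "\<And>i. i \<in> D \<Longrightarrow> A i \<in> sets (?N i)"
  let ?C = "prod_emb UNIV ?N D (PiE D A)"
  have C: "?C \<in> sets config_space"
    unfolding config_space_def using D A by (intro sets_PiM_I) auto
  have "local_on D (indicator ?C)"
    unfolding local_on_def
  proof (intro ballI impI)
    fix \<sigma> \<tau> :: "'a config" assume *: "\<sigma> \<in> configs" "\<tau> \<in> configs" "\<forall>i\<in>D. \<sigma> i = \<tau> i"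
    have "restrict \<sigma> D = restrict \<tau> D" using *(3) by (auto simp: restrict_def)
    moreover have "\<sigma> \<in> (\<Pi>\<^sub>E i\<in>UNIV. space (?N i))" "\<tau> \<in> (\<Pi>\<^sub>E i\<in>UNIV. space (?N i))"
      using *(1,2) by (auto simp: configs_def)
    ultimately show "(indicator ?C \<sigma> :: real) = indicator ?C \<tau>"
      by (simp add: prod_emb_def indicator_def)
  qed
  from eq[OF D(1) this] show "emeasure M ?C = emeasure M' ?C"
    using C P(1) P'(1) by (simp add: M.emeasure_eq_measure M'.emeasure_eq_measure)
qed

text \<open>Compactness of the configuration space: finitely many cylinder sets on which \<open>f\<close> is nearly constant
cover it, and \<open>D\<close> collects the coordinates that they involve.\<close>

lemma continuous_uniformly_local:
  fixes f :: "'d::finite config \<Rightarrow> real"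
  assumes f: "continuous_map config_top euclideanreal f" and e: "0 < e"
  obtains D where "finite D"
    "\<And>\<sigma> \<tau>. \<sigma> \<in> configs \<Longrightarrow> \<tau> \<in> configs \<Longrightarrow> (\<And>i. i \<in> D \<Longrightarrow> \<sigma> i = \<tau> i) \<Longrightarrow> \<bar>f \<sigma> - f \<tau>\<bar> < e"
proof -
  let ?X = "\<lambda>_ :: int ^ 'd. discrete_topology {-1, 1 :: real}"
  have "\<exists>W. finite {i. W i \<noteq> topspace (?X i)} \<and> (\<forall>i. openin (?X i) (W i)) \<and> \<rho> \<in> PiE UNIV W \<and>
      (\<forall>\<sigma>\<in>PiE UNIV W. \<bar>f \<sigma> - f \<rho>\<bar> < e / 2)" if \<rho>: "\<rho> \<in> configs" for \<rho>
  proof -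
    let ?O = "{\<sigma> \<in> topspace config_top. f \<sigma> \<in> ball (f \<rho>) (e / 2)}"
    have "openin config_top ?O" by (rule openin_continuous_map_preimage[OF f]) simp
    moreover have "\<rho> \<in> ?O" using \<rho> e by (simp add: topspace_config_top)
    ultimately have "\<exists>W. finite {i \<in> UNIV. W i \<noteq> topspace (?X i)} \<and> (\<forall>i\<in>UNIV. openin (?X i) (W i)) \<and>
        \<rho> \<in> PiE UNIV W \<and> PiE UNIV W \<subseteq> ?O"
      unfolding config_top_def openin_product_topology_alt by (rule bspec)
    then obtain W where W: "finite {i \<in> UNIV. W i \<noteq> topspace (?X i)} \<and> (\<forall>i\<in>UNIV. openin (?X i) (W i)) \<and>
        \<rho> \<in> PiE UNIV W \<and> PiE UNIV W \<subseteq> ?O" ..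
    have "\<bar>f \<sigma> - f \<rho>\<bar> < e / 2" if "\<sigma> \<in> PiE UNIV W" for \<sigma>
    proof -
      have "\<sigma> \<in> ?O" using W that by blast
      then show ?thesis by (simp add: dist_real_def abs_minus_commute)
    qed
    with W show ?thesis by (intro exI[of _ W]) simp
  qed
  then have "\<forall>\<rho>\<in>configs. \<exists>W. finite {i. W i \<noteq> topspace (?X i)} \<and> (\<forall>i. openin (?X i) (W i)) \<and> \<rho> \<in> PiE UNIV W \<and>
      (\<forall>\<sigma>\<in>PiE UNIV W. \<bar>f \<sigma> - f \<rho>\<bar> < e / 2)" by blast
  from bchoice[OF this] obtain W where W: "\<forall>\<rho>\<in>configs. finite {i. W \<rho> i \<noteq> topspace (?X i)} \<and>
      (\<forall>i. openin (?X i) (W \<rho> i)) \<and> \<rho> \<in> PiE UNIV (W \<rho>) \<and> (\<forall>\<sigma>\<in>PiE UNIV (W \<rho>). \<bar>f \<sigma> - f \<rho>\<bar> < e / 2)" ..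
  have "compact_space config_top"
    unfolding config_top_def by (simp add: compact_space_product_topology compact_space_discrete_topology)
  moreover have "openin config_top (PiE UNIV (W \<rho>))" if "\<rho> \<in> configs" for \<rho>
    unfolding config_top_def using W that by (simp add: openin_PiE_gen)
  moreover have "topspace config_top \<subseteq> \<Union>((\<lambda>\<rho>. PiE UNIV (W \<rho>)) ` configs)"
    using W by (auto simp: topspace_config_top)
  ultimately obtain \<C> where \<C>: "finite \<C>" "\<C> \<subseteq> (\<lambda>\<rho>. PiE UNIV (W \<rho>)) ` configs" "topspace config_top \<subseteq> \<Union>\<C>"
    unfolding compact_space_alt by (metis (no_types, lifting) imageE)
  then obtain T where T: "finite T" "T \<subseteq> configs" "\<C> = (\<lambda>\<rho>. PiE UNIV (W \<rho>)) ` T"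
    by (meson finite_subset_image)
  define D where "D = (\<Union>\<rho>\<in>T. {i. W \<rho> i \<noteq> topspace (?X i)})"
  show ?thesis
  proof (rule that[of D])
    show "finite D" using T W by (auto simp: D_def)
    fix \<sigma> \<tau> :: "'d config" assume *: "\<sigma> \<in> configs" "\<tau> \<in> configs" "\<And>i. i \<in> D \<Longrightarrow> \<sigma> i = \<tau> i"
    obtain \<rho> where \<rho>: "\<rho> \<in> T" "\<sigma> \<in> PiE UNIV (W \<rho>)"
      using * \<C>(3) T(3) by (auto simp: topspace_config_top)
    have "\<tau> i \<in> W \<rho> i" for i
    proof (cases "i \<in> D")
      case True
      then show ?thesis using *(3)[OF True] PiE_mem[OF \<rho>(2), of i] by simp
    next
      case False
      then have "W \<rho> i = topspace (?X i)" using \<rho>(1) by (auto simp: D_def)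
      then show ?thesis using configs_cases[OF *(2), of i] by auto
    qed
    then have "\<tau> \<in> PiE UNIV (W \<rho>)" by auto
    then have "\<bar>f \<sigma> - f \<rho>\<bar> < e / 2" "\<bar>f \<tau> - f \<rho>\<bar> < e / 2" using W T(2) \<rho> by blast+
    then show "\<bar>f \<sigma> - f \<tau>\<bar> < e" by linarith
  qed
qed

lemma continuous_local_approximation:
  fixes f :: "'d::finite config \<Rightarrow> real"
  assumes f: "continuous_map config_top euclideanreal f" and e: "0 < e"
  obtains D F where "finite D" "local_on D F" "\<And>\<sigma>. \<sigma> \<in> configs \<Longrightarrow> \<bar>f \<sigma> - F \<sigma>\<bar> < e"
proof -
  obtain D where D: "finite D"
    "\<And>\<sigma> \<tau>. \<sigma> \<in> configs \<Longrightarrow> \<tau> \<in> configs \<Longrightarrow> (\<And>i. i \<in> D \<Longrightarrow> \<sigma> i = \<tau> i) \<Longrightarrow> \<bar>f \<sigma> - f \<tau>\<bar> < e"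
    using continuous_uniformly_local[OF f e] by blast
  show ?thesis
  proof (rule that[of D "\<lambda>\<sigma>. f (extend D (\<lambda>_. 1) \<sigma>)"])
    show "local_on D (\<lambda>\<sigma>. f (extend D (\<lambda>_. 1) \<sigma>))"
      unfolding local_on_def
    proof (intro ballI impI)
      fix \<sigma> \<tau> :: "'d config" assume "\<forall>i\<in>D. \<sigma> i = \<tau> i"
      then have "extend D (\<lambda>_. 1) \<sigma> = extend D (\<lambda>_. 1) \<tau>" by (auto simp: extend_def)
      then show "f (extend D (\<lambda>_. 1) \<sigma>) = f (extend D (\<lambda>_. 1) \<tau>)" by simp
    qed
    show "\<bar>f \<sigma> - f (extend D (\<lambda>_. 1) \<sigma>)\<bar> < e" if "\<sigma> \<in> configs" for \<sigma>
      using that by (intro D(2)) (auto simp: extend_def configs_def)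
  qed (rule D(1))
qed

lemma continuous_measurable:
  fixes f :: "'d::finite config \<Rightarrow> real"
  assumes "continuous_map config_top euclideanreal f"
  shows "f \<in> borel_measurable config_space"
proof -
  have "\<forall>n. \<exists>F. F \<in> borel_measurable config_space \<and> (\<forall>\<sigma>\<in>configs. \<bar>f \<sigma> - F \<sigma>\<bar> < 1 / real (Suc n))"
  proof
    fix n
    obtain D F where "finite D" "local_on D F" "\<And>\<sigma>. \<sigma> \<in> configs \<Longrightarrow> \<bar>f \<sigma> - F \<sigma>\<bar> < 1 / real (Suc n)"
      by (rule continuous_local_approximation[OF assms, of "1 / real (Suc n)"]) auto
    then show "\<exists>F. F \<in> borel_measurable config_space \<and> (\<forall>\<sigma>\<in>configs. \<bar>f \<sigma> - F \<sigma>\<bar> < 1 / real (Suc n))"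
      using local_measurable[of D F] by (intro exI[of _ F]) simp
  qed
  from choice[OF this] obtain F where F0: "\<forall>n. F n \<in> borel_measurable config_space \<and>
      (\<forall>\<sigma>\<in>configs. \<bar>f \<sigma> - F n \<sigma>\<bar> < 1 / real (Suc n))" ..
  then have F: "\<And>n. F n \<in> borel_measurable config_space"
    "\<And>n \<sigma>. \<sigma> \<in> configs \<Longrightarrow> \<bar>f \<sigma> - F n \<sigma>\<bar> < 1 / real (Suc n)" by simp_all
  show ?thesis
  proof (rule borel_measurable_LIMSEQ_metric[OF F(1)])
    fix \<sigma> :: "'d config" assume "\<sigma> \<in> space config_space"
    then have \<sigma>: "\<sigma> \<in> configs" by (simp add: space_config_space)
    have "(\<lambda>n. F n \<sigma> - f \<sigma>) \<longlonglongrightarrow> 0"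
      by (rule Lim_null_comparison[OF _ LIMSEQ_inverse_real_of_nat])
         (use F(2)[OF \<sigma>] in \<open>auto intro!: always_eventually less_imp_le simp: abs_minus_commute inverse_eq_divide\<close>)
    then show "(\<lambda>n. F n \<sigma>) \<longlonglongrightarrow> f \<sigma>" by (rule LIM_zero_cancel)
  qed
qed

lemma topspace_weak_topology: "topspace weak_topology = space (prob_algebra config_space)"
proof -
  have "space (prob_algebra config_space) \<in> {{M \<in> space (prob_algebra config_space). (\<integral>\<sigma>. f \<sigma> \<partial>M) \<in> U} | f U.
        continuous_map config_top euclideanreal f \<and> bounded (f ` topspace config_top) \<and> open U}"
    by (intro CollectI exI[of _ "\<lambda>_. 0"] exI[of _ UNIV]) (auto simp: bounded_iff)
  then show ?thesis
    unfolding weak_topology_def topology_generated_by_topspace by blast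
qed

lemma openin_weak_topology_local:
  assumes "finite D" "local_on D F" "open U"
  shows "openin weak_topology {M \<in> space (prob_algebra config_space). (\<integral>\<sigma>. F \<sigma> \<partial>M) \<in> U}"
proof -
  obtain B where "\<And>\<sigma>. \<sigma> \<in> configs \<Longrightarrow> \<bar>F \<sigma>\<bar> \<le> B"
    using local_bounded[OF assms(1,2)] by blast
  then have "bounded (F ` topspace config_top)"
    by (auto simp: topspace_config_top bounded_iff)
  then show ?thesis
    unfolding weak_topology_def using local_continuous[OF assms(1,2)] assms(3)
    by (intro topology_generated_by_Basis) blast
qed

lemma weak_limit_local:
  assumes "limitin weak_topology Q M sequentially" "finite D" "local_on D F"
  shows "(\<lambda>n. \<integral>\<sigma>. F \<sigma> \<partial>Q n) \<longlonglongrightarrow> (\<integral>\<sigma>. F \<sigma> \<partial>M)"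
proof (rule topological_tendstoI)
  fix U assume U: "open U" "(\<integral>\<sigma>. F \<sigma> \<partial>M) \<in> U"
  have "M \<in> space (prob_algebra config_space)"
    using assms(1) by (simp add: limitin_def topspace_weak_topology)
  with U assms(1) openin_weak_topology_local[OF assms(2,3) U(1)]
  have "\<forall>\<^sub>F n in sequentially. Q n \<in> {M \<in> space (prob_algebra config_space). (\<integral>\<sigma>. F \<sigma> \<partial>M) \<in> U}"
    unfolding limitin_def by blast
  then show "\<forall>\<^sub>F n in sequentially. (\<integral>\<sigma>. F \<sigma> \<partial>Q n) \<in> U"
    by eventually_elim simp
qed

text \<open>Continuous functions are uniform limits of local ones, so local functions suffice to test weak
convergence.\<close>

lemma limitin_weak_topologyI:
  fixes M :: "'d::finite config measure"
  assumes M: "M \<in> space (prob_algebra config_space)" and Q: "\<And>n. Q n \<in> space (prob_algebra config_space)"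
    and loc: "\<And>D F. finite D \<Longrightarrow> local_on D F \<Longrightarrow> (\<lambda>n. \<integral>\<sigma>. F \<sigma> \<partial>Q n) \<longlonglongrightarrow> (\<integral>\<sigma>. F \<sigma> \<partial>M)"
  shows "limitin weak_topology Q M sequentially"
proof -
  have cont: "(\<lambda>n. \<integral>\<sigma>. f \<sigma> \<partial>Q n) \<longlonglongrightarrow> (\<integral>\<sigma>. f \<sigma> \<partial>M)"
    if f: "continuous_map config_top euclideanreal f" and b: "bounded (f ` topspace config_top)" for f
  proof (rule LIMSEQ_I)
    fix e :: real assume e: "0 < e"
    obtain B where B: "\<And>\<sigma>. \<sigma> \<in> configs \<Longrightarrow> \<bar>f \<sigma>\<bar> \<le> B"
      using b by (auto simp: topspace_config_top bounded_iff)
    obtain D F where F: "finite D" "local_on D F" "\<And>\<sigma>. \<sigma> \<in> configs \<Longrightarrow> \<bar>f \<sigma> - F \<sigma>\<bar> < e / 3"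
      using continuous_local_approximation[OF f, of "e / 3"] e by auto
    obtain C where C: "\<And>\<sigma>. \<sigma> \<in> configs \<Longrightarrow> \<bar>F \<sigma>\<bar> \<le> C"
      using local_bounded[OF F(1,2)] by blast
    have close: "\<bar>(\<integral>\<sigma>. f \<sigma> \<partial>P) - (\<integral>\<sigma>. F \<sigma> \<partial>P)\<bar> \<le> e / 3" if "P \<in> space (prob_algebra config_space)" for P
      using integral_config_close[OF that continuous_measurable[OF f] B local_measurable[OF F(1,2)] C]
        F(3) by (meson less_imp_le)
    obtain N where N: "\<And>n. n \<ge> N \<Longrightarrow> norm ((\<integral>\<sigma>. F \<sigma> \<partial>Q n) - (\<integral>\<sigma>. F \<sigma> \<partial>M)) < e / 3"
      using LIMSEQ_D[OF loc[OF F(1,2)], of "e / 3"] e by auto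
    have "norm ((\<integral>\<sigma>. f \<sigma> \<partial>Q n) - (\<integral>\<sigma>. f \<sigma> \<partial>M)) < e" if "n \<ge> N" for n
      using N[OF that] close[OF M] close[OF Q[of n]] by (simp only: real_norm_def)
    then show "\<exists>N. \<forall>n\<ge>N. norm ((\<integral>\<sigma>. f \<sigma> \<partial>Q n) - (\<integral>\<sigma>. f \<sigma> \<partial>M)) < e" by blast
  qed
  have "\<forall>\<^sub>F n in sequentially. Q n \<in> U" if "openin weak_topology U" "M \<in> U" for U
    using that unfolding weak_topology_def openin_topology_generated_by_iff
  proof (induction rule: generate_topology_on.induct)
    case (Int a b)
    then show ?case by (auto intro: eventually_conj)
  next
    case (UN K)
    then obtain k where "k \<in> K" "M \<in> k" "\<forall>\<^sub>F n in sequentially. Q n \<in> k" by blast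
    then show ?case by (auto elim: eventually_mono)
  next
    case (Basis s)
    then obtain f U where s: "s = {M \<in> space (prob_algebra config_space). (\<integral>\<sigma>. f \<sigma> \<partial>M) \<in> U}"
      "continuous_map config_top euclideanreal f" "bounded (f ` topspace config_top)" "open U" by blast
    then have "(\<integral>\<sigma>. f \<sigma> \<partial>M) \<in> U" using Basis by simp
    from topological_tendstoD[OF cont[OF s(2,3)] s(4) this] show ?case
      using Q by (simp add: s(1))
  qed simp
  then show ?thesis using M by (simp add: limitin_def topspace_weak_topology)
qed

text \<open>Local functions separate measures, so points are closed.\<close>

lemma closure_of_weak_singleton:
  fixes M :: "'d::finite config measure"
  assumes "M \<in> space (prob_algebra config_space)"
  shows "weak_topology closure_of {M} = {M}"
proof (intro equalityI subsetI)
  fix x assume "x \<in> weak_topology closure_of {M}"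
  then have x: "x \<in> space (prob_algebra config_space)"
    and op: "\<And>U. x \<in> U \<Longrightarrow> openin weak_topology U \<Longrightarrow> M \<in> U"
    by (auto simp: in_closure_of topspace_weak_topology)
  have "x = M"
  proof (rule prob_measure_eqI[OF x assms])
    fix D and F :: "'d config \<Rightarrow> real" assume F: "finite D" "local_on D F"
    show "(\<integral>\<sigma>. F \<sigma> \<partial>x) = (\<integral>\<sigma>. F \<sigma> \<partial>M)"
      using op[OF _ openin_weak_topology_local[OF F, of "- {\<integral>\<sigma>. F \<sigma> \<partial>M}"]] x by auto
  qed
  then show "x \<in> {M}" by simp
next
  fix x assume "x \<in> {M}"
  then show "x \<in> weak_topology closure_of {M}"
    using assms closure_of_subset[of "{M}" weak_topology] by (auto simp: topspace_weak_topology)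
qed

lemma measure_convex_hull_singleton:
  assumes M: "M \<in> space (prob_algebra config_space)"
  shows "measure_convex_hull {M} = {M}"
proof (intro equalityI subsetI)
  fix x assume "x \<in> measure_convex_hull {M}"
  then obtain n w N where x: "x \<in> space (prob_algebra config_space)"
    and w: "\<forall>k<n. 0 \<le> w k \<and> N k \<in> {M}" "(\<Sum>k<n. w k) = (1::real)"
    "\<forall>A\<in>sets config_space. measure x A = (\<Sum>k<(n::nat). w k * measure (N k) A)"
    unfolding measure_convex_hull_def by blast
  interpret M: prob_space M by (rule prob_algebra_configD(2)[OF M])
  interpret x: prob_space x by (rule prob_algebra_configD(2)[OF x])
  have "x = M"
  proof (rule measure_eqI)
    show "sets x = sets M" using prob_algebra_configD(1)[OF x] prob_algebra_configD(1)[OF M] by simp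
    fix A assume "A \<in> sets x"
    then have "A \<in> sets config_space" using prob_algebra_configD(1)[OF x] by simp
    then have "measure x A = (\<Sum>k<n. w k * measure (N k) A)" using w(3) by blast
    also have "\<dots> = (\<Sum>k<n. w k) * measure M A"
      unfolding sum_distrib_right using w(1) by (intro sum.cong) auto
    finally show "emeasure x A = emeasure M A"
      by (simp add: w(2) M.emeasure_eq_measure x.emeasure_eq_measure)
  qed
  then show "x \<in> {M}" by simp
next
  fix x assume "x \<in> {M}"
  then show "x \<in> measure_convex_hull {M}"
    using M unfolding measure_convex_hull_def
    by (intro CollectI conjI exI[of _ "1::nat"] exI[of _ "\<lambda>_. 1::real"] exI[of _ "\<lambda>_. M"]) auto
qed

section \<open>Existence and uniqueness of the limit measure\<close>

lemma integral_point_distr: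
  fixes f :: "'b \<Rightarrow> real"
  assumes "finite A" "\<And>a. a \<in> A \<Longrightarrow> 0 \<le> w a" "\<And>a. a \<in> A \<Longrightarrow> \<phi> a \<in> space N"
    and "f \<in> borel_measurable N"
  shows "(\<integral>x. f x \<partial>distr (point_measure A (\<lambda>a. ennreal (w a))) N \<phi>) = (\<Sum>a\<in>A. w a * f (\<phi> a))"
proof -
  have "\<phi> \<in> measurable (point_measure A (\<lambda>a. ennreal (w a))) N" using assms(3) by simp
  then show ?thesis
    using assms by (simp add: integral_distr lebesgue_integral_point_measure_finite)
qed

lemma prob_space_point_distr:
  assumes "finite A" "\<And>a. a \<in> A \<Longrightarrow> 0 \<le> w a" "\<And>a. a \<in> A \<Longrightarrow> \<phi> a \<in> space N"
    and "(\<Sum>a\<in>A. w a) = 1"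
  shows "prob_space (distr (point_measure A (\<lambda>a. ennreal (w a))) N \<phi>)"
proof (rule prob_space.prob_space_distr)
  show "prob_space (point_measure A (\<lambda>a. ennreal (w a)))"
  proof (rule prob_spaceI)
    show "emeasure (point_measure A (\<lambda>a. ennreal (w a))) (space (point_measure A (\<lambda>a. ennreal (w a)))) = 1"
      using assms by (simp add: space_point_measure emeasure_point_measure_finite)
  qed
  show "\<phi> \<in> measurable (point_measure A (\<lambda>a. ennreal (w a))) N" using assms(3) by simp
qed

lemma measure_point_distr:
  assumes "finite A" "\<And>a. a \<in> A \<Longrightarrow> 0 \<le> w a" "\<And>a. a \<in> A \<Longrightarrow> \<phi> a \<in> space N" and X: "X \<in> sets N"
  shows "measure (distr (point_measure A (\<lambda>a. ennreal (w a))) N \<phi>) X = (\<Sum>a\<in>A. w a * indicator X (\<phi> a))"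
proof -
  have "X \<inter> space N = X" using sets.sets_into_space[OF X] by blast
  then show ?thesis
    using integral_point_distr[OF assms(1-3), where f = "indicator X"] X by simp
qed

lemma boltzmann_weight:
  assumes "finite V" "\<sigma> \<in> bc_configs V \<mu>"
  shows "exp (- \<beta> * hamiltonian J h V \<mu> \<sigma>) = exp (energy (\<beta> * J) (\<lambda>i. \<beta> * h i) V \<sigma>)"
  unfolding hamiltonian_eq_energy[OF assms] energy_def
  by (simp add: sum_distrib_left[symmetric] mult.assoc algebra_simps)

lemma
  assumes V: "finite V" and \<mu>: "\<mu> \<in> configs"
  shows gibbs_measure_prob_algebra: "gibbs_measure \<beta> J h V \<mu> \<in> space (prob_algebra config_space)"
    and integral_gibbs_measure: "f \<in> borel_measurable config_space \<Longrightarrow>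
      (\<integral>\<sigma>. f \<sigma> \<partial>gibbs_measure \<beta> J h V \<mu>) = gexp (\<beta> * J) (\<lambda>i. \<beta> * h i) V \<mu> f"
proof -
  let ?w = "\<lambda>\<sigma>. exp (- \<beta> * hamiltonian J h V \<mu> \<sigma>) / partition_fun \<beta> J h V \<mu>"
  have fin: "finite (bc_configs V \<mu>)" by (rule finite_bc_configs[OF V \<mu>])
  have Z: "partition_fun \<beta> J h V \<mu> = gsum (\<beta> * J) (\<lambda>i. \<beta> * h i) V \<mu> (\<lambda>_. 1)"
    unfolding partition_fun_def gsum_def by (intro sum.cong refl) (simp only: boltzmann_weight[OF V] mult_1)
  have Zpos: "0 < partition_fun \<beta> J h V \<mu>" unfolding Z by (rule gsum_one_pos[OF V \<mu>])
  have w: "0 \<le> ?w \<sigma>" for \<sigma> using Zpos by simp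
  have sp: "\<sigma> \<in> space config_space" if "\<sigma> \<in> bc_configs V \<mu>" for \<sigma>
    using that bc_configs_subset space_config_space by blast
  have "(\<Sum>\<sigma>\<in>bc_configs V \<mu>. ?w \<sigma>) = 1"
    using Zpos by (simp add: sum_divide_distrib[symmetric] partition_fun_def)
  from prob_space_point_distr[OF fin w sp this]
  show "gibbs_measure \<beta> J h V \<mu> \<in> space (prob_algebra config_space)"
    by (simp add: space_prob_algebra gibbs_measure_def)
  show "(\<integral>\<sigma>. f \<sigma> \<partial>gibbs_measure \<beta> J h V \<mu>) = gexp (\<beta> * J) (\<lambda>i. \<beta> * h i) V \<mu> f"
    if f: "f \<in> borel_measurable config_space"
  proof -
    have "(\<integral>\<sigma>. f \<sigma> \<partial>gibbs_measure \<beta> J h V \<mu>) = (\<Sum>\<sigma>\<in>bc_configs V \<mu>. ?w \<sigma> * f \<sigma>)"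
      unfolding gibbs_measure_def by (rule integral_point_distr[OF fin w sp f])
    also have "\<dots> = (\<Sum>\<sigma>\<in>bc_configs V \<mu>. f \<sigma> * exp (energy (\<beta> * J) (\<lambda>i. \<beta> * h i) V \<sigma>)) / partition_fun \<beta> J h V \<mu>"
      unfolding sum_divide_distrib by (intro sum.cong refl) (simp only: boltzmann_weight[OF V] times_divide_eq_left times_divide_eq_right mult.commute)
    finally show ?thesis by (simp add: gexp_def gsum_def Z)
  qed
qed

lemma local_on_cylinder:
  assumes "S \<subseteq> D"
  shows "local_on D (cylinder S (D - S))"
  unfolding local_on_def
proof (intro ballI impI)
  fix \<sigma> \<tau> :: "'a config" assume "\<forall>i\<in>D. \<sigma> i = \<tau> i"
  then show "cylinder S (D - S) \<sigma> = cylinder S (D - S) \<tau>"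
    unfolding cylinder_def using assms by (intro arg_cong2[where f = "(*)"] prod.cong) auto
qed

text \<open>The limits of the cylinder probabilities form a consistent family of finite-dimensional distributions,
and Kolmogorov's extension theorem yields the measure. The extension theorem is stated for products of
Polish spaces whose topology is a type class, so it is applied to the product of copies of the reals
and the result is mapped back to signs.\<close>

lemma exists_local_limit_measure:
  fixes h :: "int ^ 'd \<Rightarrow> real"
  assumes conv: "\<And>A. finite A \<Longrightarrow> \<exists>p. ((\<lambda>(V, \<mu>). gexp J h V \<mu> (cylinder A {})) \<longlongrightarrow> p) volumes"
  obtains M where "M \<in> space (prob_algebra config_space)"
    "\<And>D F. finite D \<Longrightarrow> local_on D F \<Longrightarrow> (\<integral>\<sigma>. F \<sigma> \<partial>M) = local_limit J h F"
proof -
  let ?L = "local_limit J h"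
  define p where "p D S = ?L (cylinder S (D - S))" for D S
  let ?N = "\<lambda>_ :: int ^ 'd. borel :: real measure"
  note lim = tendsto_local_limit[OF _ _ conv]
  have expansion: "?L F = (\<Sum>S\<in>Pow D. p D S * F (sign_config S))" if D: "finite D" and F: "local_on D F" for D F
  proof (rule tendsto_unique[OF volumes_neq_bot lim[OF D F]])
    have "gexp J h V \<mu> F = (\<Sum>S\<in>Pow D. gexp J h V \<mu> (cylinder S (D - S)) * F (sign_config S))" for V \<mu>
      by (subst gexp_cong[OF local_expansion[OF D F]]) (simp_all add: gexp_sum gexp_mult mult.commute)
    moreover have "((\<lambda>x. \<Sum>S\<in>Pow D. (case x of (V, \<mu>) \<Rightarrow> gexp J h V \<mu> (cylinder S (D - S))) * F (sign_config S))
      \<longlongrightarrow> (\<Sum>S\<in>Pow D. p D S * F (sign_config S))) volumes"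
      unfolding p_def
    proof (intro tendsto_sum tendsto_mult_right)
      fix S assume "S \<in> Pow D"
      then show "((\<lambda>x. case x of (V, \<mu>) \<Rightarrow> gexp J h V \<mu> (cylinder S (D - S))) \<longlongrightarrow> ?L (cylinder S (D - S))) volumes"
        using lim[OF D local_on_cylinder] by simp
    qed
    ultimately show "((\<lambda>(V, \<mu>). gexp J h V \<mu> F) \<longlongrightarrow> (\<Sum>S\<in>Pow D. p D S * F (sign_config S))) volumes"
      by (simp add: case_prod_beta')
  qed
  have p0: "0 \<le> p D S" if D: "finite D" and S: "S \<in> Pow D" for D S
    unfolding p_def
  proof (rule tendsto_lowerbound[OF lim[OF D local_on_cylinder] _ volumes_neq_bot])
    have fin: "finite S" "finite (D - S)" using S D finite_subset[of S D] by auto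
    show "\<forall>\<^sub>F x in volumes. 0 \<le> (case x of (V, \<mu>) \<Rightarrow> gexp J h V \<mu> (cylinder S (D - S)))"
    proof (rule eventually_volumes[of "{}"], simp)
      fix V :: "(int ^ 'd) set" and \<mu> :: "'d config" assume "finite V" "\<mu> \<in> configs"
      have "0 \<le> gsum J h V \<mu> (cylinder S (D - S))" "0 \<le> gsum J h V \<mu> (\<lambda>_. 1)"
        unfolding gsum_def using fin bc_configs_subset[of V \<mu>]
        by (auto intro!: sum_nonneg mult_nonneg_nonneg simp: cylinder_configs subset_iff)
      then show "0 \<le> (case (V, \<mu>) of (V, \<mu>) \<Rightarrow> gexp J h V \<mu> (cylinder S (D - S)))"
        by (simp add: gexp_def)
    qed
  qed (use S in simp)
  have p1: "(\<Sum>S\<in>Pow D. p D S) = 1" if D: "finite D" for D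
  proof -
    have loc: "local_on D (\<lambda>_. 1)" by (simp add: local_on_def)
    have "((\<lambda>(V, \<mu>). gexp J h V \<mu> (\<lambda>_. 1)) \<longlongrightarrow> 1) volumes"
      by (rule tendsto_eventually, rule eventually_volumes[of "{}"]) (auto simp: gexp_const)
    from tendsto_unique[OF volumes_neq_bot lim[OF D loc] this] show ?thesis
      using expansion[OF D loc] by simp
  qed
  let ?r = "\<lambda>D S. restrict (sign_config S) D"
  define P where "P D = distr (point_measure (Pow D) (\<lambda>S. ennreal (p D S))) (PiM D ?N) (?r D)" for D
  have sp: "?r D S \<in> space (PiM D ?N)" for D S by (simp add: space_PiM)
  have probP: "prob_space (P D)" if "finite D" for D
    unfolding P_def using that by (intro prob_space_point_distr p0 p1 sp) auto
  have locX: "local_on D (\<lambda>\<sigma>. indicator X (restrict \<sigma> D))" for D :: "(int ^ 'd) set" and X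
    unfolding local_on_def
  proof (intro ballI impI)
    fix \<sigma> \<tau> :: "'d config" assume "\<forall>i\<in>D. \<sigma> i = \<tau> i"
    then have "restrict \<sigma> D = restrict \<tau> D" by (auto simp: restrict_def)
    then show "(indicator X (restrict \<sigma> D) :: real) = indicator X (restrict \<tau> D)" by simp
  qed
  have measP: "measure (P D) X = ?L (\<lambda>\<sigma>. indicator X (restrict \<sigma> D))"
    if D: "finite D" and X: "X \<in> sets (PiM D ?N)" for D X
    unfolding P_def expansion[OF D locX]
    by (rule measure_point_distr) (use D X in \<open>auto intro: p0 sp\<close>)
  interpret polish_projective UNIV P
  proof (rule polish_projective.intro, rule projective_family.intro)
    fix D H :: "(int ^ 'd) set" assume DH: "D \<subseteq> H" "finite H"
    then have D: "finite D" using finite_subset by blast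
    interpret PD: prob_space "P D" by (rule probP[OF D])
    interpret PH: prob_space "P H" by (rule probP[OF DH(2)])
    have setsP: "sets (P D) = sets (PiM D ?N)" for D by (simp add: P_def)
    have m: "(\<lambda>f. restrict f D) \<in> measurable (P H) (PiM D ?N)"
      unfolding measurable_cong_sets[OF setsP refl] by (rule measurable_restrict_subset[OF DH(1)])
    interpret PR: prob_space "distr (P H) (PiM D ?N) (\<lambda>f. restrict f D)"
      by (rule PH.prob_space_distr[OF m])
    show "P D = distr (P H) (PiM D ?N) (\<lambda>f. restrict f D)"
    proof (rule measure_eqI)
      fix X assume "X \<in> sets (P D)"
      then have X: "X \<in> sets (PiM D ?N)" by (simp add: setsP)
      let ?Y = "(\<lambda>f. restrict f D) -` X \<inter> space (PiM H ?N)"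
      have Y: "?Y \<in> sets (PiM H ?N)"
        by (rule measurable_sets[OF measurable_restrict_subset[OF DH(1)] X])
      have "measure (distr (P H) (PiM D ?N) (\<lambda>f. restrict f D)) X = measure (P H) ?Y"
        using measure_distr[OF m X] sets_eq_imp_space_eq[OF setsP[of H]] by simp
      also have "\<dots> = ?L (\<lambda>\<sigma>. indicator ?Y (restrict \<sigma> H))" by (rule measP[OF DH(2) Y])
      also have "(\<lambda>\<sigma>. indicator ?Y (restrict \<sigma> H) :: real) = (\<lambda>\<sigma>. indicator X (restrict \<sigma> D))"
        using DH(1) by (auto simp: fun_eq_iff indicator_def space_PiM Int_absorb1)
      also have "?L \<dots> = measure (P D) X" by (rule measP[OF D X, symmetric])
      finally show "emeasure (P D) X = emeasure (distr (P H) (PiM D ?N) (\<lambda>f. restrict f D)) X"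
        unfolding PD.emeasure_eq_measure PR.emeasure_eq_measure by (simp only:)
    qed (simp add: setsP)
  next
    fix D :: "(int ^ 'd) set" assume "finite D"
    then show "prob_space (P D)" by (rule probP)
  qed
  \<comment> \<open>the extension lives on real sequences; \<open>s\<close> rounds them to signs and fixes \<open>-1\<close> and \<open>1\<close>\<close>
  define s :: "real \<Rightarrow> real" where "s x = (if x = 1 then 1 else -1)" for x
  define \<rho> where "\<rho> D f = (\<lambda>i. if i \<in> D then s (f i) else 1)" for D and f :: "int ^ 'd \<Rightarrow> real"
  have s: "s \<in> measurable borel (count_space {-1, 1})"
    unfolding s_def[abs_def] by measurable
  have \<rho>: "\<rho> D \<in> measurable (PiM D ?N) config_space" for D
    unfolding config_space_def \<rho>_def[abs_def]
  proof (rule measurable_PiM_single')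
    show "(\<lambda>f. if i \<in> D then s (f i) else 1) \<in> measurable (PiM D ?N) (count_space {-1, 1})" for i
    proof (cases "i \<in> D")
      case True
      then show ?thesis
        using measurable_compose[OF measurable_component_singleton[OF True] s] by simp
    qed simp
  qed (auto simp: s_def)
  have \<rho>conf: "\<rho> D f \<in> configs" for D f by (simp add: \<rho>_def s_def configs_def)
  have measurable_UNIV: "\<rho> UNIV \<in> measurable lim config_space"
    using \<rho>[of UNIV] unfolding measurable_cong_sets[OF sets_lim refl] .
  define M where "M = distr lim config_space (\<rho> UNIV)"
  have "M \<in> space (prob_algebra config_space)"
    unfolding M_def space_prob_algebra using P.prob_space_distr[OF measurable_UNIV] by simp
  moreover have "(\<integral>\<sigma>. F \<sigma> \<partial>M) = ?L F" if D: "finite D" and F: "local_on D F" for D F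
  proof -
    have Fm: "F \<in> borel_measurable config_space" by (rule local_measurable[OF D F])
    have r: "(\<lambda>f. restrict f D) \<in> measurable lim (PiM D ?N)"
      unfolding measurable_cong_sets[OF sets_lim refl] by (rule measurable_restrict_subset) simp
    have marginal: "distr lim (PiM D ?N) (\<lambda>f. restrict f D) = P D"
    proof (rule measure_eqI)
      show "sets (distr lim (PiM D ?N) (\<lambda>f. restrict f D)) = sets (P D)" by (simp add: P_def)
      fix X assume "X \<in> sets (distr lim (PiM D ?N) (\<lambda>f. restrict f D))"
      then have X: "X \<in> sets (PiM D ?N)" by simp
      have "(\<lambda>f. restrict f D) -` X \<inter> space lim = prod_emb UNIV ?N D X"
        by (simp add: prod_emb_def space_PiM)
      then show "emeasure (distr lim (PiM D ?N) (\<lambda>f. restrict f D)) X = emeasure (P D) X"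
        using emeasure_distr[OF r X] emeasure_lim_emb[OF _ D X] by simp
    qed
    have "(\<integral>\<sigma>. F \<sigma> \<partial>M) = (\<integral>f. F (\<rho> UNIV f) \<partial>lim)"
      unfolding M_def by (rule integral_distr[OF measurable_UNIV Fm])
    also have "\<dots> = (\<integral>f. F (\<rho> D (restrict f D)) \<partial>lim)"
    proof (intro Bochner_Integration.integral_cong refl)
      fix f :: "int ^ 'd \<Rightarrow> real"
      have "\<forall>i\<in>D. \<rho> UNIV f i = \<rho> D (restrict f D) i" by (simp add: \<rho>_def)
      then show "F (\<rho> UNIV f) = F (\<rho> D (restrict f D))"
        using F \<rho>conf unfolding local_on_def by blast
    qed
    also have "\<dots> = (\<integral>f. F (\<rho> D f) \<partial>P D)"
      unfolding marginal[symmetric] by (rule integral_distr[OF r measurable_compose[OF \<rho> Fm], symmetric])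
    also have "\<dots> = (\<Sum>S\<in>Pow D. p D S * F (\<rho> D (?r D S)))"
      unfolding P_def by (rule integral_point_distr[OF _ p0 sp measurable_compose[OF \<rho> Fm]]) (use D in auto)
    also have "\<dots> = (\<Sum>S\<in>Pow D. p D S * F (sign_config S))"
    proof (intro sum.cong refl arg_cong2[where f = "(*)"])
      fix S
      have "\<forall>i\<in>D. \<rho> D (?r D S) i = sign_config S i" by (simp add: \<rho>_def s_def sign_config_def)
      then show "F (\<rho> D (?r D S)) = F (sign_config S)"
        using F \<rho>conf sign_config_configs unfolding local_on_def by blast
    qed
    also have "\<dots> = ?L F" by (rule expansion[OF D F, symmetric])
    finally show ?thesis .
  qed
  ultimately show ?thesis by (rule that)
qed

text \<open>Uniform convergence of local expectations determines every weak limit, and the limit measure is itself a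
weak limit along boxes. Convex hull and closure add nothing to a single measure.\<close>

theorem ising_gibbs_measures_singleton:
  fixes h :: "int ^ 'd \<Rightarrow> real"
  assumes conv: "\<And>A. finite A \<Longrightarrow>
    \<exists>p. ((\<lambda>(V, \<mu>). gexp (\<beta> * J) (\<lambda>i. \<beta> * h i) V \<mu> (cylinder A {})) \<longlongrightarrow> p) volumes"
  shows "is_singleton (ising_gibbs_measures \<beta> J h)"
proof -
  let ?L = "local_limit (\<beta> * J) (\<lambda>i. \<beta> * h i)"
  obtain M where M: "M \<in> space (prob_algebra config_space)"
    "\<And>D F. finite D \<Longrightarrow> local_on D F \<Longrightarrow> (\<integral>\<sigma>. F \<sigma> \<partial>M) = ?L F"
    using exists_local_limit_measure[OF conv] by blast
  have lim: "(\<lambda>n. \<integral>\<sigma>. F \<sigma> \<partial>gibbs_measure \<beta> J h (V n) (\<mu> n)) \<longlonglongrightarrow> ?L F"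
    if V: "\<And>n. finite (V n)" "incseq V" "(\<Union>n. V n) = UNIV" "\<And>n. \<mu> n \<in> configs"
      and F: "finite D" "local_on D F" for V \<mu> D F
  proof -
    have "(\<integral>\<sigma>. F \<sigma> \<partial>gibbs_measure \<beta> J h (V n) (\<mu> n)) =
        (\<lambda>(V, \<mu>). gexp (\<beta> * J) (\<lambda>i. \<beta> * h i) V \<mu> F) (V n, \<mu> n)" for n
      using integral_gibbs_measure[OF V(1,4) local_measurable[OF F]] by simp
    then show ?thesis
      using filterlim_compose[OF tendsto_local_limit[OF F conv] filterlim_volumes[OF V]] by simp
  qed
  have "weak_gibbs_limits \<beta> J h = {M}"
  proof (intro equalityI subsetI)
    fix Q assume "Q \<in> weak_gibbs_limits \<beta> J h"
    then obtain V \<mu> where V: "\<And>n. finite (V n)" "incseq V" "(\<Union>n. V n) = UNIV" "\<And>n. \<mu> n \<in> configs"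
      and Q: "limitin weak_topology (\<lambda>n. gibbs_measure \<beta> J h (V n) (\<mu> n)) Q sequentially"
      unfolding weak_gibbs_limits_def by blast
    have Q': "Q \<in> space (prob_algebra config_space)"
      using Q by (simp add: limitin_def topspace_weak_topology)
    have "Q = M"
    proof (rule prob_measure_eqI[OF Q' M(1)])
      fix D and F :: "'d config \<Rightarrow> real" assume F: "finite D" "local_on D F"
      show "(\<integral>\<sigma>. F \<sigma> \<partial>Q) = (\<integral>\<sigma>. F \<sigma> \<partial>M)"
        unfolding M(2)[OF F] by (rule LIMSEQ_unique[OF weak_limit_local[OF Q F] lim[OF V F]])
    qed
    then show "Q \<in> {M}" by simp
  next
    fix Q assume "Q \<in> {M}"
    define V where "V n = lattice_box n (0 :: int ^ 'd)" for n
    have V: "\<And>n. finite (V n)" "incseq V" "(\<Union>n. V n) = UNIV" "\<And>n::nat. (\<lambda>_. 1) \<in> configs"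
    proof -
      show "finite (V n)" for n by (simp add: V_def finite_lattice_box)
      show "incseq V" by (auto simp: incseq_def V_def lattice_box_def intro: order_trans)
      have "\<exists>n. x \<in> V n" for x
      proof -
        have "\<bar>x $ k\<bar> \<le> int (nat (\<Sum>k\<in>UNIV. \<bar>x $ k\<bar>))" for k
        proof -
          have "\<bar>x $ k\<bar> \<le> (\<Sum>k\<in>UNIV. \<bar>x $ k\<bar>)" by (rule member_le_sum) auto
          then show ?thesis by simp
        qed
        then show ?thesis by (intro exI[of _ "nat (\<Sum>k\<in>UNIV. \<bar>x $ k\<bar>)"]) (simp add: V_def lattice_box_def)
      qed
      then show "(\<Union>n. V n) = UNIV" by blast
    qed (rule plus_config)
    have "limitin weak_topology (\<lambda>n. gibbs_measure \<beta> J h (V n) (\<lambda>_. 1)) M sequentially"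
    proof (rule limitin_weak_topologyI[OF M(1)])
      show "gibbs_measure \<beta> J h (V n) (\<lambda>_. 1) \<in> space (prob_algebra config_space)" for n
        by (rule gibbs_measure_prob_algebra[OF V(1) plus_config])
      fix D and F :: "'d config \<Rightarrow> real" assume F: "finite D" "local_on D F"
      show "(\<lambda>n. \<integral>\<sigma>. F \<sigma> \<partial>gibbs_measure \<beta> J h (V n) (\<lambda>_. 1)) \<longlonglongrightarrow> (\<integral>\<sigma>. F \<sigma> \<partial>M)"
        unfolding M(2)[OF F] by (rule lim[OF V F])
    qed
    then have "M \<in> weak_gibbs_limits \<beta> J h"
      unfolding weak_gibbs_limits_def using V
      by (intro CollectI exI[of _ V] exI[of _ "\<lambda>_ _. 1"]) blast
    with \<open>Q \<in> {M}\<close> show "Q \<in> weak_gibbs_limits \<beta> J h" by simp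
  qed
  then have "ising_gibbs_measures \<beta> J h = {M}"
    unfolding ising_gibbs_measures_def
    by (simp add: measure_convex_hull_singleton[OF M(1)] closure_of_weak_singleton[OF M(1)])
  then show ?thesis by (simp add: is_singleton_def)
qed

theorem mainTheorem1:
  fixes N :: "real ^ 'd \<Rightarrow> real" and J hs \<alpha> \<beta> :: real
  assumes "is_norm N" and "J > 0" and "hs > 0" and "0 \<le> \<alpha>" and "\<alpha> < 1" and "\<beta> > 0"
  shows "is_singleton (ising_gibbs_measures \<beta> J (decaying_field N hs \<alpha>))"
proof (rule ising_gibbs_measures_singleton)
  let ?h = "\<lambda>i. \<beta> * decaying_field N hs \<alpha> i"
  have J: "0 \<le> \<beta> * J" using assms by simp
  have h0: "0 \<le> ?h i" for i using assms by (simp add: decaying_field_def)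
  fix A :: "(int ^ 'd) set" assume A: "finite A"
  show "\<exists>p. ((\<lambda>(V, \<mu>). gexp (\<beta> * J) ?h V \<mu> (cylinder A {})) \<longlongrightarrow> p) volumes"
  proof (rule cylinder_converges[OF J A])
    fix i :: "int ^ 'd" and e :: real assume e: "0 < e"
    obtain K where K: "0 < K"
      "\<And>n j. j \<in> lattice_box (2 * n) i \<Longrightarrow> K / real (n + 1) powr \<alpha> \<le> decaying_field N hs \<alpha> j"
      using decaying_field_lower_bound[OF assms(1,3,4), of i] by blast
    have "\<beta> * K / real (n + 1) powr \<alpha> \<le> ?h j" if "j \<in> lattice_box (2 * n) i" for n j
      using mult_left_mono[OF K(2)[OF that], of \<beta>] assms(6) by simp
    then have "(\<lambda>n. gap (\<beta> * J) ?h (lattice_box (2 * n) i) i) \<longlonglongrightarrow> 0"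
      by (intro gap_tendsto_zero[OF J mult_pos_pos[OF assms(6) K(1)] assms(5) h0])
    then have "\<forall>\<^sub>F n in sequentially. gap (\<beta> * J) ?h (lattice_box (2 * n) i) i < e"
      using e by (rule order_tendstoD)
    then obtain n where "gap (\<beta> * J) ?h (lattice_box (2 * n) i) i < e"
      by (auto simp: eventually_sequentially)
    then show "\<exists>V. finite V \<and> gap (\<beta> * J) ?h V i < e" using finite_lattice_box by blast
  qed
qed

end
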